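(* Assume the setting described in the context, including the Generalized Kreiss Condition. Then there exists a full-rank constant $n_1^+\times n^+$ matrix $B_o$ (independent of $\xi$ and $\omega$) such that the relation $$B_oB_u\,\bar u(t,0,\hat x)=B_o\,b(t,\hat x),$$ as a boundary condition at $x_1=0$ for the equilibrium system $\bar u_t+A_{11}\bar u_{x_1}+\sum_{j=2}^dA_{j11}\bar u_{x_j}=0$, satisfies $$B_oB_uP_0=0$$ and the Uniform Kreiss Condition for characteristic initial-boundary-value problems: there is a constant $c>0$ such that $$\bigl|\det\{B_oB_uP_1R_{11}^S\}\bigr|\ \ge\ c\,\sqrt{\det\{R_{11}^{S*}R_{11}^S\}}$$ for all $\xi\in\mathbb C$ with $\mathrm{Re}\,\xi>0$ and all $\omega\in\mathbb R^{d-1}$, where $R_{11}^S=R_{11}^S(\xi,\omega)$ is a right-stable matrix of $M_1(\xi,\omega)$.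
   Context: Superscript $*$ is the transpose (conjugate transpose for complex matrices). A square matrix is stable (unstable) if all its eigenvalues have negative (positive) real part. If an $m\times m$ matrix $X$ has exactly $k$ eigenvalues (with algebraic multiplicity) with negative real part, a right-stable matrix of $X$ is a full-rank $m\times k$ matrix $R$ such that $XR=RX^S$ with $X^S$ a stable $k\times k$ matrix. Setting. For a small parameter $\epsilon>0$ consider $U_t+\sum_{j=1}^dA_jU_{x_j}=QU/\epsilon$ for $x_1>0$, $\hat x=(x_2,\dots,x_d)\in\mathbb R^{d-1}$, $t>0$, $U\in\mathbb R^n$, with boundary condition $BU(t,0,\hat x)=b(t,\hat x)$. Here $A_1,\dots,A_d$ are constant real symmetric $n\times n$ matrices and $Q=\mathrm{diag}(0_{n-r},S)$ with $S$ a real symmetric negative definite $r\times r$ matrix. In the same block partition, $A_1=\begin{pmatrix}A_{11}&A_{12}\\ A_{12}^*&A_{22}\end{pmatrix}$, $A_j=\begin{pmatrix}A_{j11}&A_{j12}\\ A_{j12}^*&A_{j22}\end{pmatrix}$ for $j\ge2$, and $B=(B_u,B_v)$ with $B_u$ having $n-r$ columns. $A_1$ is invertible, while $A_{11}$ is singular. Let $n^+$ be the number of positive eigenvalues of $A_1$, $n_1^+$ the number of positive eigenvalues of $A_{11}$, and $n_1^o\ge1$ the multiplicity of the eigenvalue $0$ of $A_{11}$. $B$ is a constant full-rank $n^+\times n$ matrix. $P_1$ of size $(n-r)\times(n-r-n_1^o)$ and $P_0$ of size $(n-r)\times n_1^o$ are real matrices such that $(P_1,P_0)$ is orthogonal and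 $(P_1,P_0)^*A_{11}(P_1,P_0)=\mathrm{diag}(\Lambda_1,0)$ with $\Lambda_1$ an invertible diagonal matrix. Generalized Kreiss Condition (GKC). For $\eta\ge0$, $\mathrm{Re}\,\xi>0$, $\omega=(\omega_2,\dots,\omega_d)\in\mathbb R^{d-1}$, put $M(\xi,\omega,\eta)=A_1^{-1}\bigl(\eta Q-\xi I_n-i\sum_{j=2}^d\omega_jA_j\bigr)$. This matrix has exactly $n^+$ eigenvalues with negative real part; let $R_M^S(\xi,\omega,\eta)$ be a right-stable matrix ($n\times n^+$) of it. The GKC: there is $c_K>0$ such that $|\det\{BR_M^S(\xi,\omega,\eta)\}|\ge c_K\sqrt{\det\{R_M^{S*}(\xi,\omega,\eta)R_M^S(\xi,\omega,\eta)\}}$ for all $\eta\ge0$, $\omega\in\mathbb R^{d-1}$ and $\xi$ with $\mathrm{Re}\,\xi>0$. Let $C(\omega)=i\sum_{j=2}^d\omega_jA_{j11}$, $C_{kl}(\omega)=P_k^*C(\omega)P_l$ for $k,l\in\{0,1\}$, and $$M_1(\xi,\omega)=-\Lambda_1^{-1}\Bigl([\xi I+C_{11}(\omega)]-C_{10}(\omega)[\xi I+C_{00}(\omega)]^{-1}C_{01}(\omega)\Bigr).$$ $M_1(\xi,\omega)$ has exactly $n_1^+$ eigenvalues with negative real part when $\mathrm{Re}\,\xi>0$. *)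

theory Defs
  imports
    "Jordan_Normal_Form.Spectral_Radius"
    "Jordan_Normal_Form.Schur_Decomposition"
    "Jordan_Normal_Form.Gauss_Jordan_Elimination"
    "Jordan_Normal_Form.DL_Rank"
begin

text \<open>
  Matrices have explicit dimensions that may be \<open>0\<close>: the blocks of size \<open>n\<^sub>1\<^sup>+\<close> and
  \<open>n - r - n\<^sub>1\<^sup>o\<close> can be empty. The determinant of an empty matrix is \<open>1\<close>.
\<close>

abbreviation cmat :: "real mat \<Rightarrow> complex mat" where
  "cmat \<equiv> map_mat complex_of_real"

definition append_cols :: "'a :: zero mat \<Rightarrow> 'a mat \<Rightarrow> 'a mat" where
  "append_cols A B =
     four_block_mat A B (0\<^sub>m 0 (dim_col A)) (0\<^sub>m 0 (dim_col B))"

text \<open>The inverse is meaningful only for an invertible square matrix.\<close>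

definition minv :: "'a :: field mat \<Rightarrow> 'a mat" where
  "minv A = the (mat_inverse A)"

definition full_rank :: "'a :: field mat \<Rightarrow> bool" where
  "full_rank A \<longleftrightarrow> vec_space.rank (dim_row A) A = min (dim_row A) (dim_col A)"

definition negative_definite :: "real mat \<Rightarrow> bool" where
  "negative_definite S \<longleftrightarrow>
     (\<forall>v \<in> carrier_vec (dim_row S). v \<noteq> 0\<^sub>v (dim_row S) \<longrightarrow> v \<bullet> (S *\<^sub>v v) < 0)"

definition alg_mult :: "'a :: field mat \<Rightarrow> 'a \<Rightarrow> nat" where
  "alg_mult X z = Polynomial.order z (char_poly X)"

text \<open>Used for symmetric matrices only, all of whose eigenvalues are real.\<close>

definition num_pos_eigenvalues :: "real mat \<Rightarrow> nat" where
  "num_pos_eigenvalues A = (\<Sum>x | x \<in> spectrum A \<and> 0 < x. alg_mult A x)"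

definition num_stable_eigenvalues :: "complex mat \<Rightarrow> nat" where
  "num_stable_eigenvalues X = (\<Sum>z | z \<in> spectrum X \<and> Re z < 0. alg_mult X z)"

definition stable_mat :: "complex mat \<Rightarrow> bool" where
  "stable_mat X \<longleftrightarrow> square_mat X \<and> (\<forall>z \<in> spectrum X. Re z < 0)"

definition right_stable_mat :: "complex mat \<Rightarrow> complex mat \<Rightarrow> bool" where
  "right_stable_mat X R \<longleftrightarrow>
     square_mat X \<and>
     R \<in> carrier_mat (dim_row X) (num_stable_eigenvalues X) \<and> full_rank R \<and>
     (\<exists>XS \<in> carrier_mat (num_stable_eigenvalues X) (num_stable_eigenvalues X).
        stable_mat XS \<and> X * R = R * XS)"

text \<open>
  The \<open>m \<times> m\<close> matrix \<open>i \<Sum>\<^sub>j \<omega>\<^sub>j A\<^sub>j\<close>, \<open>j = 2, \<dots>, d\<close>. A frequency vector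
  \<open>\<omega> = (\<omega>\<^sub>2, \<dots>, \<omega>\<^sub>d)\<close> is a function on \<^typ>\<open>nat\<close>; only its values on \<open>{2..d}\<close> matter.
\<close>

definition tangential_symbol ::
  "nat \<Rightarrow> nat \<Rightarrow> (nat \<Rightarrow> real mat) \<Rightarrow> (nat \<Rightarrow> real) \<Rightarrow> complex mat" where
  "tangential_symbol m d A w =
     mat m m (\<lambda>(k, l). \<i> * complex_of_real (\<Sum>j = 2..d. w j * (A j $$ (k, l))))"

definition relaxation_symbol ::
  "nat \<Rightarrow> nat \<Rightarrow> (nat \<Rightarrow> real mat) \<Rightarrow> real mat \<Rightarrow> complex \<Rightarrow> (nat \<Rightarrow> real) \<Rightarrow> real \<Rightarrow> complex mat"
  where
  "relaxation_symbol n d A Q \<xi> w \<eta> =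
     minv (cmat (A 1)) *
     (complex_of_real \<eta> \<cdot>\<^sub>m cmat Q - \<xi> \<cdot>\<^sub>m 1\<^sub>m n - tangential_symbol n d A w)"

text \<open>
  Two right-stable matrices of the same matrix differ by an invertible right factor \<open>T\<close>,
  which multiplies both sides of the determinant inequalities below by \<open>|det T|\<close>; quantifying
  over all right-stable matrices is thus the same as choosing one at each frequency.
  \<open>det (R\<^sup>* R)\<close> is a nonnegative real number, so \<^const>\<open>Re\<close> only changes its type.
\<close>

definition generalized_kreiss ::
  "nat \<Rightarrow> nat \<Rightarrow> (nat \<Rightarrow> real mat) \<Rightarrow> real mat \<Rightarrow> real mat \<Rightarrow> bool" where
  "generalized_kreiss n d A Q B \<longleftrightarrow>
     (\<exists>cK > 0. \<forall>\<eta> \<ge> 0. \<forall>w \<xi>. Re \<xi> > 0 \<longrightarrow>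
        (\<forall>R. right_stable_mat (relaxation_symbol n d A Q \<xi> w \<eta>) R \<longrightarrow>
           cmod (det (cmat B * R)) \<ge> cK * sqrt (Re (det (mat_adjoint R * R)))))"

text \<open>
  The arguments \<open>A11\<close>, \<open>P1\<close>, \<open>P0\<close>, \<open>L1\<close> are the coefficients \<open>A\<^sub>1\<^sub>1, A\<^sub>j\<^sub>1\<^sub>1\<close> of the equilibrium system
  (as the family \<open>A11 1, A11 j\<close>), the matrices \<open>P\<^sub>1\<close>, \<open>P\<^sub>0\<close>, and \<open>\<Lambda>\<^sub>1\<close>.
\<close>

definition equilibrium_symbol ::
  "nat \<Rightarrow> (nat \<Rightarrow> real mat) \<Rightarrow> real mat \<Rightarrow> real mat \<Rightarrow> real mat \<Rightarrow>
   complex \<Rightarrow> (nat \<Rightarrow> real) \<Rightarrow> complex mat" where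
  "equilibrium_symbol d A11 P1 P0 L1 \<xi> w =
     (let C = tangential_symbol (dim_row P1) d A11 w;
          Q1 = cmat P1; Q0 = cmat P0;
          C11 = mat_adjoint Q1 * C * Q1; C10 = mat_adjoint Q1 * C * Q0;
          C01 = mat_adjoint Q0 * C * Q1; C00 = mat_adjoint Q0 * C * Q0
      in - (minv (cmat L1) *
            ((\<xi> \<cdot>\<^sub>m 1\<^sub>m (dim_col P1) + C11)
             - C10 * minv (\<xi> \<cdot>\<^sub>m 1\<^sub>m (dim_col P0) + C00) * C01)))"

text \<open>
  The Uniform Kreiss Condition of the characteristic problem for the equilibrium system
  with boundary matrix \<open>Bh\<close>, i.e. with a boundary condition \<open>Bh u = bh\<close>.
\<close>

definition uniform_kreiss_characteristic ::
  "nat \<Rightarrow> (nat \<Rightarrow> real mat) \<Rightarrow> real mat \<Rightarrow> real mat \<Rightarrow> real mat \<Rightarrow> real mat \<Rightarrow> bool" where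
  "uniform_kreiss_characteristic d A11 P1 P0 L1 Bh \<longleftrightarrow>
     (\<exists>c > 0. \<forall>\<xi> w. Re \<xi> > 0 \<longrightarrow>
        (\<forall>R. right_stable_mat (equilibrium_symbol d A11 P1 P0 L1 \<xi> w) R \<longrightarrow>
           cmod (det (cmat Bh * cmat P1 * R)) \<ge> c * sqrt (Re (det (mat_adjoint R * R)))))"

end

(* The stable subspace of the relaxation symbol M(\<xi>,\<omega>,\<eta>) is followed as \<eta> tends to infinity. It is
   A_1-positive, and the resolvent of M applied to one of its vectors e is a vector U with
   4 Re s (Re \<xi> |U|^2 + \<eta> \<sigma> |U_v|^2) \<le> e^* A_1 e for Re s > 0. Passing to the limit \<eta> \<rightarrow> \<infinity> for
   fixed s, and for s replaced by \<eta> s, shows that every limit of stable vectors has the form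
   P_1 y + P_0 z + G w with y in the stable subspace of M_1, z arbitrary, and G w a fast boundary
   layer mode determined by A_1 and S alone. On vectors of this form A_1 is nonnegative, so an inertia
   count bounds the dimension of their space by n^+, and the inclusion is an equality. The Generalized
   Kreiss Condition therefore gives |B e| \<ge> c |e| on this space, uniformly in \<xi> and \<omega>. Since P_0 and G do
   not depend on \<xi> and \<omega>, the rows of B_o can be taken to span the left annihilator of B (P_0, G). *)

theory Submission
  imports Defs
begin

section \<open>Injective matrices and rank\<close>

text \<open>Since \<open>A11 1\<close> is singular, the \<open>P0\<close> part of a limit vector
  obeys no evolution equation, and the eigenvalues of M are nowhere expanded or tracked. Decay is
  encoded instead by a resolvent bound of order 1 / sqrt (Re s), which passes to limits of
  subsequences. Limits are taken separately at each frequency. Uniformity is not lost, because the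
  Generalized Kreiss Condition is first rewritten as \<open>c |R a|^2 \<le> |B R a|^2\<close> for
  orthonormal stable frames R, and this \<open>c\<close> reaches the limit unchanged. The row count
  of B_o rests on an equality of dimensions: the limit space has dimension n_1^+ + n_1^o + q, with q
  the number of fast modes, and this equals n^+, so the left annihilator of B (P_0, G) has dimension
  exactly n_1^+. That M_1 has n_1^+ stable eigenvalues comes from a Lyapunov inequality between M_1
  and \<Lambda>_1. B_o has to be real, hence so do the fast modes; the matrix governing them is a
  symmetric matrix times the definite S and so has real spectrum.\<close>

definition inj_mat :: "'a :: field mat \<Rightarrow> bool" where
  "inj_mat K \<longleftrightarrow>
     (\<forall>a \<in> carrier_vec (dim_col K). K *\<^sub>v a = 0\<^sub>v (dim_row K) \<longrightarrow> a = 0\<^sub>v (dim_col K))"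

lemma inj_matI:
  assumes "K \<in> carrier_mat m k"
    and "\<And>a. a \<in> carrier_vec k \<Longrightarrow> K *\<^sub>v a = 0\<^sub>v m \<Longrightarrow> a = 0\<^sub>v k"
  shows "inj_mat K"
  using assms unfolding inj_mat_def by auto

lemma inj_matD:
  assumes "inj_mat K" "K \<in> carrier_mat m k" "a \<in> carrier_vec k" "K *\<^sub>v a = 0\<^sub>v m"
  shows "a = 0\<^sub>v k"
  using assms unfolding inj_mat_def by auto

lemma det_nonzero_obtain_inverse:
  fixes K :: "'a :: field mat"
  assumes K: "K \<in> carrier_mat k k" and d: "det K \<noteq> 0"
  obtains L where "L \<in> carrier_mat k k" "K * L = 1\<^sub>m k" "L * K = 1\<^sub>m k"
proof
  let ?L = "inverse (det K) \<cdot>\<^sub>m adj_mat K"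
  note a = adj_mat[OF K]
  show "?L \<in> carrier_mat k k" using a by auto
  show "K * ?L = 1\<^sub>m k" using a K d by (subst mult_smult_distrib[OF K a(1)]) auto
  show "?L * K = 1\<^sub>m k" using a K d by (subst mult_smult_assoc_mat[OF a(1) K]) auto
qed

lemma inj_mat_det:
  fixes K :: "'a :: field mat"
  assumes K: "K \<in> carrier_mat k k"
  shows "inj_mat K \<longleftrightarrow> det K \<noteq> 0"
  using det_0_iff_vec_prod_zero_field[OF K] K unfolding inj_mat_def by auto

lemma inj_mat_obtain_inverse:
  fixes K :: "'a :: field mat"
  assumes K: "K \<in> carrier_mat k k" and d: "inj_mat K"
  obtains L where "L \<in> carrier_mat k k" "K * L = 1\<^sub>m k" "L * K = 1\<^sub>m k"
  using det_nonzero_obtain_inverse[OF K] inj_mat_det[OF K] d by auto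

lemma left_inverse_inj_mat:
  fixes K :: "'a :: field mat"
  assumes K: "K \<in> carrier_mat m k" and L: "L \<in> carrier_mat k m" and LK: "L * K = 1\<^sub>m k"
  shows "inj_mat K"
proof (rule inj_matI[OF K])
  fix a assume a: "a \<in> carrier_vec k" and z: "K *\<^sub>v a = 0\<^sub>v m"
  have "a = (L * K) *\<^sub>v a" using a LK by simp
  also have "\<dots> = L *\<^sub>v (K *\<^sub>v a)" using K L a by (simp add: assoc_mult_mat_vec)
  finally show "a = 0\<^sub>v k" using z L by auto
qed

text \<open>Padding with zero rows makes the matrix square. A zero row is a kernel vector of the
  transpose, so the determinant vanishes and the padded matrix has a kernel vector too.\<close>

lemma wide_mat_kernel:
  fixes K :: "'a :: field mat"
  assumes K: "K \<in> carrier_mat m k" and mk: "m < k"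
  obtains a where "a \<in> carrier_vec k" "a \<noteq> 0\<^sub>v k" "K *\<^sub>v a = 0\<^sub>v m"
proof -
  define K' where "K' = mat k k (\<lambda>(i,j). if i < m then K $$ (i,j) else 0)"
  have K': "K' \<in> carrier_mat k k" unfolding K'_def by auto
  have "transpose_mat K' *\<^sub>v unit_vec k m = 0\<^sub>v k"
  proof (rule eq_vecI)
    fix i assume "i < dim_vec (0\<^sub>v k :: 'a vec)"
    then show "(transpose_mat K' *\<^sub>v unit_vec k m) $ i = 0\<^sub>v k $ i"
      using mk K' by (simp add: K'_def)
  qed (use K' in auto)
  moreover have "unit_vec k m \<noteq> (0\<^sub>v k :: 'a vec)" using mk by simp
  ultimately have "det (transpose_mat K') = 0"
    using det_0_iff_vec_prod_zero_field[of "transpose_mat K'" k] K' by (metis transpose_carrier_mat unit_vec_carrier)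
  then have "det K' = 0" using det_transpose[OF K'] by simp
  then obtain a where a: "a \<in> carrier_vec k" "a \<noteq> 0\<^sub>v k" "K' *\<^sub>v a = 0\<^sub>v k"
    using det_0_iff_vec_prod_zero_field[OF K'] by auto
  have "K *\<^sub>v a = 0\<^sub>v m"
  proof (rule eq_vecI)
    fix i assume "i < dim_vec (0\<^sub>v m :: 'a vec)"
    then have i: "i < m" by simp
    have "(K *\<^sub>v a) $ i = (K' *\<^sub>v a) $ i"
      using i mk K K' a(1) unfolding K'_def by (auto simp: scalar_prod_def)
    also have "\<dots> = 0" using a(3) i mk by simp
    finally show "(K *\<^sub>v a) $ i = 0\<^sub>v m $ i" using i by simp
  qed (use K in auto)
  with a that show thesis by auto
qed

lemma inj_mat_le:
  fixes K :: "'a :: field mat"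
  assumes "K \<in> carrier_mat m k" "inj_mat K"
  shows "k \<le> m"
proof (rule ccontr)
  assume "\<not> k \<le> m"
  then have "m < k" by simp
  from wide_mat_kernel[OF assms(1) this] obtain a
    where a: "a \<in> carrier_vec k" "a \<noteq> 0\<^sub>v k" "K *\<^sub>v a = 0\<^sub>v m" .
  with inj_matD[OF assms(2,1) a(1,3)] show False by simp
qed

lemma mult_mat_unit_vec:
  fixes R :: "'a :: comm_ring_1 mat"
  assumes "R \<in> carrier_mat n k" "j < k"
  shows "R *\<^sub>v unit_vec k j = col R j"
  using assms by (intro eq_vecI) (auto simp: row_def)

lemma inj_mat_left_factor:
  fixes E :: "'a :: field mat"
  assumes E: "E \<in> carrier_mat n m" and K: "K \<in> carrier_mat m k" and i: "inj_mat (E * K)"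
  shows "inj_mat K"
proof (rule inj_matI[OF K])
  fix a assume a: "a \<in> carrier_vec k" and z: "K *\<^sub>v a = 0\<^sub>v m"
  have "E * K *\<^sub>v a = E *\<^sub>v (K *\<^sub>v a)" using E K a by (simp add: assoc_mult_mat_vec)
  then have "E * K *\<^sub>v a = 0\<^sub>v n" using z E by auto
  from inj_matD[OF i _ a this] E K show "a = 0\<^sub>v k" by auto
qed

text \<open>A chosen preimage of each column becomes a column of \<open>K\<close>. Inclusions of
  ranges thus turn into factorizations, and dimension comparisons into \<open>inj_mat_le\<close> for
  the factor.\<close>

lemma columns_in_range_factor:
  fixes E :: "'a :: field mat"
  assumes R: "R \<in> carrier_mat n k" and E: "E \<in> carrier_mat n m"
    and sub: "\<And>a. a \<in> carrier_vec k \<Longrightarrow> \<exists>b \<in> carrier_vec m. R *\<^sub>v a = E *\<^sub>v b"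
  obtains K where "K \<in> carrier_mat m k" "R = E * K"
proof -
  have "\<forall>j. \<exists>b. j < k \<longrightarrow> b \<in> carrier_vec m \<and> col R j = E *\<^sub>v b"
  proof
    fix j
    show "\<exists>b. j < k \<longrightarrow> b \<in> carrier_vec m \<and> col R j = E *\<^sub>v b"
    proof (cases "j < k")
      case True
      with sub[of "unit_vec k j"] have "\<exists>b \<in> carrier_vec m. col R j = E *\<^sub>v b"
        using mult_mat_unit_vec[OF R] by (metis unit_vec_carrier)
      then show ?thesis by blast
    qed auto
  qed
  from choice[OF this] obtain b where b: "\<And>j. j < k \<Longrightarrow> b j \<in> carrier_vec m"
    "\<And>j. j < k \<Longrightarrow> col R j = E *\<^sub>v b j" by auto
  let ?K = "mat_of_cols m (map b [0..<k])"
  have K: "?K \<in> carrier_mat m k" by auto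
  have "R = E * ?K"
  proof (rule eq_matI)
    fix i j assume "i < dim_row (E * ?K)" "j < dim_col (E * ?K)"
    then have i: "i < n" and j: "j < k" using E by auto
    have "R $$ (i,j) = col R j $ i" using R i j by simp
    also have "\<dots> = row E i \<bullet> b j" using b(2)[OF j] E i by simp
    also have "b j = col ?K j" using b(1)[OF j] j by (simp add: col_mat_of_cols)
    finally show "R $$ (i,j) = (E * ?K) $$ (i,j)" using E i j by simp
  qed (use R E in auto)
  with K that show thesis by blast
qed

lemma inj_mat_distinct_cols:
  fixes R :: "'a :: field mat"
  assumes R: "R \<in> carrier_mat n k" and i: "inj_mat R"
  shows "distinct (cols R)"
  unfolding distinct_conv_nth
proof (intro allI impI notI)
  fix p q assume "p < length (cols R)" "q < length (cols R)" and pq: "p \<noteq> q"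
    and e: "cols R ! p = cols R ! q"
  then have p: "p < k" and q: "q < k" using R by auto
  have "R *\<^sub>v (unit_vec k p - unit_vec k q) = 0\<^sub>v n"
    using e p q R mult_mat_unit_vec[OF R p] mult_mat_unit_vec[OF R q]
    by (simp add: mult_minus_distrib_mat_vec)
  then have "unit_vec k p - unit_vec k q = (0\<^sub>v k :: 'a vec)"
    using inj_matD[OF i R] by auto
  then have "(unit_vec k p - unit_vec k q :: 'a vec) $ p = 0" using p by simp
  then show False using p q pq by simp
qed

text \<open>Linear independence speaks of the set of columns, where a repeated column goes
  unnoticed. Repetition is excluded by the rank: it would leave fewer than \<open>k\<close> distinct
  columns to choose from.\<close>

lemma full_rank_inj_mat:
  fixes R :: "'a :: field mat"
  assumes R: "R \<in> carrier_mat n k" and kn: "k \<le> n"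
  shows "full_rank R \<longleftrightarrow> inj_mat R"
proof -
  interpret vec_space "TYPE('a)" n .
  have fr: "full_rank R \<longleftrightarrow> rank R = k" unfolding full_rank_def using R kn by auto
  have nd: "distinct (cols R)" if "rank R = k"
  proof (rule ccontr)
    assume nd: "\<not> distinct (cols R)"
    obtain S where S: "maximal S (\<lambda>T. T \<subseteq> set (cols R) \<and> lin_indpt T)"
      using maximal_exists[of "(\<lambda>T. T \<subseteq> set (cols R) \<and> lin_indpt T)" "card (set (cols R))" "{}"]
      by (meson List.finite_set card_mono empty_iff empty_subsetI finite_lin_indpt2 rev_finite_subset)
    then have "card S \<le> card (set (cols R))" by (simp add: card_mono maximal_def)
    moreover have "card (set (cols R)) < k"
      using nd R by (metis card_distinct card_length carrier_matD(2) cols_length nat_less_le)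
    ultimately show False using rank_card_indpt[OF R S] that by simp
  qed
  show ?thesis
  proof
    assume "full_rank R"
    then have r: "rank R = k" using fr by simp
    note d = nd[OF r]
    from full_rank_lin_indpt[OF R r d] have "lin_indpt (set (cols R))" .
    then show "inj_mat R" using lin_depI[OF R _ _ _ d] by (intro inj_matI[OF R]) auto
  next
    assume i: "inj_mat R"
    note d = inj_mat_distinct_cols[OF R i]
    have "lin_indpt (set (cols R))"
      using lin_depE[OF R _ d] inj_matD[OF i R] by metis
    from lin_indpt_full_rank[OF R d this] show "full_rank R" using fr by simp
  qed
qed

section \<open>Horizontal concatenation of matrices\<close>

lemma append_cols_carrier [simp, intro]:
  assumes "A \<in> carrier_mat n k" "B \<in> carrier_mat n l"
  shows "append_cols A B \<in> carrier_mat n (k + l)"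
  using assms unfolding append_cols_def by auto

lemma append_cols_mult_vec:
  fixes A :: "'a :: comm_ring_1 mat"
  assumes "A \<in> carrier_mat n k" "B \<in> carrier_mat n l" "a \<in> carrier_vec k" "b \<in> carrier_vec l"
  shows "append_cols A B *\<^sub>v (a @\<^sub>v b) = A *\<^sub>v a + B *\<^sub>v b"
proof -
  have "append_cols A B *\<^sub>v (a @\<^sub>v b) =
      (A *\<^sub>v a + B *\<^sub>v b) @\<^sub>v (0\<^sub>m 0 k *\<^sub>v a + 0\<^sub>m 0 l *\<^sub>v b)"
    unfolding append_cols_def using assms
    by (subst four_block_mat_mult_vec[of A n k B l _ 0]) auto
  also have "\<dots> = A *\<^sub>v a + B *\<^sub>v b" using assms by (intro eq_vecI) auto
  finally show ?thesis .
qed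

lemma append_cols_mult_left:
  fixes A :: "'a :: comm_ring_1 mat"
  assumes M: "M \<in> carrier_mat p n" and "A \<in> carrier_mat n k" "B \<in> carrier_mat n l"
  shows "M * append_cols A B = append_cols (M * A) (M * B)"
  unfolding append_cols_def using assms
  by (intro eq_matI) (auto simp: scalar_prod_def intro!: sum.cong)

lemma append_cols_mult_right:
  fixes A :: "'a :: comm_ring_1 mat"
  assumes "A \<in> carrier_mat n k" "B \<in> carrier_mat n l" "C \<in> carrier_mat k m" "D \<in> carrier_mat l m"
  shows "append_cols A B * (C @\<^sub>r D) = A * C + B * D"
proof -
  have *: "append_cols A B * (C @\<^sub>r D) =
    four_block_mat (A * C + B * D) (A * 0\<^sub>m k 0 + B * 0\<^sub>m l 0) (0\<^sub>m 0 k * C + 0\<^sub>m 0 l * D)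
      (0\<^sub>m 0 k * 0\<^sub>m k 0 + 0\<^sub>m 0 l * 0\<^sub>m l 0)"
    unfolding append_cols_def append_rows_def using assms
    by (subst mult_four_block_mat[of A n k B l _ 0 _ C m _ 0]) auto
  show ?thesis unfolding * using assms by (intro eq_matI) auto
qed

text \<open>A right inverse makes the columns span the whole space. The matrix is wide here, so full
  rank means rank equal to the number of rows; in this way B_o is seen to have full rank.\<close>

lemma right_inverse_full_rank:
  fixes R :: "'a :: field mat"
  assumes R: "R \<in> carrier_mat n k" and L: "L \<in> carrier_mat k n" and RL: "R * L = 1\<^sub>m n"
  shows "full_rank R"
proof -
  interpret vec_space "TYPE('a)" n .
  have iL: "inj_mat L" using left_inverse_inj_mat[OF L R RL] .
  then have nk: "n \<le> k" using inj_mat_le[OF L] by simp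
  have "\<exists>x \<in> carrier_vec k. R *\<^sub>v x = y" if y: "y \<in> carrier_vec n" for y
    using R L RL y by (intro bexI[of _ "L *\<^sub>v y"]) (auto simp flip: assoc_mult_mat_vec)
  then have "span (set (cols R)) = carrier_vec n"
    using col_space_eq[of R] R unfolding col_space_def by auto
  then have "span_vs (set (cols R)) = V" by (simp add: module_vec_def)
  then have "rank R = n" unfolding rank_def using dim_is_n by simp
  then show ?thesis unfolding full_rank_def using R nk by auto
qed

section \<open>Hermitian inner product and norm bounds\<close>

text \<open>If every vector lay in the range of \<open>D\<close>, the identity would factor through
  dimension \<open>m < n\<close>, against \<open>inj_mat_le\<close>. Any vector outside the range
  can be appended.\<close>

lemma inj_mat_extend:
  fixes D :: "'a :: field mat"
  assumes D: "D \<in> carrier_mat n m" and i: "inj_mat D" and mn: "m < n"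
  obtains x where "x \<in> carrier_vec n" "inj_mat (append_cols D (mat_of_cols n [x]))"
proof -
  have "\<exists>x \<in> carrier_vec n. \<forall>a \<in> carrier_vec m. x \<noteq> D *\<^sub>v a"
  proof (rule ccontr)
    assume "\<not> ?thesis"
    then have "\<exists>b \<in> carrier_vec m. (1\<^sub>m n :: 'a mat) *\<^sub>v a = D *\<^sub>v b" if "a \<in> carrier_vec n" for a
      using that by auto
    from columns_in_range_factor[OF one_carrier_mat D this] obtain K
      where K: "K \<in> carrier_mat m n" "1\<^sub>m n = D * K" by blast
    have "inj_mat (1\<^sub>m n :: 'a mat)" by (rule left_inverse_inj_mat[of _ n n "1\<^sub>m n"]) auto
    with K have "inj_mat K" using inj_mat_left_factor[OF D K(1)] by simp
    with inj_mat_le[OF K(1)] mn show False by simp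
  qed
  then obtain x where x: "x \<in> carrier_vec n" and nx: "\<And>a. a \<in> carrier_vec m \<Longrightarrow> x \<noteq> D *\<^sub>v a" by auto
  have "inj_mat (append_cols D (mat_of_cols n [x]))"
  proof (rule inj_matI)
    show "append_cols D (mat_of_cols n [x]) \<in> carrier_mat n (m + 1)"
      using D by (intro append_cols_carrier) auto
    fix c assume c: "c \<in> carrier_vec (m + 1)"
      and z: "append_cols D (mat_of_cols n [x]) *\<^sub>v c = 0\<^sub>v n"
    define a b where "a = vec_first c m" and "b = vec_last c 1"
    have ab: "a \<in> carrier_vec m" "b \<in> carrier_vec 1" "c = a @\<^sub>v b"
      unfolding a_def b_def using c by auto
    have X: "mat_of_cols n [x] *\<^sub>v b = b $ 0 \<cdot>\<^sub>v x"
      using x ab by (intro eq_vecI) (auto simp: scalar_prod_def mat_of_cols_index)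
    from z have z': "D *\<^sub>v a + b $ 0 \<cdot>\<^sub>v x = 0\<^sub>v n"
      unfolding ab(3) append_cols_mult_vec[OF D carrier_matI ab(1,2), of "mat_of_cols n [x]", simplified] X
      by simp
    have b0: "b $ 0 = 0"
    proof (rule ccontr)
      assume b: "b $ 0 \<noteq> 0"
      have "x = D *\<^sub>v ((- 1 / b $ 0) \<cdot>\<^sub>v a)"
      proof (rule eq_vecI)
        fix i assume "i < dim_vec (D *\<^sub>v ((- 1 / b $ 0) \<cdot>\<^sub>v a))"
        then have i: "i < n" using D by auto
        from arg_cong[OF z', of "\<lambda>v. v $ i"] i D x
        have "(D *\<^sub>v a) $ i + b $ 0 * x $ i = 0" by simp
        then have "b $ 0 * x $ i = - (D *\<^sub>v a) $ i" by (simp add: add_eq_0_iff)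
        then have "x $ i = - (D *\<^sub>v a) $ i / b $ 0"
          by (metis b nonzero_mult_div_cancel_left)
        then show "x $ i = (D *\<^sub>v ((- 1 / b $ 0) \<cdot>\<^sub>v a)) $ i"
          using i D ab by (simp add: mult_mat_vec)
      qed (use D x in auto)
      with nx[of "(- 1 / b $ 0) \<cdot>\<^sub>v a"] ab show False by auto
    qed
    have "0 \<cdot>\<^sub>v x = 0\<^sub>v n" using x by (intro eq_vecI) auto
    then have "D *\<^sub>v a = 0\<^sub>v n" using z' b0 D ab by auto
    from inj_matD[OF i D ab(1) this] have "a = 0\<^sub>v m" .
    moreover have "b = 0\<^sub>v 1" using b0 ab by (intro eq_vecI) auto
    ultimately show "c = 0\<^sub>v (m + 1)" unfolding ab(3) by auto
  qed
  with x that show thesis by blast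
qed

lemma append_cols_assoc:
  assumes "A \<in> carrier_mat n k" "B \<in> carrier_mat n l" "C \<in> carrier_mat n m"
  shows "append_cols (append_cols A B) C = append_cols A (append_cols B C)"
  using assms unfolding append_cols_def by (intro eq_matI) auto

lemma inj_mat_complement:
  fixes D :: "'a :: field mat"
  assumes D: "D \<in> carrier_mat n m" and i: "inj_mat D"
  obtains E where "E \<in> carrier_mat n (n - m)" "inj_mat (append_cols D E)"
proof -
  have "\<exists>E \<in> carrier_mat n (n - m). inj_mat (append_cols D E)"
    using D i
  proof (induction "n - m" arbitrary: m D)
    case 0
    have "append_cols D (0\<^sub>m n 0) = D"
      unfolding append_cols_def using 0 by (intro eq_matI) auto
    then show ?case using 0 by (intro bexI[of _ "0\<^sub>m n 0"]) auto
  next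
    case (Suc p)
    then obtain x where x: "x \<in> carrier_vec n" "inj_mat (append_cols D (mat_of_cols n [x]))"
      using inj_mat_extend[of D n m] by (metis zero_less_Suc zero_less_diff)
    let ?x = "mat_of_cols n [x]"
    have X: "?x \<in> carrier_mat n 1" by (rule carrier_matI) auto
    have "p = n - (m + 1)" using Suc(2) by simp
    from Suc(1)[OF this append_cols_carrier[OF Suc(3) X] x(2)]
    obtain E where E: "E \<in> carrier_mat n (n - (m + 1))" "inj_mat (append_cols (append_cols D ?x) E)"
      by blast
    have eq: "1 + (n - (m + 1)) = n - m" using Suc(2) by simp
    have "append_cols ?x E \<in> carrier_mat n (n - m)"
      using append_cols_carrier[OF X E(1)] unfolding eq .
    moreover have "inj_mat (append_cols D (append_cols ?x E))"
      using E(2) append_cols_assoc[OF Suc(3) X E(1)] by simp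
    ultimately show ?case by blast
  qed
  then show thesis using that by blast
qed

section \<open>Adjoints and the Hermitian inner product\<close>

lemma mat_adjoint_carrier [simp, intro]:
  "A \<in> carrier_mat m n \<Longrightarrow> mat_adjoint A \<in> carrier_mat n m"
  unfolding mat_adjoint_def by (intro carrier_matI) simp_all

lemma mat_adjoint_index [simp]:
  "i < dim_col A \<Longrightarrow> j < dim_row A \<Longrightarrow> mat_adjoint A $$ (i, j) = conjugate (A $$ (j, i))"
  unfolding mat_adjoint_def by (simp add: mat_of_rows_index)

lemma mat_adjoint_dim [simp]:
  "dim_row (mat_adjoint A) = dim_col A" "dim_col (mat_adjoint A) = dim_row A"
  unfolding mat_adjoint_def by auto

lemma mat_adjoint_adjoint [simp]: "mat_adjoint (mat_adjoint A) = (A :: complex mat)"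
  by (intro eq_matI) auto

lemma mat_adjoint_uminus: "mat_adjoint (- A) = - mat_adjoint (A :: complex mat)"
  by (intro eq_matI) auto

lemma mat_adjoint_mult:
  fixes A :: "complex mat"
  assumes "A \<in> carrier_mat m n" "B \<in> carrier_mat n k"
  shows "mat_adjoint (A * B) = mat_adjoint B * mat_adjoint A"
  using assms by (intro eq_matI) (auto simp: scalar_prod_def cnj_sum ac_simps intro!: sum.cong)

lemma mat_adjoint_cmat: "mat_adjoint (cmat A) = cmat (transpose_mat A)"
  by (intro eq_matI) auto

lemma mat_adjoint_one [simp]: "mat_adjoint (1\<^sub>m n :: complex mat) = 1\<^sub>m n"
  by (intro eq_matI) auto

lemma inner_adjoint:
  fixes A :: "complex mat"
  assumes A: "A \<in> carrier_mat m n" and x: "x \<in> carrier_vec n" and y: "y \<in> carrier_vec m"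
  shows "(A *\<^sub>v x) \<bullet>c y = x \<bullet>c (mat_adjoint A *\<^sub>v y)"
proof -
  have "(A *\<^sub>v x) \<bullet>c y = (\<Sum>i<m. \<Sum>j<n. A $$ (i,j) * x $ j * cnj (y $ i))"
    using assms by (simp add: scalar_prod_def sum_distrib_right atLeast0LessThan)
  also have "\<dots> = (\<Sum>j<n. \<Sum>i<m. A $$ (i,j) * x $ j * cnj (y $ i))" by (rule sum.swap)
  also have "\<dots> = x \<bullet>c (mat_adjoint A *\<^sub>v y)"
    using assms by (simp add: scalar_prod_def sum_distrib_left atLeast0LessThan cnj_sum ac_simps)
  finally show ?thesis .
qed

lemma inner_commute:
  fixes x :: "complex vec"
  assumes "x \<in> carrier_vec n" "y \<in> carrier_vec n"
  shows "y \<bullet>c x = cnj (x \<bullet>c y)"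
  using assms by (simp add: scalar_prod_def cnj_sum ac_simps)

lemma inner_add_left:
  fixes x :: "complex vec"
  assumes "x \<in> carrier_vec n" "y \<in> carrier_vec n" "z \<in> carrier_vec n"
  shows "(x + y) \<bullet>c z = x \<bullet>c z + y \<bullet>c z"
  using assms by (intro add_scalar_prod_distrib[of _ n]) auto

lemma inner_add_right:
  fixes x :: "complex vec"
  assumes "x \<in> carrier_vec n" "y \<in> carrier_vec n" "z \<in> carrier_vec n"
  shows "z \<bullet>c (x + y) = z \<bullet>c x + z \<bullet>c y"
  using assms by (simp add: scalar_prod_def sum.distrib ring_distribs)

lemma inner_minus_left:
  fixes x :: "complex vec"
  assumes "x \<in> carrier_vec n" "y \<in> carrier_vec n" "z \<in> carrier_vec n"
  shows "(x - y) \<bullet>c z = x \<bullet>c z - y \<bullet>c z"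
  using assms by (intro minus_scalar_prod_distrib[of _ n]) auto

lemma inner_minus_right:
  fixes x :: "complex vec"
  assumes "x \<in> carrier_vec n" "y \<in> carrier_vec n" "z \<in> carrier_vec n"
  shows "z \<bullet>c (x - y) = z \<bullet>c x - z \<bullet>c y"
  using assms by (simp add: scalar_prod_def sum_subtractf ring_distribs)

lemma inner_smult_left:
  fixes x :: "complex vec"
  assumes "x \<in> carrier_vec n" "z \<in> carrier_vec n"
  shows "(c \<cdot>\<^sub>v x) \<bullet>c z = c * (x \<bullet>c z)"
  using assms by (intro smult_scalar_prod_distrib[of _ n]) auto

lemma inner_smult_right:
  fixes x :: "complex vec"
  assumes "x \<in> carrier_vec n" "z \<in> carrier_vec n"
  shows "z \<bullet>c (c \<cdot>\<^sub>v x) = cnj c * (z \<bullet>c x)"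
  using assms by (simp add: scalar_prod_def sum_distrib_left ac_simps)

lemmas inner_simps = inner_add_left inner_add_right inner_minus_left inner_minus_right
  inner_smult_left inner_smult_right

section \<open>Squared norm, quadratic forms and operator bounds\<close>

definition sqn :: "complex vec \<Rightarrow> real" where
  "sqn x = (\<Sum>i<dim_vec x. (cmod (x $ i))\<^sup>2)"

text \<open>The real part gives the form of the Hermitian part of the matrix, so the definition also
  serves products such as \<open>A * M\<close> that are not Hermitian.\<close>

definition qf :: "complex mat \<Rightarrow> complex vec \<Rightarrow> real" where
  "qf A x = Re ((A *\<^sub>v x) \<bullet>c x)"

lemma inner_self: "x \<bullet>c x = complex_of_real (sqn x)"
  unfolding sqn_def by (simp add: scalar_prod_def atLeast0LessThan flip: complex_norm_square)

lemma sqn_nonneg [simp]: "0 \<le> sqn x"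
  unfolding sqn_def by (intro sum_nonneg) auto

lemma sqn_zero [simp]: "sqn (0\<^sub>v n) = 0"
  unfolding sqn_def by simp

lemma sqn_eq_0: "x \<in> carrier_vec n \<Longrightarrow> sqn x = 0 \<longleftrightarrow> x = 0\<^sub>v n"
  unfolding sqn_def by (auto simp: sum_nonneg_eq_0_iff vec_eq_iff)

lemma sqn_pos: "x \<in> carrier_vec n \<Longrightarrow> x \<noteq> 0\<^sub>v n \<Longrightarrow> 0 < sqn x"
  using sqn_eq_0 sqn_nonneg by (metis less_eq_real_def)

lemma sqn_smult: "sqn (c \<cdot>\<^sub>v x) = (cmod c)\<^sup>2 * sqn x"
  unfolding sqn_def by (simp add: norm_mult power_mult_distrib sum_distrib_left)

lemma cmod_index_le_sqn: "i < dim_vec x \<Longrightarrow> (cmod (x $ i))\<^sup>2 \<le> sqn x"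
  unfolding sqn_def by (rule member_le_sum) auto

lemma cmod_index_le_sqrt_sqn: "i < dim_vec x \<Longrightarrow> cmod (x $ i) \<le> sqrt (sqn x)"
  using cmod_index_le_sqn real_le_rsqrt by blast

lemma isometry_sqn:
  assumes R: "R \<in> carrier_mat n k" and RR: "mat_adjoint R * R = 1\<^sub>m k" and a: "a \<in> carrier_vec k"
  shows "sqn (R *\<^sub>v a) = sqn a"
proof -
  have "(R *\<^sub>v a) \<bullet>c (R *\<^sub>v a) = a \<bullet>c (mat_adjoint R *\<^sub>v (R *\<^sub>v a))"
    using R a by (intro inner_adjoint) auto
  also have "mat_adjoint R *\<^sub>v (R *\<^sub>v a) = a"
    using R a RR by (metis assoc_mult_mat_vec mat_adjoint_carrier one_mult_mat_vec)
  finally show ?thesis by (simp add: inner_self)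
qed

lemma norm_bound_exists: "\<exists>K \<ge> 0. norm_bound (A :: complex mat) K"
proof -
  have "norm_bound A (\<bar>Max {norm (A $$ (i,j)) | i j. i < dim_row A \<and> j < dim_col A}\<bar>)"
    using norm_bound_max[of A] unfolding norm_bound_def by fastforce
  then show ?thesis by (intro exI[of _ "\<bar>Max {norm (A $$ (i,j)) | i j. i < dim_row A \<and> j < dim_col A}\<bar>"]) simp
qed

lemma norm_bound_index_mult_vec:
  fixes A :: "complex mat"
  assumes A: "A \<in> carrier_mat m n" and K: "norm_bound A K" and x: "x \<in> carrier_vec n" and i: "i < m"
  shows "cmod ((A *\<^sub>v x) $ i) \<le> n * K * sqrt (sqn x)"
proof -
  have "cmod ((A *\<^sub>v x) $ i) \<le> (\<Sum>j<n. cmod (A $$ (i,j) * x $ j))"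
    using A x i by (auto simp: scalar_prod_def atLeast0LessThan intro: norm_sum)
  also have "\<dots> \<le> (\<Sum>j<n. K * sqrt (sqn x))"
  proof (rule sum_mono)
    fix j assume "j \<in> {..<n}"
    then have "cmod (A $$ (i,j)) \<le> K" "cmod (x $ j) \<le> sqrt (sqn x)"
      using K A i x cmod_index_le_sqrt_sqn[of j x] unfolding norm_bound_def by auto
    then show "cmod (A $$ (i,j) * x $ j) \<le> K * sqrt (sqn x)"
      unfolding norm_mult by (meson mult_mono norm_ge_zero order_trans)
  qed
  finally show ?thesis by simp
qed

lemma norm_bound_sqn_mult_vec:
  fixes A :: "complex mat"
  assumes A: "A \<in> carrier_mat m n" and K: "norm_bound A K" and x: "x \<in> carrier_vec n"
  shows "sqn (A *\<^sub>v x) \<le> m * (n * K)\<^sup>2 * sqn x"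
proof -
  have "sqn (A *\<^sub>v x) \<le> (\<Sum>i<m. (n * K * sqrt (sqn x))\<^sup>2)"
    unfolding sqn_def[of "A *\<^sub>v x"] using A norm_bound_index_mult_vec[OF A K x]
    by (auto simp del: index_mult_mat_vec sum_constant intro!: sum_mono power_mono)
  also have "\<dots> = m * (n * K)\<^sup>2 * sqn x" by (simp add: power_mult_distrib)
  finally show ?thesis .
qed

lemma sqn_mult_vec_bounded:
  fixes A :: "complex mat"
  assumes A: "A \<in> carrier_mat m n"
  obtains C where "C > 0" "\<And>x. x \<in> carrier_vec n \<Longrightarrow> sqn (A *\<^sub>v x) \<le> C * sqn x"
proof -
  obtain K where "K \<ge> 0" and K: "norm_bound A K" using norm_bound_exists by blast
  have "sqn (A *\<^sub>v x) \<le> (m * (n * K)\<^sup>2 + 1) * sqn x" if "x \<in> carrier_vec n" for x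
    using norm_bound_sqn_mult_vec[OF A K that] sqn_nonneg[of x] unfolding distrib_right by linarith
  then show thesis by (intro that[of "m * (n * K)\<^sup>2 + 1"]) (auto intro: add_nonneg_pos)
qed

lemma qf_bounded:
  fixes A :: "complex mat"
  assumes A: "A \<in> carrier_mat n n"
  obtains C where "C > 0" "\<And>x. x \<in> carrier_vec n \<Longrightarrow> \<bar>qf A x\<bar> \<le> C * sqn x"
proof -
  obtain K where K0: "K \<ge> 0" and K: "norm_bound A K" using norm_bound_exists by blast
  have "\<bar>qf A x\<bar> \<le> (n * (n * K) + 1) * sqn x" if x: "x \<in> carrier_vec n" for x
  proof -
    have "\<bar>qf A x\<bar> \<le> cmod ((A *\<^sub>v x) \<bullet>c x)" unfolding qf_def by (rule abs_Re_le_cmod)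
    also have "\<dots> \<le> (\<Sum>i<n. cmod ((A *\<^sub>v x) $ i * cnj (x $ i)))"
      using x A by (auto simp: scalar_prod_def[of "A *\<^sub>v x"] atLeast0LessThan intro: norm_sum)
    also have "\<dots> \<le> (\<Sum>i<n. (n * K * sqrt (sqn x)) * sqrt (sqn x))"
      using x A norm_bound_index_mult_vec[OF A K x] cmod_index_le_sqrt_sqn[of _ x] K0
      by (intro sum_mono) (auto simp: norm_mult intro!: mult_mono)
    also have "\<dots> = n * (n * K) * sqn x" by simp
    finally show ?thesis using sqn_nonneg[of x] unfolding distrib_right by linarith
  qed
  then show thesis using K0 by (intro that[of "n * (n * K) + 1"]) (auto intro: add_nonneg_pos)
qed

lemma norm_bound_det:
  fixes A :: "complex mat"
  assumes A: "A \<in> carrier_mat n n" and K: "norm_bound A K"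
  shows "cmod (det A) \<le> fact n * K ^ n"
proof -
  have "cmod (det A) \<le> (\<Sum>p | p permutes {0..<n}. cmod (signof p * (\<Prod>i = 0..<n. A $$ (i, p i))))"
    unfolding det_def'[OF A] by (rule norm_sum)
  also have "\<dots> \<le> (\<Sum>p | p permutes {0..<n}. K ^ n)"
  proof (rule sum_mono)
    fix p assume "p \<in> {p. p permutes {0..<n}}"
    then have p: "p permutes {0..<n}" by simp
    have "cmod (signof p * (\<Prod>i = 0..<n. A $$ (i, p i))) = (\<Prod>i = 0..<n. cmod (A $$ (i, p i)))"
      by (simp add: norm_mult prod_norm sign_def)
    also have "\<dots> \<le> (\<Prod>i = 0..<n. K)"
      using K A p unfolding norm_bound_def by (intro prod_mono) (auto simp: permutes_in_image)
    finally show "cmod (signof p * (\<Prod>i = 0..<n. A $$ (i, p i))) \<le> K ^ n" by simp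
  qed
  also have "\<dots> = fact n * K ^ n" by (simp add: card_permutations)
  finally show ?thesis .
qed

text \<open>The adjugate sends \<open>M a\<close> to \<open>det M\<close> times \<open>a\<close>,
  and its entries are minors of size \<open>k - 1\<close>, bounded through the Leibniz formula. A
  lower bound on the determinant thus becomes a lower bound on \<open>M a\<close>. For
  \<open>k = 0\<close> both sides are 0.\<close>

lemma det_lower_bound_sqn:
  fixes M :: "complex mat"
  assumes M: "M \<in> carrier_mat k k" and K: "norm_bound M K" and a: "a \<in> carrier_vec k"
  shows "(cmod (det M))\<^sup>2 * sqn a \<le> k * (k * (fact (k - 1) * K ^ (k - 1)))\<^sup>2 * sqn (M *\<^sub>v a)"
proof -
  note ad = adj_mat[OF M]
  have nb: "norm_bound (adj_mat M) (fact (k - 1) * K ^ (k - 1))"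
  proof (rule norm_boundI)
    fix i j assume "i < dim_row (adj_mat M)" "j < dim_col (adj_mat M)"
    then have ij: "i < k" "j < k" using ad by auto
    have "norm_bound (mat_delete M j i) K"
      using K M ij unfolding norm_bound_def mat_delete_def by auto
    from norm_bound_det[OF mat_delete_carrier[OF M] this]
    have "cmod (det (mat_delete M j i)) \<le> fact (k - 1) * K ^ (k - 1)" .
    then show "cmod (adj_mat M $$ (i,j)) \<le> fact (k - 1) * K ^ (k - 1)"
      using ij M unfolding adj_mat_def cofactor_def by (simp add: norm_mult norm_power)
  qed
  have "adj_mat M *\<^sub>v (M *\<^sub>v a) = (adj_mat M * M) *\<^sub>v a"
    using ad(1) M a by (simp add: assoc_mult_mat_vec)
  also have "\<dots> = det M \<cdot>\<^sub>v a" unfolding ad(3) using a by (intro eq_vecI) auto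
  finally have e: "adj_mat M *\<^sub>v (M *\<^sub>v a) = det M \<cdot>\<^sub>v a" .
  have "(cmod (det M))\<^sup>2 * sqn a = sqn (adj_mat M *\<^sub>v (M *\<^sub>v a))" unfolding e sqn_smult ..
  also have "\<dots> \<le> k * (k * (fact (k - 1) * K ^ (k - 1)))\<^sup>2 * sqn (M *\<^sub>v a)"
    using norm_bound_sqn_mult_vec[OF ad(1) nb, of "M *\<^sub>v a"] M a by simp
  finally show ?thesis .
qed

section \<open>Determinants, compactness and orthonormal frames\<close>

lemma char_poly_eq_imp_det:
  fixes A :: "complex mat"
  assumes A: "A \<in> carrier_mat n n" and c: "char_poly A = (\<Prod>a\<leftarrow>as. [:- a, 1:])"
  shows "det A = prod_list as"
proof -
  obtain B P Q where s: "schur_decomposition A as = (B, P, Q)" by (cases "schur_decomposition A as") auto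
  from schur_decomposition[OF A c s] have w: "similar_mat_wit A B P Q" "upper_triangular B" "diag_mat B = as"
    by auto
  have B: "B \<in> carrier_mat n n" using similar_mat_witD2[OF A w(1)] by auto
  have "similar_mat A B" using w(1) unfolding similar_mat_def by blast
  from det_similar[OF this] det_upper_triangular[OF w(2) B] w(3) show ?thesis by simp
qed

lemma eigenvalues_ge_imp_det_ge:
  fixes A :: "complex mat"
  assumes A: "A \<in> carrier_mat n n" and c: "0 \<le> c"
    and ev: "\<And>z. eigenvalue A z \<Longrightarrow> c \<le> cmod z"
  shows "c ^ n \<le> cmod (det A)"
proof -
  obtain as where as: "char_poly A = (\<Prod>a\<leftarrow>as. [:- a, 1:])" "length as = n"
    using char_poly_factorized[OF A] by auto
  have "\<forall>a \<in> set as. c \<le> cmod a"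
    using linear_poly_root[of _ as] ev eigenvalue_root_char_poly[OF A] as(1) by simp
  then have "c ^ length as \<le> cmod (prod_list as)"
    by (induction as) (auto simp: norm_mult c intro!: mult_mono)
  then show ?thesis using char_poly_eq_imp_det[OF A as(1)] as(2) by simp
qed

lemma inner_gram:
  fixes R :: "complex mat"
  assumes R: "R \<in> carrier_mat n k" and a: "a \<in> carrier_vec k"
  shows "(mat_adjoint R * R *\<^sub>v a) \<bullet>c a = complex_of_real (sqn (R *\<^sub>v a))"
proof -
  have "(mat_adjoint R * R *\<^sub>v a) \<bullet>c a = (mat_adjoint R *\<^sub>v (R *\<^sub>v a)) \<bullet>c a"
    using R a by (simp add: assoc_mult_mat_vec[of _ k n])
  also have "\<dots> = (R *\<^sub>v a) \<bullet>c (R *\<^sub>v a)"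
    using inner_adjoint[of "mat_adjoint R" k n "R *\<^sub>v a" a] R a by simp
  finally show ?thesis by (simp add: inner_self)
qed

lemma inj_gram:
  fixes R :: "complex mat"
  assumes R: "R \<in> carrier_mat n k" and i: "inj_mat R"
  shows "inj_mat (mat_adjoint R * R)"
proof (rule inj_matI)
  show "mat_adjoint R * R \<in> carrier_mat k k" using R by auto
  fix a assume a: "a \<in> carrier_vec k" and "mat_adjoint R * R *\<^sub>v a = 0\<^sub>v k"
  then have "complex_of_real (sqn (R *\<^sub>v a)) = 0" using inner_gram[OF R a] by simp
  then have "R *\<^sub>v a = 0\<^sub>v n" using sqn_eq_0[of "R *\<^sub>v a" n] R a by simp
  from inj_matD[OF i R a this] show "a = 0\<^sub>v k" .
qed

text \<open>The quotient of the two determinants is the determinant of the pencil of Gram matrices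
  \<open>(R\<^sup>* R)\<^sup>-\<^sup>1 N\<^sup>* N\<close>, whose eigenvalues are generalized Rayleigh quotients.\<close>

lemma det_gram_comparison:
  fixes N R :: "complex mat"
  assumes N: "N \<in> carrier_mat k k" and R: "R \<in> carrier_mat n k" and i: "inj_mat R" and c: "0 \<le> c"
    and le: "\<And>a. a \<in> carrier_vec k \<Longrightarrow> c * sqn (R *\<^sub>v a) \<le> sqn (N *\<^sub>v a)"
  shows "c ^ k * Re (det (mat_adjoint R * R)) \<le> (cmod (det N))\<^sup>2"
proof -
  let ?H = "mat_adjoint R * R"
  have H: "?H \<in> carrier_mat k k" using R by auto
  obtain L where L: "L \<in> carrier_mat k k" "?H * L = 1\<^sub>m k" "L * ?H = 1\<^sub>m k"
    using inj_mat_obtain_inverse[OF H inj_gram[OF R i]] by blast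
  let ?G = "mat_adjoint N * N"
  have G: "?G \<in> carrier_mat k k" using N by auto
  have "c ^ k \<le> cmod (det (L * ?G))"
  proof (rule eigenvalues_ge_imp_det_ge[OF _ c])
    show "L * ?G \<in> carrier_mat k k" using L G by auto
    fix z assume "eigenvalue (L * ?G) z"
    then obtain a where "eigenvector (L * ?G) a z" unfolding eigenvalue_def by blast
    then have a: "a \<in> carrier_vec k" "a \<noteq> 0\<^sub>v k" "L * ?G *\<^sub>v a = z \<cdot>\<^sub>v a"
      unfolding eigenvector_def using L by auto
    have "?G *\<^sub>v a = ?H * L *\<^sub>v (?G *\<^sub>v a)" using L G a by simp
    also have "\<dots> = ?H *\<^sub>v (L * ?G *\<^sub>v a)"
      using H L(1) G a(1) by (simp add: assoc_mult_mat_vec[of _ k k])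
    also have "\<dots> = z \<cdot>\<^sub>v (?H *\<^sub>v a)" unfolding a(3) using H a by (simp add: mult_mat_vec)
    finally have "(?G *\<^sub>v a) \<bullet>c a = z * ((?H *\<^sub>v a) \<bullet>c a)"
      using H a by (simp add: inner_smult_left[of _ k])
    then have e: "complex_of_real (sqn (N *\<^sub>v a)) = z * complex_of_real (sqn (R *\<^sub>v a))"
      unfolding inner_gram[OF N a(1)] inner_gram[OF R a(1)] .
    have "R *\<^sub>v a \<noteq> 0\<^sub>v n" using inj_matD[OF i R a(1)] a(2) by blast
    then have p: "0 < sqn (R *\<^sub>v a)" using R a by (intro sqn_pos) auto
    from arg_cong[OF e, of cmod] have "sqn (N *\<^sub>v a) = cmod z * sqn (R *\<^sub>v a)"
      by (simp add: norm_mult)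
    with le[OF a(1)] have "c * sqn (R *\<^sub>v a) \<le> cmod z * sqn (R *\<^sub>v a)" by simp
    with p show "c \<le> cmod z" by simp
  qed
  also have "det (L * ?G) = det L * det ?G" using L(1) G by (rule det_mult)
  finally have "c ^ k \<le> cmod (det L) * cmod (det ?G)" by (simp add: norm_mult)
  moreover have "cmod (det ?H) * cmod (det L) = 1"
    using det_mult[OF H L(1)] L(2) by (metis det_one norm_mult norm_one)
  ultimately have "c ^ k * cmod (det ?H) \<le> cmod (det ?G)"
  proof -
    assume 1: "c ^ k \<le> cmod (det L) * cmod (det ?G)" and 2: "cmod (det ?H) * cmod (det L) = 1"
    have "c ^ k * cmod (det ?H) \<le> cmod (det L) * cmod (det ?G) * cmod (det ?H)"
      using 1 by (rule mult_right_mono) simp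
    also have "\<dots> = cmod (det ?H) * cmod (det L) * cmod (det ?G)" by (simp only: ac_simps)
    finally show ?thesis unfolding 2 by simp
  qed
  also have "cmod (det ?G) = (cmod (det N))\<^sup>2"
  proof -
    have "mat_adjoint N = map_mat cnj (transpose_mat N)" by (intro eq_matI) auto
    then have "det (mat_adjoint N) = cnj (det (transpose_mat N))"
      using N by (simp add: det_def cnj_sum cnj_prod sign_def)
    then have "det (mat_adjoint N) = cnj (det N)" using det_transpose[OF N] by simp
    then show ?thesis using det_mult[of "mat_adjoint N" k N] N by (simp add: norm_mult power2_eq_square)
  qed
  finally have "c ^ k * cmod (det ?H) \<le> (cmod (det N))\<^sup>2" .
  moreover have "c ^ k * Re (det ?H) \<le> c ^ k * cmod (det ?H)"
    using c by (intro mult_left_mono complex_Re_le_cmod) auto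
  ultimately show ?thesis by linarith
qed

section \<open>Sequential compactness and coordinatewise limits\<close>

lemma bounded_complex_convergent_subseq:
  fixes f :: "nat \<Rightarrow> complex"
  assumes b: "\<And>n. cmod (f n) \<le> K"
  obtains r l where "strict_mono r" "(f \<circ> r) \<longlonglongrightarrow> l"
proof -
  \<comment> \<open>Real and imaginary parts are made monotone one after the other; bounded monotone
    sequences converge.\<close>
  obtain r where r: "strict_mono r" "monoseq (\<lambda>n. Re (f (r n)))"
    using seq_monosub[of "\<lambda>n. Re (f n)"] by auto
  obtain s where s: "strict_mono s" "monoseq (\<lambda>n. Im (f (r (s n))))"
    using seq_monosub[of "\<lambda>n. Im (f (r n))"] by auto
  have "Bseq (\<lambda>n. Re (f (r n)))" by (rule BseqI'[of _ K]) (use b abs_Re_le_cmod order_trans in \<open>fastforce\<close>)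
  from Bseq_monoseq_convergent[OF this r(2)] obtain a where "(\<lambda>n. Re (f (r n))) \<longlonglongrightarrow> a"
    unfolding convergent_def by auto
  from LIMSEQ_subseq_LIMSEQ[OF this s(1)] have a: "(\<lambda>n. Re (f (r (s n)))) \<longlonglongrightarrow> a" by (simp add: o_def)
  have "Bseq (\<lambda>n. Im (f (r (s n))))" by (rule BseqI'[of _ K]) (use b abs_Im_le_cmod order_trans in \<open>fastforce\<close>)
  from Bseq_monoseq_convergent[OF this s(2)] obtain c where c: "(\<lambda>n. Im (f (r (s n)))) \<longlonglongrightarrow> c"
    unfolding convergent_def by auto
  have "(\<lambda>n. Complex (Re (f (r (s n)))) (Im (f (r (s n))))) \<longlonglongrightarrow> Complex a c"
    using a c by (rule tendsto_Complex)
  then have "(f \<circ> (r \<circ> s)) \<longlonglongrightarrow> Complex a c" by (simp add: o_def)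
  with strict_mono_o[OF r(1) s(1)] that show thesis by blast
qed

lemma bounded_family_convergent_subseq:
  fixes f :: "nat \<Rightarrow> 'i \<Rightarrow> complex"
  assumes "finite I" and b: "\<And>n i. i \<in> I \<Longrightarrow> cmod (f n i) \<le> K"
  obtains r l where "strict_mono r" "\<And>i. i \<in> I \<Longrightarrow> (\<lambda>n. f (r n) i) \<longlonglongrightarrow> l i"
proof -
  have "\<exists>r l. strict_mono r \<and> (\<forall>i\<in>I. (\<lambda>n. f (r n) i) \<longlonglongrightarrow> l i)"
    using assms
  proof (induction I)
    case empty
    show ?case using strict_mono_id by auto
  next
    case (insert i I)
    then obtain r l where r: "strict_mono r" "\<forall>i\<in>I. (\<lambda>n. f (r n) i) \<longlonglongrightarrow> l i" by auto
    obtain s m where s: "strict_mono s" "(\<lambda>n. f (r (s n)) i) \<longlonglongrightarrow> m"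
      using bounded_complex_convergent_subseq[of "\<lambda>n. f (r n) i" K] insert.prems
      by (auto simp: o_def)
    have "(\<lambda>n. f (r (s n)) j) \<longlonglongrightarrow> (if j = i then m else l j)" if "j \<in> insert i I" for j
    proof (cases "j = i")
      case False
      with that r(2) have "(\<lambda>n. f (r n) j) \<longlonglongrightarrow> l j" by auto
      from LIMSEQ_subseq_LIMSEQ[OF this s(1)] False show ?thesis by (simp add: o_def)
    qed (use s in auto)
    then show ?case
      by (intro exI[of _ "r \<circ> s"] exI[of _ "\<lambda>j. if j = i then m else l j"])
        (use strict_mono_o[OF r(1) s(1)] in \<open>auto simp: o_def\<close>)
  qed
  then show thesis using that by blast
qed

text \<open>The dimension is an argument because the type does not carry it. The carrier conditions
  on all terms and on the limit are what make the limit unique.\<close>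

definition vlim :: "nat \<Rightarrow> (nat \<Rightarrow> complex vec) \<Rightarrow> complex vec \<Rightarrow> bool" where
  "vlim n X x \<longleftrightarrow> (\<forall>k. X k \<in> carrier_vec n) \<and> x \<in> carrier_vec n \<and>
     (\<forall>i<n. (\<lambda>k. X k $ i) \<longlonglongrightarrow> x $ i)"

lemma vlimI:
  assumes "\<And>k. X k \<in> carrier_vec n" "x \<in> carrier_vec n" "\<And>i. i < n \<Longrightarrow> (\<lambda>k. X k $ i) \<longlonglongrightarrow> x $ i"
  shows "vlim n X x"
  using assms unfolding vlim_def by auto

lemma vlimD:
  assumes "vlim n X x"
  shows "X k \<in> carrier_vec n" "x \<in> carrier_vec n" "i < n \<Longrightarrow> (\<lambda>k. X k $ i) \<longlonglongrightarrow> x $ i"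
    "dim_vec (X k) = n" "dim_vec x = n"
  using assms unfolding vlim_def by auto

lemma vlim_unique:
  assumes "vlim n X x" "vlim n X y"
  shows "x = y"
  using vlimD[OF assms(1)] vlimD[OF assms(2)] by (intro eq_vecI) (auto intro: LIMSEQ_unique)

lemma vlim_subseq: "vlim n X x \<Longrightarrow> strict_mono r \<Longrightarrow> vlim n (\<lambda>k. X (r k)) x"
  unfolding vlim_def using LIMSEQ_subseq_LIMSEQ[of _ _ r] by (auto simp: o_def)

lemma vlim_add:
  assumes "vlim n X x" "vlim n Y y"
  shows "vlim n (\<lambda>k. X k + Y k) (x + y)"
  using vlimD[OF assms(1)] vlimD[OF assms(2)] by (intro vlimI) (auto simp: vlimD(4)[OF assms(1)] vlimD(4)[OF assms(2)] intro!: tendsto_add)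

lemma vlim_smult:
  assumes "vlim n X x"
  shows "vlim n (\<lambda>k. c \<cdot>\<^sub>v X k) (c \<cdot>\<^sub>v x)"
  using vlimD[OF assms] by (intro vlimI) (auto simp: vlimD(4)[OF assms] intro!: tendsto_mult)

lemma vlim_mult_mat_vec:
  assumes M: "M \<in> carrier_mat m n" and X: "vlim n X x"
  shows "vlim m (\<lambda>k. M *\<^sub>v X k) (M *\<^sub>v x)"
proof (rule vlimI)
  fix i assume i: "i < m"
  have "(\<lambda>k. \<Sum>j<n. M $$ (i,j) * X k $ j) \<longlonglongrightarrow> (\<Sum>j<n. M $$ (i,j) * x $ j)"
    using X unfolding vlim_def by (intro tendsto_sum tendsto_mult) auto
  moreover have "(M *\<^sub>v y) $ i = (\<Sum>j<n. M $$ (i,j) * y $ j)" if "y \<in> carrier_vec n" for y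
    using i M that by (auto simp: scalar_prod_def atLeast0LessThan)
  ultimately show "(\<lambda>k. (M *\<^sub>v X k) $ i) \<longlonglongrightarrow> (M *\<^sub>v x) $ i" using X unfolding vlim_def by simp
qed (use M X in \<open>auto simp: vlim_def\<close>)

lemma vlim_sqn:
  assumes "vlim n X x"
  shows "(\<lambda>k. sqn (X k)) \<longlonglongrightarrow> sqn x"
proof -
  have d: "dim_vec (X k) = n" "dim_vec x = n" for k using assms unfolding vlim_def by auto
  show ?thesis unfolding sqn_def d using assms unfolding vlim_def by (auto intro!: tendsto_intros)
qed

lemma vlim_zeroI:
  fixes X :: "nat \<Rightarrow> complex vec"
  assumes X: "\<And>k. X k \<in> carrier_vec n" and z: "(\<lambda>k. sqn (X k)) \<longlonglongrightarrow> 0"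
  shows "vlim n X (0\<^sub>v n)"
proof (rule vlimI)
  fix i assume i: "i < n"
  have "(\<lambda>k. sqrt (sqn (X k))) \<longlonglongrightarrow> 0" using tendsto_real_sqrt[OF z] by simp
  have "(\<lambda>k. cmod (X k $ i)) \<longlonglongrightarrow> 0"
  proof (rule tendsto_sandwich[OF _ _ tendsto_const \<open>(\<lambda>k. sqrt (sqn (X k))) \<longlonglongrightarrow> 0\<close>])
    show "\<forall>\<^sub>F k in sequentially. cmod (X k $ i) \<le> sqrt (sqn (X k))"
      using carrier_vecD[OF X] i by (intro always_eventually allI cmod_index_le_sqrt_sqn) simp
  qed auto
  then have "(\<lambda>k. X k $ i) \<longlonglongrightarrow> 0" by (rule tendsto_norm_zero_cancel)
  then show "(\<lambda>k. X k $ i) \<longlonglongrightarrow> 0\<^sub>v n $ i" using i by simp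
qed (use X in auto)

lemma bounded_vec_convergent_subseq:
  fixes X :: "nat \<Rightarrow> complex vec"
  assumes X: "\<And>k. X k \<in> carrier_vec n" and b: "\<And>k. sqn (X k) \<le> K"
  obtains r x where "strict_mono r" "vlim n (\<lambda>k. X (r k)) x"
proof -
  have "cmod (X k $ i) \<le> sqrt K" if "i \<in> {..<n}" for k i
    using cmod_index_le_sqrt_sqn[of i "X k"] X[of k] b[of k] that
    by (auto intro: order_trans[OF _ real_sqrt_le_mono])
  from bounded_family_convergent_subseq[of "{..<n}" "\<lambda>k i. X k $ i", OF _ this]
  obtain r l where r: "strict_mono r" "\<And>i. i \<in> {..<n} \<Longrightarrow> (\<lambda>k. X (r k) $ i) \<longlonglongrightarrow> l i" by auto
  have "vlim n (\<lambda>k. X (r k)) (vec n l)" using r X by (intro vlimI) auto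
  with r that show thesis by blast
qed

text \<open>Each entry is bounded by the norm of a column, which is 1, so all entries converge along
  one subsequence. The limit preserves norms and is therefore injective: no dimension is
  lost.\<close>

lemma isometry_convergent_subseq:
  fixes R :: "nat \<Rightarrow> complex mat"
  assumes R: "\<And>j. R j \<in> carrier_mat n k" and I: "\<And>j. mat_adjoint (R j) * R j = 1\<^sub>m k"
  obtains r S where "strict_mono r" "S \<in> carrier_mat n k"
    "\<And>a. a \<in> carrier_vec k \<Longrightarrow> vlim n (\<lambda>j. R (r j) *\<^sub>v a) (S *\<^sub>v a)"
    "\<And>a. a \<in> carrier_vec k \<Longrightarrow> sqn (S *\<^sub>v a) = sqn a"
proof -
  have "cmod (R j $$ i) \<le> 1" if i: "i \<in> {..<n} \<times> {..<k}" for j i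
  proof -
    obtain p q where pq: "i = (p,q)" "p < n" "q < k" using i by auto
    have "cmod ((R j *\<^sub>v unit_vec k q) $ p) \<le> sqrt (sqn (R j *\<^sub>v unit_vec k q))"
      using R[of j] pq by (intro cmod_index_le_sqrt_sqn) auto
    also have "sqn (R j *\<^sub>v unit_vec k q) = sqn (unit_vec k q)" using isometry_sqn[OF R I] by simp
    also have "\<dots> = (\<Sum>l<k. if l = q then 1 else 0)"
      unfolding sqn_def using pq by (intro sum.cong) (auto simp: unit_vec_def)
    also have "\<dots> = 1" using pq by simp
    finally show ?thesis using R[of j] pq by (simp add: mult_mat_unit_vec)
  qed
  from bounded_family_convergent_subseq[of "{..<n} \<times> {..<k}" "\<lambda>j i. R j $$ i", OF _ this]
  obtain r l where r: "strict_mono r"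
    and l: "\<And>i. i \<in> {..<n} \<times> {..<k} \<Longrightarrow> (\<lambda>j. R (r j) $$ i) \<longlonglongrightarrow> l i" by auto
  define S where "S = mat n k l"
  have S: "S \<in> carrier_mat n k" unfolding S_def by auto
  have lim: "vlim n (\<lambda>j. R (r j) *\<^sub>v a) (S *\<^sub>v a)" if a: "a \<in> carrier_vec k" for a
  proof (rule vlimI)
    fix i assume i: "i < n"
    have "(\<lambda>j. \<Sum>q<k. R (r j) $$ (i,q) * a $ q) \<longlonglongrightarrow> (\<Sum>q<k. S $$ (i,q) * a $ q)"
      using l i by (intro tendsto_sum tendsto_mult) (auto simp: S_def)
    moreover have "(M *\<^sub>v a) $ i = (\<Sum>q<k. M $$ (i,q) * a $ q)" if "M \<in> carrier_mat n k" for M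
      using i a that by (auto simp: scalar_prod_def atLeast0LessThan)
    ultimately show "(\<lambda>j. (R (r j) *\<^sub>v a) $ i) \<longlonglongrightarrow> (S *\<^sub>v a) $ i" using R S by simp
  qed (use mult_mat_vec_carrier[OF R a] mult_mat_vec_carrier[OF S a] in auto)
  have "sqn (S *\<^sub>v a) = sqn a" if a: "a \<in> carrier_vec k" for a
    using LIMSEQ_unique[OF vlim_sqn[OF lim[OF a]], of "sqn a"] isometry_sqn[OF R I a] by simp
  with r S lim that show thesis by blast
qed

text \<open>The change of basis \<open>T\<close> is returned with its inverse because the matrix of
  the restriction to an invariant range has to be conjugated by it.\<close>

lemma gram_schmidt_normalize:
  fixes R :: "complex mat"
  assumes R: "R \<in> carrier_mat n k" and i: "inj_mat R"
  obtains T T' where "T \<in> carrier_mat k k" "T' \<in> carrier_mat k k" "T * T' = 1\<^sub>m k" "T' * T = 1\<^sub>m k"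
    "mat_adjoint (R * T) * (R * T) = 1\<^sub>m k"
proof -
  interpret cof_vec_space n "TYPE(complex)" .
  have kn: "k \<le> n" using inj_mat_le[OF R i] .
  note d = inj_mat_distinct_cols[OF R i]
  have li: "lin_indpt (set (cols R))" using lin_depE[OF R _ d] inj_matD[OF i R] by metis
  have cR: "set (cols R) \<subseteq> carrier_vec n" using R cols_dim by blast
  define us where "us = gram_schmidt n (cols R)"
  from gram_schmidt_result[OF cR d li us_def]
  have us: "span (set (cols R)) = span (set us)" "corthogonal us" "set us \<subseteq> carrier_vec n"
    "length us = k" using R by auto
  define ws where "ws = map (\<lambda>u. complex_of_real (1 / sqrt (sqn u)) \<cdot>\<^sub>v u) us"
  define W where "W = mat_of_cols n ws"
  have W: "W \<in> carrier_mat n k" unfolding W_def ws_def using us(4) by (intro carrier_matI) auto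
  have uc: "us ! j \<in> carrier_vec n" if "j < k" for j using us that by auto
  have colW: "col W j = complex_of_real (1 / sqrt (sqn (us ! j))) \<cdot>\<^sub>v us ! j" if "j < k" for j
    unfolding W_def ws_def using that us uc[OF that] by (simp add: col_mat_of_cols)
  have orth: "col W i \<bullet>c col W j = (if i = j then 1 else 0)" if ij: "i < k" "j < k" for i j
  proof -
    have e: "col W i \<bullet>c col W j =
      complex_of_real (1 / sqrt (sqn (us ! i))) * complex_of_real (1 / sqrt (sqn (us ! j))) * (us ! i \<bullet>c us ! j)"
      unfolding colW[OF ij(1)] colW[OF ij(2)] using uc ij
      by (simp add: inner_smult_left[of _ n] inner_smult_right[of _ n])
    show ?thesis
    proof (cases "i = j")
      case True
      have "us ! i \<bullet>c us ! i \<noteq> 0" using us(2,4) ij unfolding corthogonal_def by auto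
      then have "sqn (us ! i) > 0" using sqn_nonneg[of "us ! i"] by (simp add: inner_self less_eq_real_def)
      then have "(1 / sqrt (sqn (us ! i))) * (1 / sqrt (sqn (us ! i))) * sqn (us ! i) = 1" by simp
      then show ?thesis unfolding e using True inner_self[of "us ! i"]
        by (metis of_real_1 of_real_mult)
    next
      case False
      then have "us ! i \<bullet>c us ! j = 0" using us(2,4) ij unfolding corthogonal_def by auto
      then show ?thesis using False e by simp
    qed
  qed
  have WW: "mat_adjoint W * W = 1\<^sub>m k"
  proof (rule eq_matI)
    fix i j assume "i < dim_row (1\<^sub>m k)" "j < dim_col (1\<^sub>m k)"
    then have ij: "i < k" "j < k" by auto
    have "(mat_adjoint W * W) $$ (i,j) = col W j \<bullet>c col W i"
      using W ij by (simp add: scalar_prod_def ac_simps)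
    then show "(mat_adjoint W * W) $$ (i,j) = 1\<^sub>m k $$ (i,j)" using orth ij by auto
  qed (use W in auto)
  \<comment> \<open>The columns of \<open>W\<close> are scaled Gram-Schmidt vectors, which span the
    same space as the columns of \<open>R\<close>; the factorization through \<open>R\<close>
    produces \<open>T\<close>.\<close>
  have "\<exists>b \<in> carrier_vec k. W *\<^sub>v a = R *\<^sub>v b" if a: "a \<in> carrier_vec k" for a
  proof -
    have cs: "col_space R = {y \<in> carrier_vec n. \<exists>x \<in> carrier_vec k. R *\<^sub>v x = y}"
      using col_space_eq[of R] R by auto
    have "set (cols W) \<subseteq> span (set us)"
    proof
      fix w assume "w \<in> set (cols W)"
      then obtain j where j: "j < k" "w = col W j" using W by (auto simp: cols_def)
      have "us ! j \<in> span (set us)" using us j span_mem[OF us(3)] by auto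
      then show "w \<in> span (set us)" unfolding j(2) colW[OF j(1)] 
        by (rule smult_in_span[OF us(3)])
    qed
    then have "span (set (cols W)) \<subseteq> span (set us)" by (rule span_subsetI[OF us(3)])
    then have "col_space W \<subseteq> col_space R" unfolding col_space_def us(1) .
    moreover have "W *\<^sub>v a \<in> col_space W" using col_space_eq[of W] W a by auto
    ultimately have "W *\<^sub>v a \<in> {y \<in> carrier_vec n. \<exists>x \<in> carrier_vec k. R *\<^sub>v x = y}"
      unfolding cs by (rule subsetD)
    then obtain b where "b \<in> carrier_vec k" "R *\<^sub>v b = W *\<^sub>v a" by auto
    then show ?thesis by (intro bexI[of _ b]) auto
  qed
  from columns_in_range_factor[OF W R this] obtain T where T: "T \<in> carrier_mat k k" "W = R * T" by blast
  have "inj_mat W" using left_inverse_inj_mat[OF W _ WW] W by auto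
  then have "inj_mat T" unfolding T(2) by (rule inj_mat_left_factor[OF R T(1)])
  from inj_mat_obtain_inverse[OF T(1) this] obtain T' where "T' \<in> carrier_mat k k" "T * T' = 1\<^sub>m k" "T' * T = 1\<^sub>m k" .
  with T WW that show thesis by blast
qed

section \<open>Stable subspaces\<close>

lemma poly_prod_linear_eq_0:
  "poly (\<Prod>a\<leftarrow>as. [:- a, 1:]) (z :: 'a :: field) = 0 \<longleftrightarrow> z \<in> set as"
  by (induction as) auto

lemma spectrum_eq_set:
  fixes A :: "'a :: field mat"
  assumes "A \<in> carrier_mat n n" "char_poly A = (\<Prod>a\<leftarrow>as. [:- a, 1:])"
  shows "spectrum A = set as"
  using spectrum_root_char_poly[OF assms(1)] unfolding assms(2) poly_prod_linear_eq_0 by auto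

text \<open>The order of a root in a product of monic linear factors is the number of its
  occurrences in the list, so every eigenvalue count becomes the length of a filtered list.\<close>

lemma sum_alg_mult_eq_length_filter:
  fixes A :: "'a :: field mat"
  assumes A: "A \<in> carrier_mat n n" and c: "char_poly A = (\<Prod>a\<leftarrow>as. [:- a, 1:])"
  shows "(\<Sum>x | x \<in> spectrum A \<and> P x. alg_mult A x) = length (filter P as)"
proof -
  have o: "alg_mult A x = count_list as x" for x
  proof -
    have "alg_mult A x = sum_list (map (Polynomial.order x) (map (\<lambda>a. [:- a, 1:]) as))"
      unfolding alg_mult_def c by (rule order_prod_list) auto
    also have "\<dots> = count_list as x" by (induction as) (auto simp: order_linear')
    finally show ?thesis .
  qed
  have "(\<Sum>x | x \<in> spectrum A \<and> P x. alg_mult A x) = (\<Sum>x \<in> set (filter P as). count_list (filter P as) x)"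
    unfolding o spectrum_eq_set[OF A c]
    by (intro sum.cong) (auto simp: count_list_eq_length_filter intro!: arg_cong[of _ _ length] filter_cong)
  also have "\<dots> = length (filter P as)" by (rule sum_count_set) auto
  finally show ?thesis .
qed

lemma num_stable_eigenvalues_eq:
  assumes "A \<in> carrier_mat n n" "char_poly A = (\<Prod>a\<leftarrow>as. [:- a, 1:])"
  shows "num_stable_eigenvalues A = length (filter (\<lambda>z. Re z < 0) as)"
  unfolding num_stable_eigenvalues_def using sum_alg_mult_eq_length_filter[OF assms] .

lemma num_pos_eigenvalues_eq:
  assumes "A \<in> carrier_mat n n" "char_poly A = (\<Prod>a\<leftarrow>as. [:- a, 1:])"
  shows "num_pos_eigenvalues A = length (filter (\<lambda>z. 0 < z) as)"
  unfolding num_pos_eigenvalues_def using sum_alg_mult_eq_length_filter[OF assms] .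

lemma char_poly_uminus:
  fixes A :: "complex mat"
  assumes A: "A \<in> carrier_mat n n" and c: "char_poly A = (\<Prod>a\<leftarrow>as. [:- a, 1:])"
  shows "char_poly (- A) = (\<Prod>a\<leftarrow>map uminus as. [:- a, 1:])"
proof -
  obtain B P Q where s: "schur_decomposition A as = (B, P, Q)" by (cases "schur_decomposition A as") auto
  from schur_decomposition[OF A c s] have w: "similar_mat_wit A B P Q" "upper_triangular B" "diag_mat B = as"
    by auto
  note d = similar_mat_witD2[OF A w(1)]
  have "- A = P * (- B) * Q" using d by (simp add: uminus_mult_left_mat uminus_mult_right_mat)
  then have "similar_mat_wit (- A) (- B) P Q" using d by (intro similar_mat_witI[of _ _ n]) auto
  then have "char_poly (- A) = char_poly (- B)"
    by (intro char_poly_similar) (auto simp: similar_mat_def)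
  also have "\<dots> = (\<Prod>a\<leftarrow>diag_mat (- B). [:- a, 1:])"
    using w(2) d by (intro char_poly_upper_triangular[of _ n]) (auto simp: upper_triangular_def)
  also have "diag_mat (- B) = map uminus as" unfolding w(3)[symmetric] diag_mat_def using d(5) by auto
  finally show ?thesis .
qed

text \<open>The number of columns is left free: the range of \<open>R\<close> is some invariant
  subspace, possibly smaller than the whole stable subspace, and \<open>X\<close> is the matrix of
  the restriction of \<open>M\<close> to it.\<close>

definition stable_frame :: "complex mat \<Rightarrow> complex mat \<Rightarrow> complex mat \<Rightarrow> bool" where
  "stable_frame M R X \<longleftrightarrow>
     R \<in> carrier_mat (dim_row M) (dim_col R) \<and> X \<in> carrier_mat (dim_col R) (dim_col R) \<and>
     stable_mat X \<and> M * R = R * X \<and> inj_mat R"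

lemma stable_frameI:
  assumes "M \<in> carrier_mat n n" "R \<in> carrier_mat n k" "X \<in> carrier_mat k k" "stable_mat X"
    "M * R = R * X" "inj_mat R"
  shows "stable_frame M R X"
  using assms unfolding stable_frame_def by auto

lemma stable_frameD:
  assumes "stable_frame M R X" "M \<in> carrier_mat n n"  "R \<in> carrier_mat n k"
  shows "X \<in> carrier_mat k k" "stable_mat X" "M * R = R * X" "inj_mat R"
  using assms unfolding stable_frame_def by auto

lemma stable_matD: "stable_mat X \<Longrightarrow> eigenvalue X z \<Longrightarrow> Re z < 0"
  unfolding stable_mat_def spectrum_def by auto

lemma stable_mat_upper_triangular:
  assumes X: "X \<in> carrier_mat k k" and u: "upper_triangular X" and d: "\<forall>z \<in> set (diag_mat X). Re z < 0"
  shows "stable_mat X"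
  using X d spectrum_eq_set[OF X char_poly_upper_triangular[OF X u]] unfolding stable_mat_def by auto

text \<open>The leading columns of \<open>P\<close> span an invariant subspace because
  \<open>T\<close> is upper triangular, and the leading rows of \<open>Q\<close> are a left inverse
  of them. Generality in the field serves both complex and real frames.\<close>

lemma similar_triangular_leading_block:
  fixes M :: "'a :: field mat"
  assumes M: "M \<in> carrier_mat n n" and w: "similar_mat_wit M T P Q" and u: "upper_triangular T" and k: "k \<le> n"
  defines "R \<equiv> mat n k (\<lambda>(i,j). P $$ (i,j))" and "X \<equiv> mat k k (\<lambda>(i,j). T $$ (i,j))"
  shows "M * R = R * X" "inj_mat R" "upper_triangular X" "diag_mat X = take k (diag_mat T)"
proof -
  note d = similar_mat_witD2[OF M w]
  have "M * P = P * T * (Q * P)" using d by (simp add: assoc_mult_mat[of _ n n _ n _ n])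
  then have MP: "M * P = P * T" using d by simp
  show "M * R = R * X"
  proof (rule eq_matI)
    fix i j assume "i < dim_row (R * X)" "j < dim_col (R * X)"
    then have i: "i < n" and j: "j < k" unfolding R_def X_def by auto
    have "(M * R) $$ (i,j) = (M * P) $$ (i,j)"
      using i j k M d(6) unfolding R_def by (auto simp: scalar_prod_def)
    also have "\<dots> = (\<Sum>l<n. P $$ (i,l) * T $$ (l,j))"
      unfolding MP using d i j k by (simp add: scalar_prod_def atLeast0LessThan)
    also have "\<dots> = (\<Sum>l<k. P $$ (i,l) * T $$ (l,j))"
      using k j u d(5) unfolding upper_triangular_def by (intro sum.mono_neutral_right) auto
    also have "\<dots> = (R * X) $$ (i,j)"
      using i j unfolding R_def X_def by (simp add: scalar_prod_def atLeast0LessThan)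
    finally show "(M * R) $$ (i,j) = (R * X) $$ (i,j)" .
  qed (use M in \<open>auto simp: R_def X_def\<close>)
  let ?L = "mat k n (\<lambda>(i,j). Q $$ (i,j))"
  have "?L * R = 1\<^sub>m k"
  proof (rule eq_matI)
    fix i j assume "i < dim_row (1\<^sub>m k)" "j < dim_col (1\<^sub>m k)"
    then have i: "i < k" and j: "j < k" by auto
    have "(?L * R) $$ (i,j) = (Q * P) $$ (i,j)"
      using i j k d(6,7) unfolding R_def by (auto simp: scalar_prod_def)
    also have "\<dots> = 1\<^sub>m n $$ (i,j)" unfolding d(2) ..
    finally show "(?L * R) $$ (i,j) = 1\<^sub>m k $$ (i,j)" using i j k by simp
  qed (auto simp: R_def)
  then show "inj_mat R" by (intro left_inverse_inj_mat[of R n k ?L]) (auto simp: R_def)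
  show "upper_triangular X" using u d(5) k unfolding upper_triangular_def X_def by auto
  show "diag_mat X = take k (diag_mat T)"
    using d(5) k by (intro nth_equalityI) (auto simp: diag_mat_def X_def)
qed

text \<open>Square-integrable solutions of \<open>y' = M y\<close> have Laplace transforms bounded by
  \<open>C / \<surd>(Re s)\<close>. This is the form in which decay at infinity survives the limit.\<close>

definition hardy :: "complex mat \<Rightarrow> complex vec \<Rightarrow> bool" where
  "hardy M g \<longleftrightarrow> (\<exists>C. \<forall>s. 0 < Re s \<longrightarrow>
     (\<exists>y \<in> carrier_vec (dim_row M). s \<cdot>\<^sub>v y - M *\<^sub>v y = g \<and> sqn y \<le> C / Re s))"

text \<open>In Schur coordinates, back substitution from the last row gives scalar equations
  \<open>(s - \<mu>) x = W\<close> with \<open>Re \<mu> \<ge> 0\<close>. When \<open>s\<close>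
  approaches \<open>\<mu>\<close> from the right at distance \<open>\<delta>\<close>, the bound on
  \<open>x\<close> yields \<open>|W|^2\<close> of order \<open>\<delta>\<close>, hence
  \<open>W = 0\<close>. Imaginary eigenvalues are excluded together with the unstable ones.\<close>

lemma hardy_in_leading_range:
  fixes M :: "complex mat"
  assumes M: "M \<in> carrier_mat n n" and w: "similar_mat_wit M T P Q" and u: "upper_triangular T" and k: "k \<le> n"
    and un: "\<And>i. k \<le> i \<Longrightarrow> i < n \<Longrightarrow> 0 \<le> Re (T $$ (i,i))"
    and g: "g \<in> carrier_vec n" and hg: "hardy M g"
  shows "\<exists>a \<in> carrier_vec k. g = mat n k (\<lambda>(i,j). P $$ (i,j)) *\<^sub>v a"
proof -
  note d = similar_mat_witD2[OF M w]
  from hg obtain C where "\<forall>s. 0 < Re s \<longrightarrow> (\<exists>y \<in> carrier_vec n. s \<cdot>\<^sub>v y - M *\<^sub>v y = g \<and> sqn y \<le> C / Re s)"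
    unfolding hardy_def using M by auto
  then obtain y where y: "\<And>s. 0 < Re s \<Longrightarrow> y s \<in> carrier_vec n"
    "\<And>s. 0 < Re s \<Longrightarrow> s \<cdot>\<^sub>v y s - M *\<^sub>v y s = g"
    "\<And>s. 0 < Re s \<Longrightarrow> sqn (y s) \<le> C / Re s" by metis
  obtain CQ where CQ: "CQ > 0" "\<And>x. x \<in> carrier_vec n \<Longrightarrow> sqn (Q *\<^sub>v x) \<le> CQ * sqn x"
    using sqn_mult_vec_bounded[OF d(7)] by blast
  define W where "W = Q *\<^sub>v g"
  define x where "x s = Q *\<^sub>v y s" for s
  have W: "W \<in> carrier_vec n" unfolding W_def using d g by auto
  have xc: "x s \<in> carrier_vec n" if "0 < Re s" for s unfolding x_def using d y(1)[OF that] by auto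
  have QM: "Q * M = T * Q"
  proof -
    have "Q * M = (Q * P) * T * Q" unfolding d(3) using d(4-7) by (simp add: assoc_mult_mat[of _ n n _ n _ n])
    then show ?thesis using d by simp
  qed
  have eqx: "s \<cdot>\<^sub>v x s - T *\<^sub>v x s = W" if l: "0 < Re s" for s
  proof -
    have "W = Q *\<^sub>v (s \<cdot>\<^sub>v y s - M *\<^sub>v y s)" unfolding y(2)[OF l] W_def ..
    also have "\<dots> = s \<cdot>\<^sub>v x s - Q *\<^sub>v (M *\<^sub>v y s)"
      unfolding x_def using M y(1)[OF l] mult_mat_vec[OF d(7) y(1)[OF l]]
      by (subst mult_minus_distrib_mat_vec[OF d(7)]) auto
    also have "Q *\<^sub>v (M *\<^sub>v y s) = T *\<^sub>v x s"
      unfolding x_def using d M y(1)[OF l] QM by (metis assoc_mult_mat_vec)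
    finally show ?thesis by simp
  qed
  have bx: "(cmod (x s $ i))\<^sup>2 \<le> CQ * C / Re s" if l: "0 < Re s" and i: "i < n" for s i
  proof -
    have "(cmod (x s $ i))\<^sup>2 \<le> sqn (x s)" using xc[OF l] i by (intro cmod_index_le_sqn) auto
    also have "\<dots> \<le> CQ * sqn (y s)" unfolding x_def using CQ(2) y(1)[OF l] .
    also have "\<dots> \<le> CQ * (C / Re s)" using CQ(1) y(3)[OF l] by (intro mult_left_mono) auto
    finally show ?thesis by simp
  qed
  \<comment> \<open>The finite set of \<open>s\<close> at which some row equation is singular. Only
    off this set do the solution components below row \<open>i\<close> vanish, and back substitution
    needs them to vanish.\<close>
  define D where "D = set (diag_mat T)"
  have main: "W $ i = 0 \<and> (\<forall>s. 0 < Re s \<longrightarrow> s \<notin> D \<longrightarrow> x s $ i = 0)" if "k \<le> i" "i < n" for i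
    using that
  proof (induction "n - i" arbitrary: i rule: less_induct)
    case less
    have row: "(s - T $$ (i,i)) * x s $ i = W $ i" if l: "0 < Re s" and nD: "s \<notin> D" for s
    proof -
      have "(T *\<^sub>v x s) $ i = (\<Sum>j<n. T $$ (i,j) * x s $ j)"
        using d(5) xc[OF l] less.prems by (auto simp: scalar_prod_def atLeast0LessThan)
      also have "\<dots> = (\<Sum>j\<in>{i}. T $$ (i,j) * x s $ j)"
      proof (rule sum.mono_neutral_right)
        show "\<forall>j\<in>{..<n} - {i}. T $$ (i,j) * x s $ j = 0"
        proof
          fix j assume j: "j \<in> {..<n} - {i}"
          show "T $$ (i,j) * x s $ j = 0"
          proof (cases "j < i")
            case True
            then show ?thesis using u d(5) less.prems unfolding upper_triangular_def by auto
          next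
            case False
            with j have "n - j < n - i" "k \<le> j" "j < n" using less.prems by auto
            from less.hyps[OF this] l nD show ?thesis by simp
          qed
        qed
      qed (use less.prems in auto)
      finally have "(T *\<^sub>v x s) $ i = T $$ (i,i) * x s $ i" by simp
      moreover have "W $ i = s * x s $ i - (T *\<^sub>v x s) $ i"
        unfolding eqx[OF l, symmetric] using xc[OF l] d(5) less.prems by (simp del: index_mult_mat_vec)
      ultimately show ?thesis by (simp add: algebra_simps)
    qed
    let ?\<mu> = "T $$ (i,i)"
    have re: "0 \<le> Re ?\<mu>" using un less.prems by auto
    have W0: "W $ i = 0"
    proof (rule ccontr)
      assume "W $ i \<noteq> 0"
      \<comment> \<open>Below this threshold \<open>\<delta> * \<bar>CQ * C\<bar>\<close> is smaller
        than \<open>|W_i|^2\<close>. The added 1 keeps the quotient well defined.\<close>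
      define e where "e = (cmod (W $ i))\<^sup>2 / (\<bar>CQ * C\<bar> + 1)"
      have e: "0 < e" unfolding e_def using \<open>W $ i \<noteq> 0\<close> by (intro divide_pos_pos) auto
      have fin: "finite ((\<lambda>z. Re (z - ?\<mu>)) ` D)" unfolding D_def by auto
      \<comment> \<open>Only finitely many \<open>\<delta>\<close> would put \<open>s\<close> into
        \<open>D\<close>, so the interval contains an admissible one.\<close>
      have "infinite {0<..<e}" using e by (simp add: infinite_Ioo)
      with fin have "infinite ({0<..<e} - (\<lambda>z. Re (z - ?\<mu>)) ` D)" by (rule Diff_infinite_finite)
      then obtain \<delta> where \<delta>: "0 < \<delta>" "\<delta> < e" "\<delta> \<notin> (\<lambda>z. Re (z - ?\<mu>)) ` D"
        by (metis (no_types, lifting) DiffE finite.emptyI greaterThanLessThan_iff ex_in_conv)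
      define s where "s = ?\<mu> + complex_of_real \<delta>"
      have nD: "s \<notin> D" using \<delta>(3) by (auto simp: s_def image_iff)
      have l: "0 < Re s" "\<delta> \<le> Re s" unfolding s_def using re \<delta> by auto
      have "W $ i = complex_of_real \<delta> * x s $ i" using row[OF l(1) nD] by (simp add: s_def)
      then have "(cmod (W $ i))\<^sup>2 = \<delta>\<^sup>2 * (cmod (x s $ i))\<^sup>2" using \<delta> by (simp add: norm_mult power_mult_distrib)
      also have "\<dots> \<le> \<delta>\<^sup>2 * (\<bar>CQ * C\<bar> / \<delta>)"
      proof (rule mult_left_mono)
        have "(cmod (x s $ i))\<^sup>2 \<le> CQ * C / Re s" using bx l less.prems by auto
        also have "\<dots> \<le> \<bar>CQ * C\<bar> / Re s" using l by (intro divide_right_mono) auto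
        also have "\<dots> \<le> \<bar>CQ * C\<bar> / \<delta>" using l \<delta> by (intro divide_left_mono) auto
        finally show "(cmod (x s $ i))\<^sup>2 \<le> \<bar>CQ * C\<bar> / \<delta>" .
      qed simp
      also have "\<dots> = \<delta> * \<bar>CQ * C\<bar>" using \<delta> by (simp add: power2_eq_square)
      also have "\<dots> < e * (\<bar>CQ * C\<bar> + 1)" using \<delta> by (intro mult_strict_mono') auto
      also have "\<dots> = (cmod (W $ i))\<^sup>2" unfolding e_def by simp
      finally show False by simp
    qed
    moreover have "x s $ i = 0" if "0 < Re s" "s \<notin> D" for s
    proof -
      have "?\<mu> \<in> D" unfolding D_def diag_mat_def using d(5) less.prems by auto
      with that(2) have "s - ?\<mu> \<noteq> 0" by auto
      then show ?thesis using row[OF that] W0 by simp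
    qed
    ultimately show ?case by blast
  qed
  let ?a = "vec k (\<lambda>i. W $ i)"
  have "g = P *\<^sub>v W" unfolding W_def using d g by (metis assoc_mult_mat_vec one_mult_mat_vec)
  also have "\<dots> = mat n k (\<lambda>(i,j). P $$ (i,j)) *\<^sub>v ?a"
  proof (rule eq_vecI)
    fix i assume "i < dim_vec (mat n k (\<lambda>(i,j). P $$ (i,j)) *\<^sub>v ?a)"
    then have i: "i < n" by simp
    have "(P *\<^sub>v W) $ i = (\<Sum>j<n. P $$ (i,j) * W $ j)"
      using i d W by (auto simp: scalar_prod_def atLeast0LessThan)
    also have "\<dots> = (\<Sum>j<k. P $$ (i,j) * W $ j)"
      using k main by (intro sum.mono_neutral_right) auto
    also have "\<dots> = (mat n k (\<lambda>(i,j). P $$ (i,j)) *\<^sub>v ?a) $ i"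
      using i by (simp add: scalar_prod_def atLeast0LessThan)
    finally show "(P *\<^sub>v W) $ i = (mat n k (\<lambda>(i,j). P $$ (i,j)) *\<^sub>v ?a) $ i" .
  qed (use d in auto)
  finally show ?thesis by (intro bexI[of _ ?a]) auto
qed

text \<open>The Schur decomposition admits any order of the eigenvalues; listing the stable ones
  first makes the leading block the entire stable subspace, which then captures every vector with
  the resolvent bound \<open>hardy\<close>.\<close>

lemma stable_frame_exists:
  fixes M :: "complex mat"
  assumes M: "M \<in> carrier_mat n n"
  obtains R X where "R \<in> carrier_mat n (num_stable_eigenvalues M)" "stable_frame M R X"
    "\<And>g. g \<in> carrier_vec n \<Longrightarrow> hardy M g \<Longrightarrow>
       \<exists>a \<in> carrier_vec (num_stable_eigenvalues M). g = R *\<^sub>v a"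
    "num_stable_eigenvalues M \<le> n"
proof -
  obtain as where as: "char_poly M = (\<Prod>a\<leftarrow>as. [:- a, 1:])" "length as = n"
    using char_poly_factorized[OF M] by auto
  let ?P = "\<lambda>z. Re z < 0"
  define es where "es = filter ?P as @ filter (\<lambda>z. \<not> ?P z) as"
  let ?k = "length (filter ?P as)"
  have k: "num_stable_eigenvalues M = ?k" using num_stable_eigenvalues_eq[OF M as(1)] .
  have "mset es = mset as" unfolding es_def by simp
  then have "(\<Prod>a\<leftarrow>es. [:- a, 1:]) = (\<Prod>a\<leftarrow>as. [:- a, 1:])"
    by (metis mset_map prod_mset_prod_list)
  with as have es: "char_poly M = (\<Prod>a\<leftarrow>es. [:- a, 1:])" by simp
  obtain T P Q where s: "schur_decomposition M es = (T, P, Q)" by (cases "schur_decomposition M es") auto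
  from schur_decomposition[OF M es s] have w: "similar_mat_wit M T P Q" "upper_triangular T" "diag_mat T = es"
    by auto
  have T: "T \<in> carrier_mat n n" using similar_mat_witD2[OF M w(1)] by auto
  have kn: "?k \<le> n" using as(2) length_filter_le by blast
  note b = similar_triangular_leading_block[OF M w(1,2) kn]
  let ?R = "mat n ?k (\<lambda>(i,j). P $$ (i,j))" and ?X = "mat ?k ?k (\<lambda>(i,j). T $$ (i,j))"
  have "diag_mat ?X = filter ?P as" unfolding b(4) w(3) es_def by simp
  then have "stable_mat ?X" using b(3) by (intro stable_mat_upper_triangular[of _ ?k]) auto
  then have "stable_frame M ?R ?X" using b M by (intro stable_frameI[OF M, of _ ?k]) auto
  moreover have "0 \<le> Re (T $$ (i,i))" if "?k \<le> i" "i < n" for i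
  proof -
    have "T $$ (i,i) = es ! i" unfolding w(3)[symmetric] diag_mat_def using T that by simp
    also have "\<dots> = filter (\<lambda>z. \<not> ?P z) as ! (i - ?k)" unfolding es_def using that by (simp add: nth_append)
    also have "\<dots> \<in> set (filter (\<lambda>z. \<not> ?P z) as)"
      using that as(2) sum_length_filter_compl[of ?P as] by (intro nth_mem) linarith
    finally show ?thesis by simp
  qed
  ultimately show thesis
    using hardy_in_leading_range[OF M w(1,2) kn] kn unfolding k[symmetric]
    by (intro that[of ?R ?X, unfolded k[symmetric]]) (auto simp: k)
qed

section \<open>The Lyapunov inequality\<close>

lemma qf_congruence:
  assumes R: "R \<in> carrier_mat n k" and B: "B \<in> carrier_mat n n" and a: "a \<in> carrier_vec k"
  shows "qf (mat_adjoint R * (B * R)) a = qf B (R *\<^sub>v a)"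
proof -
  have "mat_adjoint R * (B * R) *\<^sub>v a = mat_adjoint R *\<^sub>v (B *\<^sub>v (R *\<^sub>v a))"
    using R B assoc_mult_mat_vec[of "mat_adjoint R" k n "B * R" k a] assoc_mult_mat_vec[OF B R a] a by simp
  then have "(mat_adjoint R * (B * R) *\<^sub>v a) \<bullet>c a = (B *\<^sub>v (R *\<^sub>v a)) \<bullet>c (R *\<^sub>v a)"
    using inner_adjoint[of "mat_adjoint R" k n "B *\<^sub>v (R *\<^sub>v a)" a] R B a by simp
  then show ?thesis unfolding qf_def by simp
qed

lemma qf_mult: "A \<in> carrier_mat n n \<Longrightarrow> M \<in> carrier_mat n n \<Longrightarrow> x \<in> carrier_vec n \<Longrightarrow>
    qf (A * M) x = Re ((A *\<^sub>v (M *\<^sub>v x)) \<bullet>c x)"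
  unfolding qf_def by (simp add: assoc_mult_mat_vec[of _ n n])

lemma hermitian_inner:
  fixes A :: "complex mat"
  assumes "A \<in> carrier_mat n n" "mat_adjoint A = A" "x \<in> carrier_vec n" "y \<in> carrier_vec n"
  shows "(A *\<^sub>v x) \<bullet>c y = x \<bullet>c (A *\<^sub>v y)"
  using inner_adjoint[OF assms(1,3,4)] assms(2) by simp

text \<open>With \<open>y = M x\<close> this compares the resolvent datum \<open>s x - M x\<close>
  with the reflected vector \<open>cnj s x + M x\<close>. It stands in for integrating the
  derivative of the form of \<open>A\<close> along solutions of \<open>y' = M y\<close>, and it is
  the source of the factor 4 in the resolvent estimates.\<close>

lemma qf_reflect:
  assumes A: "A \<in> carrier_mat n n" and h: "mat_adjoint A = A"
    and x: "x \<in> carrier_vec n" and y: "y \<in> carrier_vec n"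
  shows "qf A (s \<cdot>\<^sub>v x - y) - qf A (cnj s \<cdot>\<^sub>v x + y) = - 4 * Re s * Re ((A *\<^sub>v y) \<bullet>c x)"
proof -
  have Ax: "A *\<^sub>v x \<in> carrier_vec n" and Ay: "A *\<^sub>v y \<in> carrier_vec n" using A x y by auto
  have e: "(A *\<^sub>v x) \<bullet>c y = cnj ((A *\<^sub>v y) \<bullet>c x)"
    using hermitian_inner[OF A h x y] inner_commute[OF Ay x] by simp
  have 1: "(A *\<^sub>v (s \<cdot>\<^sub>v x - y)) \<bullet>c (s \<cdot>\<^sub>v x - y) =
      s * cnj s * ((A *\<^sub>v x) \<bullet>c x) - s * ((A *\<^sub>v x) \<bullet>c y) - cnj s * ((A *\<^sub>v y) \<bullet>c x) + (A *\<^sub>v y) \<bullet>c y"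
  proof -
    have "A *\<^sub>v (s \<cdot>\<^sub>v x - y) = s \<cdot>\<^sub>v (A *\<^sub>v x) - A *\<^sub>v y"
      using A x y by (simp add: mult_minus_distrib_mat_vec[of _ n n] mult_mat_vec[of _ n n])
    then show ?thesis using x y Ax Ay by (simp add: inner_simps[of _ n] algebra_simps)
  qed
  have 2: "(A *\<^sub>v (cnj s \<cdot>\<^sub>v x + y)) \<bullet>c (cnj s \<cdot>\<^sub>v x + y) =
      s * cnj s * ((A *\<^sub>v x) \<bullet>c x) + cnj s * ((A *\<^sub>v x) \<bullet>c y) + s * ((A *\<^sub>v y) \<bullet>c x) + (A *\<^sub>v y) \<bullet>c y"
  proof -
    have "A *\<^sub>v (cnj s \<cdot>\<^sub>v x + y) = cnj s \<cdot>\<^sub>v (A *\<^sub>v x) + A *\<^sub>v y"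
      using A x y by (simp add: mult_add_distrib_mat_vec[of _ n n] mult_mat_vec[of _ n n])
    then show ?thesis using x y Ax Ay by (simp add: inner_simps[of _ n] algebra_simps)
  qed
  show ?thesis unfolding qf_def 1 2 e by (simp add: algebra_simps)
qed

lemma not_eigenvalue_solvable:
  fixes X :: "complex mat"
  assumes X: "X \<in> carrier_mat k k" and ne: "\<not> eigenvalue X s"
  shows "inj_mat (s \<cdot>\<^sub>m 1\<^sub>m k - X)"
proof (rule inj_matI)
  show "s \<cdot>\<^sub>m 1\<^sub>m k - X \<in> carrier_mat k k" using X by auto
  fix b assume b: "b \<in> carrier_vec k" and z: "(s \<cdot>\<^sub>m 1\<^sub>m k - X) *\<^sub>v b = 0\<^sub>v k"
  have e: "(s \<cdot>\<^sub>m 1\<^sub>m k - X) *\<^sub>v b = s \<cdot>\<^sub>v b - X *\<^sub>v b"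
    using X b by (subst minus_mult_distrib_mat_vec[of _ k k]) (auto intro!: eq_vecI)
  have "X *\<^sub>v b = s \<cdot>\<^sub>v b"
  proof (rule eq_vecI)
    fix i assume i: "i < dim_vec (s \<cdot>\<^sub>v b)"
    from arg_cong[OF z[unfolded e], of "\<lambda>v. v $ i"] i b X
    show "(X *\<^sub>v b) $ i = (s \<cdot>\<^sub>v b) $ i" by (simp del: index_mult_mat_vec)
  qed (use X b in auto)
  with ne X b show "b = 0\<^sub>v k" unfolding eigenvalue_def eigenvector_def by auto
qed

lemma shifted_mult_vec:
  fixes X :: "complex mat"
  assumes "X \<in> carrier_mat k k" "b \<in> carrier_vec k"
  shows "(s \<cdot>\<^sub>m 1\<^sub>m k - X) *\<^sub>v b = s \<cdot>\<^sub>v b - X *\<^sub>v b" "(s \<cdot>\<^sub>m 1\<^sub>m k + X) *\<^sub>v b = s \<cdot>\<^sub>v b + X *\<^sub>v b"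
  using assms by (subst minus_mult_distrib_mat_vec[of _ k k] add_mult_distrib_mat_vec[of _ k k]; auto intro!: eq_vecI)+

lemma smult_pow_mat:
  fixes K :: "complex mat"
  assumes K: "K \<in> carrier_mat k k"
  shows "(c \<cdot>\<^sub>m K) ^\<^sub>m m = c ^ m \<cdot>\<^sub>m (K ^\<^sub>m m)"
proof (induction m)
  case 0
  then show ?case using K by (intro eq_matI) auto
next
  case (Suc m)
  have "(c \<cdot>\<^sub>m K) ^\<^sub>m Suc m = (c ^ m \<cdot>\<^sub>m (K ^\<^sub>m m)) * (c \<cdot>\<^sub>m K)" using Suc by simp
  also have "\<dots> = c ^ m \<cdot>\<^sub>m ((K ^\<^sub>m m) * (c \<cdot>\<^sub>m K))"
    using K by (intro mult_smult_assoc_mat[of _ k k]) auto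
  also have "(K ^\<^sub>m m) * (c \<cdot>\<^sub>m K) = c \<cdot>\<^sub>m ((K ^\<^sub>m m) * K)"
    using K by (intro mult_smult_distrib[of _ k k]) auto
  finally show ?case by (intro eq_matI) auto
qed

text \<open>A scaling factor slightly above 1 keeps the spectral radius below 1. The powers of the
  scaled matrix stay bounded, so those of \<open>K\<close> decay geometrically.\<close>

lemma contraction_powers_tendsto_0:
  fixes K :: "complex mat"
  assumes K: "K \<in> carrier_mat k k" and ev: "\<And>z. eigenvalue K z \<Longrightarrow> cmod z < 1" and a: "a \<in> carrier_vec k"
  shows "(\<lambda>m. sqn (K ^\<^sub>m m *\<^sub>v a)) \<longlonglongrightarrow> 0"
\<comment> \<open>In dimension 0 the spectrum is empty, and the spectral radius is a maximum over
  the empty set.\<close>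
proof (cases "k = 0")
  case True
  then have "sqn (K ^\<^sub>m m *\<^sub>v a) = 0" for m unfolding sqn_def using K by simp
  then show ?thesis by simp
next
  case False
  then obtain z where "spectral_radius K = cmod z" "eigenvalue K z"
    using spectral_radius_mem_max(1)[OF K] unfolding spectrum_def by auto
  then have sr: "0 \<le> spectral_radius K" "spectral_radius K < 1" using ev by auto
  \<comment> \<open>For a spectral radius \<open>\<rho> < 1\<close> this gives \<open>s > 1\<close>
    and \<open>s \<rho> = 2 \<rho> / (1 + \<rho>) < 1\<close>.\<close>
  define s where "s = 2 / (1 + spectral_radius K)"
  have s: "1 < s" "s * spectral_radius K < 1" unfolding s_def using sr by (auto simp: field_simps)
  let ?K = "complex_of_real s \<cdot>\<^sub>m K"
  have K': "?K \<in> carrier_mat k k" using K by auto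
  obtain w where w: "spectral_radius ?K = cmod w" "eigenvalue ?K w"
    using spectral_radius_mem_max(1)[OF K'] False unfolding spectrum_def by auto
  then obtain v where v: "v \<in> carrier_vec k" "v \<noteq> 0\<^sub>v k" "?K *\<^sub>v v = w \<cdot>\<^sub>v v"
    unfolding eigenvalue_def eigenvector_def using K by auto
  have "K *\<^sub>v v = (w / s) \<cdot>\<^sub>v v"
  proof (rule eq_vecI)
    fix i assume i: "i < dim_vec ((w / s) \<cdot>\<^sub>v v)"
    from arg_cong[OF v(3), of "\<lambda>v. v $ i"] i v(1) K
    have "s * (K *\<^sub>v v) $ i = w * v $ i" by (auto simp: scalar_prod_def sum_distrib_left ac_simps)
    then show "(K *\<^sub>v v) $ i = ((w / s) \<cdot>\<^sub>v v) $ i" using i s by (simp add: field_simps del: index_mult_mat_vec)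
  qed (use K v in auto)
  then have "eigenvalue K (w / s)" unfolding eigenvalue_def eigenvector_def using K v by auto
  then have "cmod (w / s) \<le> spectral_radius K"
    using spectral_radius_mem_max(2)[OF K] False unfolding spectrum_def by auto
  then have "cmod w \<le> s * spectral_radius K" using s by (simp add: norm_divide field_simps)
  then have "spectral_radius ?K < 1" using w s by simp
  then obtain c where c: "\<And>m. norm_bound (?K ^\<^sub>m m) c"
    using spectral_radius_jnf_norm_bound_less_1_upper_triangular[OF K'] by blast
  have b: "sqn (K ^\<^sub>m m *\<^sub>v a) \<le> k * (k * c)\<^sup>2 * sqn a * ((1 / s)\<^sup>2) ^ m" for m
  proof -
    have "sqn (?K ^\<^sub>m m *\<^sub>v a) = (s ^ m)\<^sup>2 * sqn (K ^\<^sub>m m *\<^sub>v a)"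
    proof -
      have "?K ^\<^sub>m m *\<^sub>v a = complex_of_real s ^ m \<cdot>\<^sub>v (K ^\<^sub>m m *\<^sub>v a)"
        unfolding smult_pow_mat[OF K] using K a by (intro eq_vecI) auto
      then show ?thesis using s by (simp add: sqn_smult norm_power)
    qed
    moreover have "sqn (?K ^\<^sub>m m *\<^sub>v a) \<le> k * (k * c)\<^sup>2 * sqn a"
      using norm_bound_sqn_mult_vec[OF _ c a] K' by auto
    ultimately have "(s ^ m)\<^sup>2 * sqn (K ^\<^sub>m m *\<^sub>v a) \<le> k * (k * c)\<^sup>2 * sqn a" by simp
    then have "sqn (K ^\<^sub>m m *\<^sub>v a) \<le> k * (k * c)\<^sup>2 * sqn a / (s ^ m)\<^sup>2"
      using s by (simp add: pos_le_divide_eq mult.commute)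
    then show ?thesis by (simp add: power_divide power_mult[symmetric] mult.commute)
  qed
  have "(\<lambda>m. k * (k * c)\<^sup>2 * sqn a * ((1 / s)\<^sup>2) ^ m) \<longlonglongrightarrow> k * (k * c)\<^sup>2 * sqn a * 0"
  proof (intro tendsto_mult tendsto_const LIMSEQ_power_zero)
    have "\<bar>1 / s\<bar> < 1" using s by simp
    then have "(1 / s)\<^sup>2 < 1" by (subst abs_square_less_1)
    then show "norm ((1 / s)\<^sup>2) < 1" by simp
  qed
  then have u: "(\<lambda>m. k * (k * c)\<^sup>2 * sqn a * ((1 / s)\<^sup>2) ^ m) \<longlonglongrightarrow> 0" by simp
  show ?thesis
    by (rule tendsto_sandwich[OF _ _ tendsto_const u]) (use b in auto)
qed

text \<open>The Cayley transform \<open>K = (1 + X) (1 - X)\<^sup>-\<^sup>1\<close> turns the Lyapunov inequality into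
  \<open>K\<^sup>* H K < H\<close>, and \<open>K\<^sup>m \<rightarrow> 0\<close> for stable \<open>X\<close>.\<close>

lemma lyapunov_positive:
  fixes H X :: "complex mat"
  assumes H: "H \<in> carrier_mat k k" and h: "mat_adjoint H = H" and X: "X \<in> carrier_mat k k" and st: "stable_mat X"
    and neg: "\<And>x. x \<in> carrier_vec k \<Longrightarrow> x \<noteq> 0\<^sub>v k \<Longrightarrow> qf (H * X) x < 0"
    and a: "a \<in> carrier_vec k" "a \<noteq> 0\<^sub>v k"
  shows "0 < qf H a"
proof -
  let ?D = "1 \<cdot>\<^sub>m 1\<^sub>m k - X" and ?N = "1 \<cdot>\<^sub>m 1\<^sub>m k + X"
  have D: "?D \<in> carrier_mat k k" and N: "?N \<in> carrier_mat k k" using X by auto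
  have "\<not> eigenvalue X 1" using stable_matD[OF st] by force
  from inj_mat_obtain_inverse[OF D not_eigenvalue_solvable[OF X this]] obtain D'
    where D': "D' \<in> carrier_mat k k" "?D * D' = 1\<^sub>m k" "D' * ?D = 1\<^sub>m k" by blast
  define K where "K = ?N * D'"
  have K: "K \<in> carrier_mat k k" unfolding K_def using N D' by auto
  have dec: "\<exists>b \<in> carrier_vec k. b = D' *\<^sub>v x \<and> x = 1 \<cdot>\<^sub>v b - X *\<^sub>v b \<and> K *\<^sub>v x = 1 \<cdot>\<^sub>v b + X *\<^sub>v b"
    if x: "x \<in> carrier_vec k" for x
  proof (intro bexI[of _ "D' *\<^sub>v x"] conjI refl)
    show b: "D' *\<^sub>v x \<in> carrier_vec k" using D' x by auto
    have "x = ?D * D' *\<^sub>v x" unfolding D'(2) using x by simp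
    also have "\<dots> = ?D *\<^sub>v (D' *\<^sub>v x)" by (rule assoc_mult_mat_vec[OF D D'(1) x])
    finally show "x = 1 \<cdot>\<^sub>v (D' *\<^sub>v x) - X *\<^sub>v (D' *\<^sub>v x)" unfolding shifted_mult_vec[OF X b] .
    have "K *\<^sub>v x = ?N *\<^sub>v (D' *\<^sub>v x)" unfolding K_def using N D' x by (simp add: assoc_mult_mat_vec[of _ k k])
    then show "K *\<^sub>v x = 1 \<cdot>\<^sub>v (D' *\<^sub>v x) + X *\<^sub>v (D' *\<^sub>v x)" unfolding shifted_mult_vec[OF X b] .
  qed
  have step: "qf H (K *\<^sub>v x) \<le> qf H x \<and> (x \<noteq> 0\<^sub>v k \<longrightarrow> qf H (K *\<^sub>v x) < qf H x)" if x: "x \<in> carrier_vec k" for x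
  proof -
    from dec[OF x] obtain b where b: "b \<in> carrier_vec k" "x = 1 \<cdot>\<^sub>v b - X *\<^sub>v b" "K *\<^sub>v x = 1 \<cdot>\<^sub>v b + X *\<^sub>v b" by blast
    have Xb: "X *\<^sub>v b \<in> carrier_vec k" using X b by auto
    \<comment> \<open>The vectors \<open>x = b - X b\<close> and \<open>K x = b + X b\<close> are
      exactly the pair that \<open>qf_reflect\<close> compares at \<open>s = 1\<close>.\<close>
    have e: "qf H x - qf H (K *\<^sub>v x) = - 4 * qf (H * X) b"
      using qf_reflect[OF H h b(1) Xb, of 1] unfolding b(2)[symmetric] qf_mult[OF H X b(1)]
      using b(3) by simp
    show ?thesis
    proof (cases "b = 0\<^sub>v k")
      case True
      then have "x = 0\<^sub>v k" "K *\<^sub>v x = 0\<^sub>v k" using b X by auto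
      then show ?thesis by simp
    next
      case False
      from neg[OF b(1) this] e show ?thesis by simp
    qed
  qed
  have ev: "cmod z < 1" if "eigenvalue K z" for z
  proof -
    from that obtain x where x: "x \<in> carrier_vec k" "x \<noteq> 0\<^sub>v k" "K *\<^sub>v x = z \<cdot>\<^sub>v x"
      unfolding eigenvalue_def eigenvector_def using K by auto
    from dec[OF x(1)] obtain b where b: "b \<in> carrier_vec k" "x = 1 \<cdot>\<^sub>v b - X *\<^sub>v b" "K *\<^sub>v x = 1 \<cdot>\<^sub>v b + X *\<^sub>v b" by blast
    have b0: "b \<noteq> 0\<^sub>v k" using x(2) b X by auto
    have i: "(1 + z) * (X *\<^sub>v b) $ i = (z - 1) * b $ i" if "i < k" for i
    proof -
      have "(1 \<cdot>\<^sub>v b + X *\<^sub>v b) $ i = (z \<cdot>\<^sub>v (1 \<cdot>\<^sub>v b - X *\<^sub>v b)) $ i"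
        using x(3) b(2,3) by metis
      then show ?thesis using that b X by (simp add: algebra_simps del: index_mult_mat_vec)
    qed
    have z1: "1 + z \<noteq> 0"
    proof
      assume z: "1 + z = 0"
      then have "z - 1 = - 2" by (simp add: add_eq_0_iff)
      with i z have "b $ i = 0" if "i < k" for i using that by fastforce
      with b0 b show False by (auto simp: vec_eq_iff)
    qed
    have "X *\<^sub>v b = ((z - 1) / (1 + z)) \<cdot>\<^sub>v b"
      using i z1 b X by (intro eq_vecI) (auto simp: field_simps simp del: index_mult_mat_vec)
    then have "eigenvalue X ((z - 1) / (1 + z))"
      unfolding eigenvalue_def eigenvector_def using b b0 X by auto
    \<comment> \<open>The quotient is the eigenvalue of \<open>X\<close> that the Cayley transform
      sends to \<open>z\<close>; its real part has the sign of \<open>|z|^2 - 1\<close>.\<close>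
    from stable_matD[OF st this] have "Re ((z - 1) / (1 + z)) < 0" .
    then have "Re ((z - 1) * cnj (1 + z)) < 0"
      by (metis Re_complex_div_lt_0)
    then have "(cmod z)\<^sup>2 < 1" unfolding cmod_power2 unfolding power2_eq_square by (simp add: algebra_simps)
    then show ?thesis using abs_square_less_1[of "cmod z"] by simp
  qed
  have mono: "qf H (K ^\<^sub>m m *\<^sub>v x) \<le> qf H x" if "x \<in> carrier_vec k" for x m
    using that
  proof (induction m arbitrary: x)
    case 0
    then show ?case using K by simp
  next
    case (Suc m)
    have "K ^\<^sub>m Suc m *\<^sub>v x = K ^\<^sub>m m *\<^sub>v (K *\<^sub>v x)" using K Suc.prems by (simp add: assoc_mult_mat_vec[of _ k k])
    then show ?case using Suc.IH[of "K *\<^sub>v x"] step[OF Suc.prems] K Suc.prems by fastforce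
  qed
  obtain C where C: "C > 0" "\<And>x. x \<in> carrier_vec k \<Longrightarrow> \<bar>qf H x\<bar> \<le> C * sqn x" using qf_bounded[OF H] by blast
  have Ka: "K *\<^sub>v a \<in> carrier_vec k" using K a by auto
  \<comment> \<open>The limit of the powers yields only nonnegativity. It is taken from
    \<open>K a\<close> on, so that the first step from \<open>a\<close> to \<open>K a\<close>
    supplies the strict inequality.\<close>
  have "0 \<le> qf H (K *\<^sub>v a)"
  proof (rule LIMSEQ_le)
    have "(\<lambda>m. - (C * sqn (K ^\<^sub>m m *\<^sub>v (K *\<^sub>v a)))) \<longlonglongrightarrow> - (C * 0)"
      by (intro tendsto_intros contraction_powers_tendsto_0[OF K ev Ka])
    then show "(\<lambda>m. - (C * sqn (K ^\<^sub>m m *\<^sub>v (K *\<^sub>v a)))) \<longlonglongrightarrow> 0" by simp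
    show "(\<lambda>m. qf H (K *\<^sub>v a)) \<longlonglongrightarrow> qf H (K *\<^sub>v a)" by simp
    have "- (C * sqn (K ^\<^sub>m m *\<^sub>v (K *\<^sub>v a))) \<le> qf H (K *\<^sub>v a)" for m
    proof -
      have "K ^\<^sub>m m *\<^sub>v (K *\<^sub>v a) \<in> carrier_vec k"
        by (rule mult_mat_vec_carrier[OF pow_carrier_mat[OF K] Ka])
      from C(2)[OF this] mono[OF Ka, of m] show ?thesis by linarith
    qed
    then show "\<exists>N. \<forall>m\<ge>N. - (C * sqn (K ^\<^sub>m m *\<^sub>v (K *\<^sub>v a))) \<le> qf H (K *\<^sub>v a)" by blast
  qed
  with step[OF a(1)] a(2) show ?thesis by linarith
qed

text \<open>Compress the form of \<open>A\<close> to the frame: the product of the compression with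
  \<open>X\<close> is the compression of \<open>A M\<close>, so the Lyapunov inequality holds for
  the stable matrix \<open>X\<close>.\<close>

lemma stable_frame_positive:
  assumes A: "A \<in> carrier_mat n n" and h: "mat_adjoint A = A" and M: "M \<in> carrier_mat n n"
    and neg: "\<And>x. x \<in> carrier_vec n \<Longrightarrow> x \<noteq> 0\<^sub>v n \<Longrightarrow> qf (A * M) x < 0"
    and R: "R \<in> carrier_mat n k" and f: "stable_frame M R X"
    and a: "a \<in> carrier_vec k" "a \<noteq> 0\<^sub>v k"
  shows "0 < qf A (R *\<^sub>v a)"
proof -
  note d = stable_frameD[OF f M R]
  let ?H = "mat_adjoint R * (A * R)"
  have H: "?H \<in> carrier_mat k k" using R A by auto
  have "mat_adjoint ?H = mat_adjoint (A * R) * R"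
    using mat_adjoint_mult[of "mat_adjoint R" k n "A * R" k] R A by simp
  also have "mat_adjoint (A * R) = mat_adjoint R * A" using mat_adjoint_mult[OF A R] h by simp
  also have "mat_adjoint R * A * R = ?H" using R A by (intro assoc_mult_mat) auto
  finally have hH: "mat_adjoint ?H = ?H" .
  have HX: "?H * X = mat_adjoint R * (A * M * R)"
  proof -
    have "?H * X = mat_adjoint R * (A * R * X)" using R A d(1) by (intro assoc_mult_mat) auto
    also have "A * R * X = A * (R * X)" using R A d(1) by (intro assoc_mult_mat) auto
    also have "\<dots> = A * M * R" unfolding d(3)[symmetric] using A M R by (intro assoc_mult_mat[symmetric]) auto
    finally show ?thesis .
  qed
  have "0 < qf ?H a"
  proof (rule lyapunov_positive[OF H hH d(1,2) _ a])
    fix x :: "complex vec" assume x: "x \<in> carrier_vec k" "x \<noteq> 0\<^sub>v k"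
    have "R *\<^sub>v x \<noteq> 0\<^sub>v n" using inj_matD[OF d(4) R x(1)] x(2) by blast
    then have "qf (A * M) (R *\<^sub>v x) < 0" using R x by (intro neg) auto
    then show "qf (?H * X) x < 0" unfolding HX using qf_congruence[OF R _ x(1), of "A * M"] A M by simp
  qed
  then show ?thesis using qf_congruence[OF R A a(1)] by simp
qed

lemma stable_frame_resolvent:
  assumes A: "A \<in> carrier_mat n n" and h: "mat_adjoint A = A" and M: "M \<in> carrier_mat n n"
    and neg: "\<And>x. x \<in> carrier_vec n \<Longrightarrow> x \<noteq> 0\<^sub>v n \<Longrightarrow> qf (A * M) x < 0"
    and R: "R \<in> carrier_mat n k" and f: "stable_frame M R X"
    and a: "a \<in> carrier_vec k" and s: "0 < Re s"
  obtains U where "U \<in> carrier_vec n" "s \<cdot>\<^sub>v U - M *\<^sub>v U = R *\<^sub>v a"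
    "- 4 * Re s * qf (A * M) U \<le> qf A (R *\<^sub>v a)"
proof -
  note d = stable_frameD[OF f M R]
  have "\<not> eigenvalue X s" using stable_matD[OF d(2)] s by force
  then have "inj_mat (s \<cdot>\<^sub>m 1\<^sub>m k - X)" by (rule not_eigenvalue_solvable[OF d(1)])
  moreover have D: "s \<cdot>\<^sub>m 1\<^sub>m k - X \<in> carrier_mat k k" using d(1) by auto
  ultimately obtain L where L: "L \<in> carrier_mat k k" "(s \<cdot>\<^sub>m 1\<^sub>m k - X) * L = 1\<^sub>m k"
    using inj_mat_obtain_inverse by blast
  let ?b = "L *\<^sub>v a"
  have b: "?b \<in> carrier_vec k" using L a by auto
  have "a = (s \<cdot>\<^sub>m 1\<^sub>m k - X) * L *\<^sub>v a" unfolding L(2) using a by simp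
  also have "\<dots> = (s \<cdot>\<^sub>m 1\<^sub>m k - X) *\<^sub>v ?b" by (rule assoc_mult_mat_vec[OF D L(1) a])
  finally have ab: "a = s \<cdot>\<^sub>v ?b - X *\<^sub>v ?b" unfolding shifted_mult_vec[OF d(1) b] .
  let ?U = "R *\<^sub>v ?b"
  have U: "?U \<in> carrier_vec n" using R b by auto
  have MU: "M *\<^sub>v ?U = R *\<^sub>v (X *\<^sub>v ?b)"
    using d M R b by (metis assoc_mult_mat_vec)
  have Xb: "X *\<^sub>v ?b \<in> carrier_vec k" using d(1) b by auto
  have 1: "s \<cdot>\<^sub>v ?U - M *\<^sub>v ?U = R *\<^sub>v a"
  proof -
    have "R *\<^sub>v a = R *\<^sub>v (s \<cdot>\<^sub>v ?b - X *\<^sub>v ?b)" using ab by simp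
    also have "\<dots> = s \<cdot>\<^sub>v ?U - M *\<^sub>v ?U"
      unfolding MU using R b Xb mult_mat_vec[OF R b] by (subst mult_minus_distrib_mat_vec[OF R]) auto
    finally show ?thesis by simp
  qed
  have "cnj s \<cdot>\<^sub>v ?U + M *\<^sub>v ?U = R *\<^sub>v (cnj s \<cdot>\<^sub>v ?b + X *\<^sub>v ?b)"
    unfolding MU using R b Xb mult_mat_vec[OF R b] by (subst mult_add_distrib_mat_vec[OF R]) auto
  moreover have "0 \<le> qf A (R *\<^sub>v c)" if c: "c \<in> carrier_vec k" for c
  proof (cases "c = 0\<^sub>v k")
    case True
    then have "R *\<^sub>v c = 0\<^sub>v n" using R by auto
    then show ?thesis unfolding qf_def using A by simp
  next
    case False
    from stable_frame_positive[OF A h M neg R f c False] show ?thesis by simp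
  qed
  ultimately have 2: "0 \<le> qf A (cnj s \<cdot>\<^sub>v ?U + M *\<^sub>v ?U)" using b Xb by simp
  have MU': "M *\<^sub>v ?U \<in> carrier_vec n" using M U by auto
  have "- 4 * Re s * qf (A * M) ?U \<le> qf A (R *\<^sub>v a)"
    using qf_reflect[OF A h U MU', of s] 2 unfolding 1 qf_mult[OF A M U] by simp
  with U 1 that show thesis by blast
qed

text \<open>Coercivity turns the energy estimate for the resolvent into a bound on its norm. This is
  the converse of the inclusion in \<open>stable_frame_exists\<close>: stable vectors are recognized
  by \<open>hardy\<close>.\<close>

lemma stable_frame_hardy:
  assumes A: "A \<in> carrier_mat n n" and h: "mat_adjoint A = A" and M: "M \<in> carrier_mat n n"
    and c: "0 < c" and neg: "\<And>x. x \<in> carrier_vec n \<Longrightarrow> qf (A * M) x \<le> - c * sqn x"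
    and R: "R \<in> carrier_mat n k" and f: "stable_frame M R X" and a: "a \<in> carrier_vec k"
  shows "hardy M (R *\<^sub>v a)"
  unfolding hardy_def
proof (intro exI[of _ "qf A (R *\<^sub>v a) / (4 * c)"] allI impI)
  fix s :: complex assume s: "0 < Re s"
  have neg': "qf (A * M) x < 0" if "x \<in> carrier_vec n" "x \<noteq> 0\<^sub>v n" for x
    using neg[OF that(1)] mult_pos_pos[OF c sqn_pos[OF that]] by simp
  from stable_frame_resolvent[OF A h M neg' R f a s] obtain U
    where U: "U \<in> carrier_vec n" "s \<cdot>\<^sub>v U - M *\<^sub>v U = R *\<^sub>v a" "- 4 * Re s * qf (A * M) U \<le> qf A (R *\<^sub>v a)" .
  have "4 * Re s * (c * sqn U) \<le> 4 * Re s * (- qf (A * M) U)"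
    using neg[OF U(1)] s by (intro mult_left_mono) auto
  also have "\<dots> \<le> qf A (R *\<^sub>v a)" using U(3) by simp
  also have "4 * Re s * (c * sqn U) = sqn U * (4 * c * Re s)" by simp
  finally have "sqn U * (4 * c * Re s) \<le> qf A (R *\<^sub>v a)" .
  moreover have "0 < 4 * c * Re s" using c s by simp
  ultimately have "sqn U \<le> qf A (R *\<^sub>v a) / (4 * c) / Re s"
    unfolding divide_divide_eq_left by (subst pos_le_divide_eq)
  with U M show "\<exists>y\<in>carrier_vec (dim_row M). s \<cdot>\<^sub>v y - M *\<^sub>v y = R *\<^sub>v a \<and> sqn y \<le> qf A (R *\<^sub>v a) / (4 * c) / Re s"
    by auto
qed

section \<open>Inertia\<close>

lemma eigenvalue_in_set:
  fixes A :: "'a :: field mat"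
  assumes "A \<in> carrier_mat n n" "char_poly A = (\<Prod>a\<leftarrow>as. [:- a, 1:])"
  shows "eigenvalue A z \<longleftrightarrow> z \<in> set as"
  using spectrum_eq_set[OF assms] unfolding spectrum_def by auto

lemma num_stable_eigenvalues_uminus:
  assumes A: "A \<in> carrier_mat n n" and ev: "\<And>z. eigenvalue A z \<Longrightarrow> Re z \<noteq> 0"
  shows "num_stable_eigenvalues A + num_stable_eigenvalues (- A) = n"
proof -
  obtain as where as: "char_poly A = (\<Prod>a\<leftarrow>as. [:- a, 1:])" "length as = n"
    using char_poly_factorized[OF A] by auto
  have "num_stable_eigenvalues (- A) = length (filter (\<lambda>z. Re z < 0) (map uminus as))"
    using A by (intro num_stable_eigenvalues_eq[OF _ char_poly_uminus[OF A as(1)]]) auto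
  also have "\<dots> = length (filter (\<lambda>z. \<not> Re z < 0) as)"
    using ev eigenvalue_in_set[OF A as(1)]
    by (auto simp: filter_map o_def intro!: arg_cong[of _ _ length] filter_cong) (metis linorder_cases)
  finally show ?thesis
    using num_stable_eigenvalues_eq[OF A as(1)] as(2) sum_length_filter_compl[of "\<lambda>z. Re z < 0" as] by simp
qed

lemma qf_smult: "A \<in> carrier_mat n n \<Longrightarrow> x \<in> carrier_vec n \<Longrightarrow> qf A (c \<cdot>\<^sub>v x) = (cmod c)\<^sup>2 * qf A x"
proof -
  assume A: "A \<in> carrier_mat n n" and x: "x \<in> carrier_vec n"
  have "(A *\<^sub>v (c \<cdot>\<^sub>v x)) \<bullet>c (c \<cdot>\<^sub>v x) = c * (cnj c * ((A *\<^sub>v x) \<bullet>c x))"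
    using mult_mat_vec[OF A x, of c] A x by (simp add: inner_simps[of _ n])
  also have "\<dots> = complex_of_real ((cmod c)\<^sup>2) * ((A *\<^sub>v x) \<bullet>c x)"
    by (metis complex_norm_square mult.assoc)
  finally show ?thesis unfolding qf_def by simp
qed

lemma qf_uminus: "A \<in> carrier_mat n n \<Longrightarrow> x \<in> carrier_vec n \<Longrightarrow> qf (- A) x = - qf A x"
proof -
  assume A: "A \<in> carrier_mat n n" and x: "x \<in> carrier_vec n"
  have "- A *\<^sub>v x = (- 1) \<cdot>\<^sub>v (A *\<^sub>v x)" using A x by (intro eq_vecI) auto
  then show ?thesis unfolding qf_def using A x by (simp add: inner_smult_left[of _ n])
qed

lemma qf_uminus_square:
  assumes A: "A \<in> carrier_mat n n" and h: "mat_adjoint A = A" and i: "inj_mat A"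
    and x: "x \<in> carrier_vec n" "x \<noteq> 0\<^sub>v n"
  shows "qf ((- A) * A) x < 0"
proof -
  have mA: "- A \<in> carrier_mat n n" using A by auto
  have Ax: "A *\<^sub>v x \<in> carrier_vec n" using A x by auto
  have "A *\<^sub>v x \<noteq> 0\<^sub>v n" using inj_matD[OF i A x(1)] x(2) by blast
  then have p: "0 < sqn (A *\<^sub>v x)" using Ax by (intro sqn_pos)
  have "- A *\<^sub>v (A *\<^sub>v x) = (- 1) \<cdot>\<^sub>v (A *\<^sub>v (A *\<^sub>v x))" using A Ax by (intro eq_vecI) auto
  then have "(- A *\<^sub>v (A *\<^sub>v x)) \<bullet>c x = - ((A *\<^sub>v (A *\<^sub>v x)) \<bullet>c x)"
    using A Ax x by (simp add: inner_smult_left[of _ n])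
  also have "(A *\<^sub>v (A *\<^sub>v x)) \<bullet>c x = complex_of_real (sqn (A *\<^sub>v x))"
    using hermitian_inner[OF A h Ax x(1)] inner_self by simp
  finally show ?thesis using p unfolding qf_mult[OF mA A x(1)] by simp
qed

text \<open>On the stable subspace of \<open>A\<close> the form of \<open>A\<close> is negative, by
  \<open>stable_frame_positive\<close> for the pair \<open>- A\<close>, \<open>A\<close>; hence it
  meets the range of \<open>E\<close> only in 0. Nonnegativity on \<open>E\<close> suffices, which
  matters because the \<open>p0\<close> directions used later are null for the form.\<close>

lemma psd_dim_bound:
  assumes A: "A \<in> carrier_mat n n" and h: "mat_adjoint A = A" and i: "inj_mat A"
    and E: "E \<in> carrier_mat n k" and iE: "inj_mat E"
    and pos: "\<And>a. a \<in> carrier_vec k \<Longrightarrow> 0 \<le> qf A (E *\<^sub>v a)"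
  shows "k + num_stable_eigenvalues A \<le> n"
proof -
  let ?l = "num_stable_eigenvalues A"
  obtain N Y where N: "N \<in> carrier_mat n ?l" "stable_frame A N Y"
    using stable_frame_exists[OF A] by blast
  have mA: "- A \<in> carrier_mat n n" using A by auto
  have hA: "mat_adjoint (- A) = - A" unfolding mat_adjoint_uminus h ..
  have neg: "qf ((- A) * A) x < 0" if "x \<in> carrier_vec n" "x \<noteq> 0\<^sub>v n" for x
    using qf_uminus_square[OF A h i that] .
  have qN: "qf A (N *\<^sub>v b) < 0" if b: "b \<in> carrier_vec ?l" "b \<noteq> 0\<^sub>v ?l" for b
    using stable_frame_positive[OF mA hA A neg N b] qf_uminus[OF A, of "N *\<^sub>v b"] N(1) b by simp
  have "inj_mat (append_cols E N)"
  proof (rule inj_matI[OF append_cols_carrier[OF E N(1)]])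
    fix c assume c: "c \<in> carrier_vec (k + ?l)" and z: "append_cols E N *\<^sub>v c = 0\<^sub>v n"
    define a b where "a = vec_first c k" and "b = vec_last c ?l"
    have ab: "a \<in> carrier_vec k" "b \<in> carrier_vec ?l" "c = a @\<^sub>v b"
      unfolding a_def b_def using c by auto
    have z': "E *\<^sub>v a + N *\<^sub>v b = 0\<^sub>v n"
      using z unfolding ab(3) append_cols_mult_vec[OF E N(1) ab(1,2)] .
    have "E *\<^sub>v a = (- 1) \<cdot>\<^sub>v (N *\<^sub>v b)"
    proof (rule eq_vecI)
      fix i assume "i < dim_vec ((- 1) \<cdot>\<^sub>v (N *\<^sub>v b))"
      then have i: "i < n" using N by auto
      from arg_cong[OF z', of "\<lambda>v. v $ i"] i E N(1)
      have "(E *\<^sub>v a) $ i + (N *\<^sub>v b) $ i = 0" by (simp del: index_mult_mat_vec)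
      then show "(E *\<^sub>v a) $ i = ((- 1) \<cdot>\<^sub>v (N *\<^sub>v b)) $ i"
        using i N(1) by (simp add: add_eq_0_iff2 del: index_mult_mat_vec)
    qed (use E N in auto)
    then have "qf A (E *\<^sub>v a) = qf A (N *\<^sub>v b)" using qf_smult[OF A, of "N *\<^sub>v b" "- 1"] N(1) ab by simp
    with pos[OF ab(1)] qN[OF ab(2)] have b0: "b = 0\<^sub>v ?l" by force
    then have "N *\<^sub>v b = 0\<^sub>v n" using N by auto
    then have "E *\<^sub>v a = 0\<^sub>v n" using z' E ab by auto
    from inj_matD[OF iE E ab(1) this] b0 show "c = 0\<^sub>v (k + ?l)" unfolding ab(3) by auto
  qed
  from inj_mat_le[OF append_cols_carrier[OF E N(1)] this] show ?thesis .
qed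

lemma lyapunov_inj:
  assumes A: "A \<in> carrier_mat n n" and h: "mat_adjoint A = A" and M: "M \<in> carrier_mat n n"
    and neg: "\<And>x. x \<in> carrier_vec n \<Longrightarrow> x \<noteq> 0\<^sub>v n \<Longrightarrow> qf (A * M) x < 0"
  shows "inj_mat A"
proof (rule inj_matI[OF A])
  fix x assume x: "x \<in> carrier_vec n" and z: "A *\<^sub>v x = 0\<^sub>v n"
  have Mx: "M *\<^sub>v x \<in> carrier_vec n" using M x by auto
  have "qf (A * M) x = 0" unfolding qf_mult[OF A M x] hermitian_inner[OF A h Mx x] z using Mx by simp
  with neg[OF x] show "x = 0\<^sub>v n" by force
qed

text \<open>On an eigenvector the form of \<open>A M\<close> is the real part of the eigenvalue
  times a real number, so an imaginary eigenvalue would make it vanish.\<close>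

lemma lyapunov_eigenvalue:
  assumes A: "A \<in> carrier_mat n n" and h: "mat_adjoint A = A" and M: "M \<in> carrier_mat n n"
    and neg: "\<And>x. x \<in> carrier_vec n \<Longrightarrow> x \<noteq> 0\<^sub>v n \<Longrightarrow> qf (A * M) x < 0"
    and ev: "eigenvalue M z"
  shows "Re z \<noteq> 0"
proof
  assume z: "Re z = 0"
  from ev obtain x where x: "x \<in> carrier_vec n" "x \<noteq> 0\<^sub>v n" "M *\<^sub>v x = z \<cdot>\<^sub>v x"
    unfolding eigenvalue_def eigenvector_def using M by auto
  have Ax: "A *\<^sub>v x \<in> carrier_vec n" using A x by auto
  have "(A *\<^sub>v x) \<bullet>c x = cnj ((A *\<^sub>v x) \<bullet>c x)"
    using hermitian_inner[OF A h x(1,1)] inner_commute[OF Ax x(1)] by simp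
  then have "Im ((A *\<^sub>v x) \<bullet>c x) = 0" by (metis Reals_cnj_iff complex_is_Real_iff)
  then have "qf (A * M) x = 0" unfolding qf_mult[OF A M x(1)] x(3) mult_mat_vec[OF A x(1)]
    using Ax x(1) z by (simp add: inner_smult_left[of _ n])
  with neg[OF x(1,2)] show False by simp
qed

text \<open>The bound of \<open>psd_dim_bound\<close> for \<open>A\<close>, \<open>M\<close> and for
  \<open>- A\<close>, \<open>- M\<close> gives two inequalities with right side \<open>n\<close>
  whose left sides add up to \<open>2 n\<close>; both are therefore equalities.\<close>

lemma lyapunov_inertia:
  assumes A: "A \<in> carrier_mat n n" and h: "mat_adjoint A = A" and M: "M \<in> carrier_mat n n"
    and neg: "\<And>x. x \<in> carrier_vec n \<Longrightarrow> x \<noteq> 0\<^sub>v n \<Longrightarrow> qf (A * M) x < 0"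
  shows "num_stable_eigenvalues M = num_stable_eigenvalues (- A)"
proof -
  have le: "num_stable_eigenvalues M + num_stable_eigenvalues A \<le> n"
    if A: "A \<in> carrier_mat n n" and h: "mat_adjoint A = A" and M: "M \<in> carrier_mat n n"
    and neg: "\<And>x. x \<in> carrier_vec n \<Longrightarrow> x \<noteq> 0\<^sub>v n \<Longrightarrow> qf (A * M) x < 0" for A M
  proof -
    obtain R X where R: "R \<in> carrier_mat n (num_stable_eigenvalues M)" "stable_frame M R X"
      using stable_frame_exists[OF M] by blast
    show ?thesis
    proof (rule psd_dim_bound[OF A h lyapunov_inj[OF A h M neg] R(1)])
      show "inj_mat R" using stable_frameD(4)[OF R(2) M R(1)] .
      fix a :: "complex vec" assume a: "a \<in> carrier_vec (num_stable_eigenvalues M)"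
      show "0 \<le> qf A (R *\<^sub>v a)"
      proof (cases "a = 0\<^sub>v (num_stable_eigenvalues M)")
        case True
        then have "R *\<^sub>v a = 0\<^sub>v n" using R by auto
        then show ?thesis unfolding qf_def using A by simp
      next
        case False
        from stable_frame_positive[OF A h M neg R a False] show ?thesis by simp
      qed
    qed
  qed
  have mA: "- A \<in> carrier_mat n n" and mM: "- M \<in> carrier_mat n n" using A M by auto
  have hA: "mat_adjoint (- A) = - A" unfolding mat_adjoint_uminus h ..
  have "(- A) * (- M) = A * M" using A M by (simp add: uminus_mult_left_mat uminus_mult_right_mat)
  then have le2: "num_stable_eigenvalues (- M) + num_stable_eigenvalues (- A) \<le> n"
    using le[OF mA hA mM] neg by simp
  have i: "inj_mat A" by (rule lyapunov_inj[OF A h M neg])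
  have "qf ((- A) * A) x < 0" if "x \<in> carrier_vec n" "x \<noteq> 0\<^sub>v n" for x
    using qf_uminus_square[OF A h i that] .
  then have "num_stable_eigenvalues A + num_stable_eigenvalues (- A) = n"
    using num_stable_eigenvalues_uminus[OF A] lyapunov_eigenvalue[OF mA hA A] by blast
  moreover have "num_stable_eigenvalues M + num_stable_eigenvalues (- M) = n"
    using num_stable_eigenvalues_uminus[OF M] lyapunov_eigenvalue[OF A h M neg] by blast
  ultimately show ?thesis using le[OF A h M neg] le2 by linarith
qed

section \<open>Real matrices with real spectrum\<close>

lemma hermitian_eigenvalue_real:
  assumes A: "A \<in> carrier_mat n n" and h: "mat_adjoint A = A" and ev: "eigenvalue A z"
  shows "Im z = 0"
proof -
  from ev obtain x where x: "x \<in> carrier_vec n" "x \<noteq> 0\<^sub>v n" "A *\<^sub>v x = z \<cdot>\<^sub>v x"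
    unfolding eigenvalue_def eigenvector_def using A by auto
  have "z * complex_of_real (sqn x) = cnj z * complex_of_real (sqn x)"
    using hermitian_inner[OF A h x(1,1)] unfolding x(3)
    using x(1) by (simp add: inner_smult_left[of _ n] inner_smult_right[of _ n] inner_self)
  moreover have "sqn x \<noteq> 0" using sqn_pos[OF x(1,2)] by simp
  ultimately have "z = cnj z" by simp
  then show ?thesis by (metis Reals_cnj_iff complex_is_Real_iff)
qed

lemma map_poly_of_real_prod_linear:
  "map_poly complex_of_real (\<Prod>a\<leftarrow>as. [:- a, 1:]) = (\<Prod>a\<leftarrow>map complex_of_real as. [:- a, 1:])"
proof -
  interpret map_poly_comm_ring_hom "of_real :: real \<Rightarrow> complex" ..
  show ?thesis by (induction as) (simp_all add: hom_distribs)
qed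

lemma char_poly_cmat:
  assumes A: "A \<in> carrier_mat n n" and c: "char_poly A = (\<Prod>a\<leftarrow>as. [:- a, 1:])"
  shows "char_poly (cmat A) = (\<Prod>a\<leftarrow>map complex_of_real as. [:- a, 1:])"
  using of_real_hom.char_poly_hom[OF A, where ?'a = complex] unfolding c map_poly_of_real_prod_linear .

lemma char_poly_real_factorized:
  fixes A :: "real mat"
  assumes A: "A \<in> carrier_mat n n" and ev: "\<And>z. eigenvalue (cmat A) z \<Longrightarrow> Im z = 0"
  obtains as where "char_poly A = (\<Prod>a\<leftarrow>as. [:- a, 1:])" "length as = n"
proof -
  have cA: "cmat A \<in> carrier_mat n n" using A by auto
  obtain zs where zs: "char_poly (cmat A) = (\<Prod>a\<leftarrow>zs. [:- a, 1:])" "length zs = n"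
    using char_poly_factorized[OF cA] by auto
  define as where "as = map Re zs"
  have "zs = map complex_of_real as"
    unfolding as_def using ev eigenvalue_in_set[OF cA zs(1)]
    by (auto simp: o_def complex_eq_iff intro!: map_idI[symmetric])
  then have "map_poly complex_of_real (char_poly A) = map_poly complex_of_real (\<Prod>a\<leftarrow>as. [:- a, 1:])"
    unfolding map_poly_of_real_prod_linear using zs(1) of_real_hom.char_poly_hom[OF A, where ?'a = complex] by simp
  then have "char_poly A = (\<Prod>a\<leftarrow>as. [:- a, 1:])"
    by (simp add: poly_eq_iff coeff_map_poly)
  moreover have "length as = n" unfolding as_def using zs by simp
  ultimately show thesis using that by blast
qed

lemma num_stable_uminus_cmat:
  fixes A :: "real mat"
  assumes A: "A \<in> carrier_mat n n" and c: "char_poly A = (\<Prod>a\<leftarrow>as. [:- a, 1:])"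
  shows "num_stable_eigenvalues (- cmat A) = num_pos_eigenvalues A"
proof -
  have cA: "cmat A \<in> carrier_mat n n" using A by auto
  have "num_stable_eigenvalues (- cmat A) =
      length (filter (\<lambda>z. Re z < 0) (map uminus (map complex_of_real as)))"
    using cA by (intro num_stable_eigenvalues_eq[OF _ char_poly_uminus[OF cA char_poly_cmat[OF A c]]]) auto
  also have "\<dots> = length (filter (\<lambda>z. 0 < z) as)" by (simp add: filter_map o_def)
  finally show ?thesis using num_pos_eigenvalues_eq[OF A c] by simp
qed

lemma cmat_mult: "A \<in> carrier_mat m n \<Longrightarrow> B \<in> carrier_mat n k \<Longrightarrow> cmat (A * B) = cmat A * cmat B"
  by (rule of_real_hom.mat_hom_mult)

lemma cmat_one [simp]: "cmat (1\<^sub>m n) = 1\<^sub>m n"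
  by (rule of_real_hom.mat_hom_one)

lemma inj_mat_cmat:
  assumes A: "A \<in> carrier_mat m n" and i: "inj_mat (cmat A)"
  shows "inj_mat A"
proof (rule inj_matI[OF A])
  fix a assume a: "a \<in> carrier_vec n" and z: "A *\<^sub>v a = 0\<^sub>v m"
  let ?a = "map_vec complex_of_real a"
  have "cmat A *\<^sub>v ?a = map_vec complex_of_real (A *\<^sub>v a)"
    using of_real_hom.mult_mat_vec_hom[OF A a, where ?'a = complex] by simp
  also have "\<dots> = 0\<^sub>v m" unfolding z by auto
  finally have "?a = 0\<^sub>v n" using inj_matD[OF i, of m n ?a] A a by simp
  then show "a = 0\<^sub>v n" using a by (auto simp: vec_eq_iff)
qed

text \<open>With real spectrum the Schur decomposition runs over the reals and yields a real frame.
  The reality of B_o depends on this, because B_o is built from the fast modes.\<close>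

lemma real_stable_frame_exists:
  fixes Z :: "real mat"
  assumes Z: "Z \<in> carrier_mat n n" and ev: "\<And>z. eigenvalue (cmat Z) z \<Longrightarrow> Im z = 0"
  obtains q \<Theta> X where "\<Theta> \<in> carrier_mat n q" "X \<in> carrier_mat q q" "Z * \<Theta> = \<Theta> * X"
    "inj_mat (cmat \<Theta>)" "stable_mat (cmat X)"
    "\<And>g. g \<in> carrier_vec n \<Longrightarrow> hardy (cmat Z) g \<Longrightarrow> \<exists>a \<in> carrier_vec q. g = cmat \<Theta> *\<^sub>v a"
proof -
  obtain as where as: "char_poly Z = (\<Prod>a\<leftarrow>as. [:- a, 1:])" "length as = n"
    using char_poly_real_factorized[OF Z ev] by blast
  let ?P = "\<lambda>z::real. z < 0"
  define es where "es = filter ?P as @ filter (\<lambda>z. \<not> ?P z) as"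
  let ?k = "length (filter ?P as)"
  have "mset es = mset as" unfolding es_def by simp
  then have "(\<Prod>a\<leftarrow>es. [:- a, 1:]) = (\<Prod>a\<leftarrow>as. [:- a, 1:])"
    by (metis mset_map prod_mset_prod_list)
  with as have es: "char_poly Z = (\<Prod>a\<leftarrow>es. [:- a, 1:])" by simp
  obtain T P Q where s: "schur_decomposition Z es = (T, P, Q)" by (cases "schur_decomposition Z es") auto
  from schur_decomposition[OF Z es s] have w: "similar_mat_wit Z T P Q" "upper_triangular T" "diag_mat T = es"
    by auto
  note d = similar_mat_witD2[OF Z w(1)]
  have kn: "?k \<le> n" using as(2) length_filter_le by blast
  note b = similar_triangular_leading_block[OF Z w(1,2) kn]
  let ?R = "mat n ?k (\<lambda>(i,j). P $$ (i,j))" and ?X = "mat ?k ?k (\<lambda>(i,j). T $$ (i,j))"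
  have cZ: "cmat Z \<in> carrier_mat n n" using Z by auto
  have cw: "similar_mat_wit (cmat Z) (cmat T) (cmat P) (cmat Q)"
  proof (rule similar_mat_witI[of _ _ n])
    show "cmat P * cmat Q = 1\<^sub>m n" using cmat_mult[OF d(6,7)] d(1) by simp
    show "cmat Q * cmat P = 1\<^sub>m n" using cmat_mult[OF d(7,6)] d(2) by simp
    show "cmat Z = cmat P * cmat T * cmat Q"
      unfolding d(3) using d(5-7) cmat_mult[of "P * T" n n Q n] cmat_mult[OF d(6,5)] by simp
  qed (use d in auto)
  have cu: "upper_triangular (cmat T)" using w(2) d(5) unfolding upper_triangular_def by auto
  note cb = similar_triangular_leading_block[OF cZ cw cu kn]
  have cR: "mat n ?k (\<lambda>(i,j). cmat P $$ (i,j)) = cmat ?R" using d(6) kn by (intro eq_matI) auto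
  have cX: "mat ?k ?k (\<lambda>(i,j). cmat T $$ (i,j)) = cmat ?X" using d(5) kn by (intro eq_matI) auto
  have "diag_mat (cmat ?X) = map complex_of_real (diag_mat ?X)" unfolding diag_mat_def by auto
  then have "diag_mat (cmat ?X) = map complex_of_real (filter ?P as)" unfolding b(4) w(3) es_def by simp
  then have st: "stable_mat (cmat ?X)"
    using cb(3)[unfolded cX] by (intro stable_mat_upper_triangular[of _ ?k]) auto
  have "0 \<le> Re (cmat T $$ (i,i))" if "?k \<le> i" "i < n" for i
  proof -
    have "T $$ (i,i) = es ! i" unfolding w(3)[symmetric] diag_mat_def using d(5) that by simp
    also have "\<dots> = filter (\<lambda>z. \<not> ?P z) as ! (i - ?k)" unfolding es_def using that by (simp add: nth_append)
    also have "\<dots> \<in> set (filter (\<lambda>z. \<not> ?P z) as)"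
      using that as(2) sum_length_filter_compl[of ?P as] by (intro nth_mem) linarith
    finally show ?thesis using d(5) that by simp
  qed
  from hardy_in_leading_range[OF cZ cw cu kn this, unfolded cR]
  show thesis using b st cb(2)[unfolded cR] by (intro that[of ?R ?k ?X]) auto
qed

text \<open>Definiteness passes from real to complex vectors by splitting into real and imaginary
  parts. The uniform \<open>\<sigma>\<close> then comes from compactness of the unit sphere.\<close>

lemma negative_definite_qf:
  assumes S: "S \<in> carrier_mat r r" and sym: "transpose_mat S = S" and nd: "negative_definite S"
  obtains \<sigma> where "0 < \<sigma>" "\<And>v. v \<in> carrier_vec r \<Longrightarrow> qf (cmat S) v \<le> - \<sigma> * sqn v"
proof -
  have cS: "cmat S \<in> carrier_mat r r" using S by auto
  have h: "mat_adjoint (cmat S) = cmat S" unfolding mat_adjoint_cmat sym ..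
  have neg: "qf (cmat S) v < 0" if v: "v \<in> carrier_vec r" "v \<noteq> 0\<^sub>v r" for v
  proof -
    let ?x = "map_vec Re v" and ?y = "map_vec Im v"
    have xy: "?x \<in> carrier_vec r" "?y \<in> carrier_vec r" using v by auto
    have "qf (cmat S) v = (\<Sum>i<r. \<Sum>j<r. S $$ (i,j) * (Re (v $ j) * Re (v $ i) + Im (v $ j) * Im (v $ i)))"
      unfolding qf_def using S v(1)
      by (simp add: scalar_prod_def atLeast0LessThan sum_distrib_left algebra_simps sum.distrib)
    also have "\<dots> = ?x \<bullet> (S *\<^sub>v ?x) + ?y \<bullet> (S *\<^sub>v ?y)"
    proof -
      have "?x \<bullet> (S *\<^sub>v ?x) = (\<Sum>i<r. \<Sum>j<r. S $$ (i,j) * (Re (v $ j) * Re (v $ i)))"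
        "?y \<bullet> (S *\<^sub>v ?y) = (\<Sum>i<r. \<Sum>j<r. S $$ (i,j) * (Im (v $ j) * Im (v $ i)))"
        using S v(1) by (simp_all add: scalar_prod_def atLeast0LessThan sum_distrib_left mult_ac)
      then show ?thesis by (simp add: sum.distrib ring_distribs)
    qed
    finally have e: "qf (cmat S) v = ?x \<bullet> (S *\<^sub>v ?x) + ?y \<bullet> (S *\<^sub>v ?y)" .
    have le: "x \<bullet> (S *\<^sub>v x) \<le> 0" if "x \<in> carrier_vec r" for x
      using nd S that unfolding negative_definite_def by (cases "x = 0\<^sub>v r") (auto simp: less_imp_le)
    have "?x \<noteq> 0\<^sub>v r \<or> ?y \<noteq> 0\<^sub>v r"
      using v by (auto simp: vec_eq_iff complex_eq_iff)
    then have "?x \<bullet> (S *\<^sub>v ?x) < 0 \<or> ?y \<bullet> (S *\<^sub>v ?y) < 0"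
      using nd S xy unfolding negative_definite_def by auto
    with le[OF xy(1)] le[OF xy(2)] show ?thesis unfolding e by linarith
  qed
  have "\<exists>\<sigma> > 0. \<forall>v \<in> carrier_vec r. qf (cmat S) v \<le> - \<sigma> * sqn v"
  proof (rule ccontr)
    assume con: "\<not> ?thesis"
    \<comment> \<open>If every \<open>1 / (k + 1)\<close> fails as a value of
      \<open>\<sigma>\<close>, unit vectors arise whose limit has nonnegative form.\<close>
    have "\<exists>v \<in> carrier_vec r. sqn v = 1 \<and> - 1 / real (Suc k) < qf (cmat S) v" for k
    proof -
      have "(0 :: real) < 1 / real (Suc k)" by simp
      with con obtain v where v: "v \<in> carrier_vec r" "\<not> qf (cmat S) v \<le> - (1 / real (Suc k)) * sqn v" by blast
      then have "v \<noteq> 0\<^sub>v r" using cS by (auto simp: qf_def)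
      then have p: "0 < sqn v" using v sqn_pos by blast
      let ?w = "complex_of_real (1 / sqrt (sqn v)) \<cdot>\<^sub>v v"
      have "sqn ?w = 1" using p by (simp add: sqn_smult norm_divide power_divide)
      moreover have "qf (cmat S) ?w = qf (cmat S) v / sqn v"
        using p by (subst qf_smult[OF cS v(1)]) (simp add: norm_divide power_divide)
      moreover have "- 1 / real (Suc k) < qf (cmat S) v / sqn v"
        using v(2) p by (simp add: pos_less_divide_eq)
      ultimately show ?thesis using v(1) by (intro bexI[of _ ?w]) auto
    qed
    then obtain V where V: "\<And>k. V k \<in> carrier_vec r" "\<And>k. sqn (V k) = 1"
      "\<And>k. - 1 / real (Suc k) < qf (cmat S) (V k)" by metis
    obtain g v where g: "strict_mono g" "vlim r (\<lambda>k. V (g k)) v"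
      using bounded_vec_convergent_subseq[of V r 1] V by auto
    have vc: "v \<in> carrier_vec r" using vlimD(2)[OF g(2)] .
    have "sqn v = 1" using LIMSEQ_unique[OF vlim_sqn[OF g(2)], of 1] V(2) by simp
    then have v0: "v \<noteq> 0\<^sub>v r" by auto
    have "(\<lambda>k. qf (cmat S) (V (g k))) \<longlonglongrightarrow> qf (cmat S) v"
    proof -
      have l: "vlim r (\<lambda>k. cmat S *\<^sub>v V (g k)) (cmat S *\<^sub>v v)" by (rule vlim_mult_mat_vec[OF cS g(2)])
      have e: "(cmat S *\<^sub>v x) \<bullet>c x = (\<Sum>i<r. (cmat S *\<^sub>v x) $ i * cnj (x $ i))" if "x \<in> carrier_vec r" for x
        using that by (simp add: scalar_prod_def[of "cmat S *\<^sub>v x"] atLeast0LessThan del: index_mult_mat_vec)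
      have "(\<lambda>k. \<Sum>i<r. (cmat S *\<^sub>v V (g k)) $ i * cnj (V (g k) $ i)) \<longlonglongrightarrow>
          (\<Sum>i<r. (cmat S *\<^sub>v v) $ i * cnj (v $ i))"
        by (intro tendsto_sum tendsto_mult tendsto_cnj vlimD(3)[OF l] vlimD(3)[OF g(2)]) auto
      from tendsto_Re[OF this] show ?thesis unfolding qf_def e[OF V(1)] e[OF vc] .
    qed
    moreover have "(\<lambda>k. - 1 / real (Suc (g k))) \<longlonglongrightarrow> 0"
      using LIMSEQ_subseq_LIMSEQ[OF tendsto_minus[OF LIMSEQ_inverse_real_of_nat] g(1)]
      by (simp add: o_def field_simps)
    ultimately have "0 \<le> qf (cmat S) v"
      using V(3) by (intro LIMSEQ_le[of "\<lambda>k. - 1 / real (Suc (g k))" 0 "\<lambda>k. qf (cmat S) (V (g k))"])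
        (auto intro!: less_imp_le)
    with neg[OF vc v0] show False by simp
  qed
  then show thesis using that by blast
qed

section \<open>The limit of the stable subspaces\<close>

lemma mat_mult_vec_eq:
  assumes "A * B = C" "A \<in> carrier_mat m n" "B \<in> carrier_mat n k" "x \<in> carrier_vec k"
  shows "A *\<^sub>v (B *\<^sub>v x) = C *\<^sub>v x"
  using assms assoc_mult_mat_vec by metis

lemma mat_mult3_vec_eq:
  assumes e: "A * (B * C) = D" and A: "A \<in> carrier_mat m n" and B: "B \<in> carrier_mat n k"
    and C: "C \<in> carrier_mat k l" and x: "x \<in> carrier_vec l"
  shows "A *\<^sub>v (B *\<^sub>v (C *\<^sub>v x)) = D *\<^sub>v x"
proof -
  have "B *\<^sub>v (C *\<^sub>v x) = B * C *\<^sub>v x" using assoc_mult_mat_vec[OF B C x] by simp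
  then show ?thesis using mat_mult_vec_eq[OF e A _ x] B C by simp
qed

lemma minus_vec_eq_0:
  fixes a b :: "complex vec"
  assumes "a \<in> carrier_vec n" "b \<in> carrier_vec n" "a - b = 0\<^sub>v n"
  shows "a = b"
proof (rule eq_vecI)
  fix i assume "i < dim_vec b"
  then show "a $ i = b $ i" using arg_cong[OF assms(3), of "\<lambda>v. v $ i"] assms(1,2) by auto
qed (use assms in auto)

lemma zero_mat_mult_vec [simp]: "x \<in> carrier_vec k \<Longrightarrow> 0\<^sub>m m k *\<^sub>v x = (0\<^sub>v m :: complex vec)"
  by (intro eq_vecI) auto

text \<open>The limit problem at one frequency. \<open>p1\<close>, \<open>p0\<close>,
  \<open>pv\<close> are orthonormal blocks filling the space. \<open>D\<close> stands for
  \<open>\<xi> I\<close> plus the tangential symbol and enters the energy only through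
  \<open>\<gamma> = Re \<xi>\<close>. \<open>Z\<close> drives the fast layer, the columns of
  \<open>G\<close> are boundary values of its decaying modes, and \<open>Th\<close> is their
  \<open>pv\<close> part. \<open>M1\<close> is given implicitly: \<open>K y\<close> is the
  \<open>p0\<close> part that cancels the \<open>p0\<close> component of \<open>D\<close>, and
  \<open>L M1\<close> is minus the resulting Schur complement.\<close>

locale relaxation_limit =
  fixes n m l r q :: nat and A J p1 p0 pv L S G Th Z :: "complex mat" and \<sigma> :: real
    and D M1 K :: "complex mat" and \<gamma> :: real
  assumes A: "A \<in> carrier_mat n n" "mat_adjoint A = A" and J: "J \<in> carrier_mat n n" "J * A = 1\<^sub>m n" "A * J = 1\<^sub>m n"
    and p: "p1 \<in> carrier_mat n m" "p0 \<in> carrier_mat n l" "pv \<in> carrier_mat n r"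
    and gram: "mat_adjoint p1 * p1 = 1\<^sub>m m" "mat_adjoint p1 * p0 = 0\<^sub>m m l" "mat_adjoint p1 * pv = 0\<^sub>m m r"
      "mat_adjoint p0 * p1 = 0\<^sub>m l m" "mat_adjoint p0 * p0 = 1\<^sub>m l" "mat_adjoint p0 * pv = 0\<^sub>m l r"
      "mat_adjoint pv * p1 = 0\<^sub>m r m" "mat_adjoint pv * p0 = 0\<^sub>m r l" "mat_adjoint pv * pv = 1\<^sub>m r"
    and complete: "\<And>x. x \<in> carrier_vec n \<Longrightarrow>
      x = p1 *\<^sub>v (mat_adjoint p1 *\<^sub>v x) + (p0 *\<^sub>v (mat_adjoint p0 *\<^sub>v x) + pv *\<^sub>v (mat_adjoint pv *\<^sub>v x))"
    and LA: "mat_adjoint p1 * (A * p1) = L" "mat_adjoint p1 * (A * p0) = 0\<^sub>m m l"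
      "mat_adjoint p0 * (A * p1) = 0\<^sub>m l m" "mat_adjoint p0 * (A * p0) = 0\<^sub>m l l"
    and L: "L \<in> carrier_mat m m" "mat_adjoint L = L" "inj_mat L"
    and S: "S \<in> carrier_mat r r" and \<sigma>: "0 < \<sigma>" "\<And>v. v \<in> carrier_vec r \<Longrightarrow> qf S v \<le> - \<sigma> * sqn v"
    and G: "G \<in> carrier_mat n q" "Th \<in> carrier_mat r q" "inj_mat Th" "mat_adjoint pv * G = Th"
      "mat_adjoint p1 * (A * G) = 0\<^sub>m m q" "mat_adjoint p0 * (A * G) = 0\<^sub>m l q"
      "\<And>w. w \<in> carrier_vec q \<Longrightarrow> 0 \<le> qf A (G *\<^sub>v w)"
    and Z: "Z \<in> carrier_mat r r" "Z = mat_adjoint pv * (J * (pv * S))"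
      "\<And>g. g \<in> carrier_vec r \<Longrightarrow> hardy Z g \<Longrightarrow> \<exists>w \<in> carrier_vec q. g = Th *\<^sub>v w"
    and D: "D \<in> carrier_mat n n" and \<gamma>: "0 < \<gamma>" "\<And>x. x \<in> carrier_vec n \<Longrightarrow> qf D x = \<gamma> * sqn x"
    and M1: "M1 \<in> carrier_mat m m" "K \<in> carrier_mat l m"
      "\<And>y. y \<in> carrier_vec m \<Longrightarrow> mat_adjoint p0 *\<^sub>v (D *\<^sub>v (p1 *\<^sub>v y + p0 *\<^sub>v (K *\<^sub>v y))) = 0\<^sub>v l"
      "\<And>y. y \<in> carrier_vec m \<Longrightarrow>
        L *\<^sub>v (M1 *\<^sub>v y) = - (mat_adjoint p1 *\<^sub>v (D *\<^sub>v (p1 *\<^sub>v y + p0 *\<^sub>v (K *\<^sub>v y))))"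
begin

lemma pa: "mat_adjoint p1 \<in> carrier_mat m n" "mat_adjoint p0 \<in> carrier_mat l n" "mat_adjoint pv \<in> carrier_mat r n"
  using p by auto

definition Q where "Q = pv * (S * mat_adjoint pv)"

definition Msym :: "real \<Rightarrow> complex mat" where
  "Msym \<eta> = J * (complex_of_real \<eta> \<cdot>\<^sub>m Q - D)"

lemma Q_carrier: "Q \<in> carrier_mat n n" unfolding Q_def using p S pa by auto

lemma Msym_carrier: "Msym \<eta> \<in> carrier_mat n n" unfolding Msym_def using J D Q_carrier by auto

lemma Q_vec: "x \<in> carrier_vec n \<Longrightarrow> Q *\<^sub>v x = pv *\<^sub>v (S *\<^sub>v (mat_adjoint pv *\<^sub>v x))"
  using mat_mult3_vec_eq[OF Q_def[symmetric] p(3) S pa(3)] by simp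

lemma Msym_vec:
  assumes x: "x \<in> carrier_vec n"
  shows "Msym \<eta> *\<^sub>v x = J *\<^sub>v (complex_of_real \<eta> \<cdot>\<^sub>v (Q *\<^sub>v x) - D *\<^sub>v x)"
proof -
  have "(complex_of_real \<eta> \<cdot>\<^sub>m Q - D) *\<^sub>v x = complex_of_real \<eta> \<cdot>\<^sub>v (Q *\<^sub>v x) - D *\<^sub>v x"
    using Q_carrier D x by (subst minus_mult_distrib_mat_vec[of _ n n]) (auto intro!: eq_vecI)
  then show ?thesis unfolding Msym_def using J(1) Q_carrier D x
    by (subst assoc_mult_mat_vec[of _ n n _ n]) auto
qed

lemma A_Msym_vec:
  assumes x: "x \<in> carrier_vec n"
  shows "A *\<^sub>v (Msym \<eta> *\<^sub>v x) = complex_of_real \<eta> \<cdot>\<^sub>v (Q *\<^sub>v x) - D *\<^sub>v x"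
  unfolding Msym_vec[OF x] using mat_mult_vec_eq[OF J(3) A(1) J(1)] Q_carrier D x by simp

lemma qf_Msym:
  assumes x: "x \<in> carrier_vec n"
  shows "qf (A * Msym \<eta>) x = \<eta> * qf S (mat_adjoint pv *\<^sub>v x) - \<gamma> * sqn x"
proof -
  let ?v = "mat_adjoint pv *\<^sub>v x"
  have v: "?v \<in> carrier_vec r" using pa x by auto
  have "(Q *\<^sub>v x) \<bullet>c x = (S *\<^sub>v ?v) \<bullet>c ?v"
    unfolding Q_vec[OF x] using inner_adjoint[OF p(3) _ x] S v by simp
  then have "(complex_of_real \<eta> \<cdot>\<^sub>v (Q *\<^sub>v x) - D *\<^sub>v x) \<bullet>c x =
      complex_of_real \<eta> * ((S *\<^sub>v ?v) \<bullet>c ?v) - (D *\<^sub>v x) \<bullet>c x"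
    using Q_carrier D x by (simp add: inner_simps[of _ n])
  then show ?thesis unfolding qf_mult[OF A(1) Msym_carrier x] A_Msym_vec[OF x]
    using \<gamma>(2)[OF x] by (simp add: qf_def)
qed

lemma qf_Msym_le:
  assumes x: "x \<in> carrier_vec n" and \<eta>: "0 \<le> \<eta>"
  shows "\<gamma> * sqn x + \<eta> * (\<sigma> * sqn (mat_adjoint pv *\<^sub>v x)) \<le> - qf (A * Msym \<eta>) x"
proof -
  have "\<eta> * qf S (mat_adjoint pv *\<^sub>v x) \<le> \<eta> * (- \<sigma> * sqn (mat_adjoint pv *\<^sub>v x))"
    using \<sigma>(2) pa x \<eta> by (intro mult_left_mono) auto
  then show ?thesis unfolding qf_Msym[OF x] by simp
qed

lemma Msym_neg:
  assumes x: "x \<in> carrier_vec n" "x \<noteq> 0\<^sub>v n" and \<eta>: "0 \<le> \<eta>"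
  shows "qf (A * Msym \<eta>) x < 0"
proof -
  have "0 < \<gamma> * sqn x" using \<gamma>(1) sqn_pos[OF x] by simp
  moreover have "0 \<le> \<eta> * (\<sigma> * sqn (mat_adjoint pv *\<^sub>v x))" using \<eta> \<sigma>(1) by simp
  ultimately show ?thesis using qf_Msym_le[OF x(1) \<eta>] by linarith
qed

text \<open>For \<open>u = p1 y + p0 (K y)\<close> the \<open>p0\<close> component of
  \<open>D u\<close> vanishes, so the form of \<open>L M1\<close> at \<open>y\<close> is minus that
  of \<open>D\<close> at \<open>u\<close>. By orthogonality \<open>|u|^2 \<ge> |y|^2\<close>, so the
  Schur complement inherits coercivity.\<close>

lemma qf_L_M1:
  assumes y: "y \<in> carrier_vec m"
  shows "qf (L * M1) y \<le> - \<gamma> * sqn y"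
proof -
  let ?z = "K *\<^sub>v y"
  let ?u = "p1 *\<^sub>v y + p0 *\<^sub>v ?z"
  have z: "?z \<in> carrier_vec l" using M1 y by auto
  have u: "?u \<in> carrier_vec n" using p y z by auto
  have Du: "D *\<^sub>v ?u \<in> carrier_vec n" using D u by auto
  have py: "mat_adjoint p1 *\<^sub>v ?u = y"
    using mat_mult_vec_eq[OF gram(1) pa(1) p(1) y] mat_mult_vec_eq[OF gram(2) pa(1) p(2) z] p y z
    by (subst mult_add_distrib_mat_vec[OF pa(1)]) auto
  have "(D *\<^sub>v ?u) \<bullet>c ?u = (mat_adjoint p1 *\<^sub>v (D *\<^sub>v ?u)) \<bullet>c y + (mat_adjoint p0 *\<^sub>v (D *\<^sub>v ?u)) \<bullet>c ?z"
    using inner_adjoint[OF pa(1) Du y] inner_adjoint[OF pa(2) Du z] Du p y z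
    by (simp add: inner_add_right[of _ n])
  also have "\<dots> = (mat_adjoint p1 *\<^sub>v (D *\<^sub>v ?u)) \<bullet>c y" unfolding M1(3)[OF y] using z by simp
  finally have e: "Re ((mat_adjoint p1 *\<^sub>v (D *\<^sub>v ?u)) \<bullet>c y) = \<gamma> * sqn ?u"
    using \<gamma>(2)[OF u] unfolding qf_def by simp
  have "sqn y \<le> sqn ?u"
  proof -
    let ?w = "p0 *\<^sub>v ?z"
    have "?u \<bullet>c ?u = y \<bullet>c y + ?w \<bullet>c ?w"
    proof -
      have 1: "(p1 *\<^sub>v y) \<bullet>c (p1 *\<^sub>v y) = y \<bullet>c y"
        using inner_adjoint[OF p(1) y, of "p1 *\<^sub>v y"] mat_mult_vec_eq[OF gram(1) pa(1) p(1) y] p y by simp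
      have 2: "(p1 *\<^sub>v y) \<bullet>c ?w = 0"
        using inner_adjoint[OF p(1) y, of ?w] mat_mult_vec_eq[OF gram(2) pa(1) p(2) z] p y z by simp
      have 3: "?w \<bullet>c (p1 *\<^sub>v y) = 0"
        using inner_adjoint[OF p(2) z, of "p1 *\<^sub>v y"] mat_mult_vec_eq[OF gram(4) pa(2) p(1) y] p y z by simp
      show ?thesis using p y z 1 2 3 by (simp add: inner_simps[of _ n])
    qed
    then have "sqn ?u = sqn y + sqn ?w" unfolding inner_self by (metis of_real_add of_real_eq_iff)
    then show ?thesis using sqn_nonneg[of ?w] by linarith
  qed
  then have "\<gamma> * sqn y \<le> \<gamma> * sqn ?u" using \<gamma>(1) by (intro mult_left_mono) auto
  moreover have "qf (L * M1) y = - (\<gamma> * sqn ?u)"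
  proof -
    let ?b = "mat_adjoint p1 *\<^sub>v (D *\<^sub>v ?u)"
    have b: "?b \<in> carrier_vec m" using pa Du by auto
    then have "- ?b = (- 1) \<cdot>\<^sub>v ?b" by (intro eq_vecI) (auto simp del: index_mult_mat_vec)
    then have "(- ?b) \<bullet>c y = - (?b \<bullet>c y)" using b y by (simp add: inner_smult_left[of _ m])
    then show ?thesis unfolding qf_mult[OF L(1) M1(1) y] M1(4)[OF y] e[symmetric] by simp
  qed
  ultimately show ?thesis by simp
qed

text \<open>Without \<open>pv\<close> part, \<open>u\<close> is \<open>p1 y + p0 z\<close>. Since
  the \<open>p0\<close> rows of \<open>A\<close> vanish on such vectors, the \<open>p0\<close>
  equation is a constraint free of \<open>s\<close>, and it determines \<open>z = K y\<close>.
  Cancelling the injective \<open>L\<close> in the \<open>p1\<close> equation leaves the resolvent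
  equation of \<open>M1\<close>.\<close>

lemma slow_equation:
  assumes u: "u \<in> carrier_vec n" and uv: "mat_adjoint pv *\<^sub>v u = 0\<^sub>v r" and g: "g \<in> carrier_vec m"
    and e1: "s \<cdot>\<^sub>v (mat_adjoint p1 *\<^sub>v (A *\<^sub>v u)) + mat_adjoint p1 *\<^sub>v (D *\<^sub>v u) = L *\<^sub>v g"
    and e0: "s \<cdot>\<^sub>v (mat_adjoint p0 *\<^sub>v (A *\<^sub>v u)) + mat_adjoint p0 *\<^sub>v (D *\<^sub>v u) = 0\<^sub>v l"
  defines "y \<equiv> mat_adjoint p1 *\<^sub>v u"
  shows "s \<cdot>\<^sub>v y - M1 *\<^sub>v y = g"
proof -
  define z where "z = mat_adjoint p0 *\<^sub>v u"
  have y: "y \<in> carrier_vec m" and z: "z \<in> carrier_vec l" unfolding y_def z_def using pa u by auto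
  have uyz: "u = p1 *\<^sub>v y + p0 *\<^sub>v z"
  proof -
    have "pv *\<^sub>v 0\<^sub>v r = 0\<^sub>v n" using p by auto
    then show ?thesis
      using complete[OF u] unfolding uv y_def[symmetric] z_def[symmetric] using p y z by simp
  qed
  have Au: "A *\<^sub>v u = A *\<^sub>v (p1 *\<^sub>v y) + A *\<^sub>v (p0 *\<^sub>v z)"
    unfolding uyz using p y z by (intro mult_add_distrib_mat_vec[OF A(1)]) auto
  have Ap: "A *\<^sub>v (p1 *\<^sub>v y) \<in> carrier_vec n" "A *\<^sub>v (p0 *\<^sub>v z) \<in> carrier_vec n" using A p y z by auto
  have A1: "mat_adjoint p1 *\<^sub>v (A *\<^sub>v u) = L *\<^sub>v y"
    unfolding Au mult_add_distrib_mat_vec[OF pa(1) Ap]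
      mat_mult3_vec_eq[OF LA(1) pa(1) A(1) p(1) y] mat_mult3_vec_eq[OF LA(2) pa(1) A(1) p(2) z]
    using L y z by simp
  have A0: "mat_adjoint p0 *\<^sub>v (A *\<^sub>v u) = 0\<^sub>v l"
    unfolding Au mult_add_distrib_mat_vec[OF pa(2) Ap]
      mat_mult3_vec_eq[OF LA(3) pa(2) A(1) p(1) y] mat_mult3_vec_eq[OF LA(4) pa(2) A(1) p(2) z]
    using y z by simp
  have "s \<cdot>\<^sub>v 0\<^sub>v l = (0\<^sub>v l :: complex vec)" by (intro eq_vecI) auto
  then have e0': "mat_adjoint p0 *\<^sub>v (D *\<^sub>v u) = 0\<^sub>v l" using e0 unfolding A0 using pa D u by simp
  let ?u = "p1 *\<^sub>v y + p0 *\<^sub>v (K *\<^sub>v y)"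
  have Ky: "K *\<^sub>v y \<in> carrier_vec l" using M1 y by auto
  have u': "?u \<in> carrier_vec n" using p y Ky by auto
  let ?t = "z - K *\<^sub>v y"
  have t: "?t \<in> carrier_vec l" using z Ky by auto
  let ?w = "p0 *\<^sub>v ?t"
  have w: "?w \<in> carrier_vec n" using p t by auto
  have wu: "?w = u - ?u"
    unfolding uyz mult_minus_distrib_mat_vec[OF p(2) z Ky]
    using p y z Ky by (intro eq_vecI) (auto simp del: index_mult_mat_vec)
  have Dw: "D *\<^sub>v ?w \<in> carrier_vec n" using D w by auto
  \<comment> \<open>Uniqueness in the constraint: the difference of two solutions lies in the range
    of \<open>p0\<close> and has zero energy for the coercive \<open>D\<close>.\<close>
  have "mat_adjoint p0 *\<^sub>v (D *\<^sub>v ?w) = 0\<^sub>v l"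
    unfolding wu mult_minus_distrib_mat_vec[OF D u u'] using D u u' e0' M1(3)[OF y]
    by (subst mult_minus_distrib_mat_vec[OF pa(2)]) auto
  then have "(D *\<^sub>v ?w) \<bullet>c ?w = 0" using inner_adjoint[OF pa(2) Dw t] t by simp
  then have "\<gamma> * sqn ?w = 0" using \<gamma>(2)[OF w] unfolding qf_def by simp
  then have "?w = 0\<^sub>v n" using \<gamma>(1) sqn_eq_0[OF w] by simp
  then have uu: "?u = u" using minus_vec_eq_0[OF u u'] wu by simp
  have Du: "mat_adjoint p1 *\<^sub>v (D *\<^sub>v u) \<in> carrier_vec m" using pa D u by auto
  have Ly: "L *\<^sub>v y \<in> carrier_vec m" using L y by auto
  have "s \<cdot>\<^sub>v (L *\<^sub>v y) - L *\<^sub>v (M1 *\<^sub>v y) = s \<cdot>\<^sub>v (L *\<^sub>v y) + mat_adjoint p1 *\<^sub>v (D *\<^sub>v u)"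
    unfolding M1(4)[OF y] uu using Du Ly by (intro eq_vecI) (auto simp del: index_mult_mat_vec)
  then have "s \<cdot>\<^sub>v (L *\<^sub>v y) - L *\<^sub>v (M1 *\<^sub>v y) = L *\<^sub>v g" using e1 unfolding A1 by simp
  then have "L *\<^sub>v (s \<cdot>\<^sub>v y - M1 *\<^sub>v y) = L *\<^sub>v g"
    using mult_mat_vec[OF L(1) y] M1 y by (subst mult_minus_distrib_mat_vec[OF L(1)]) auto
  moreover have M1y: "s \<cdot>\<^sub>v y - M1 *\<^sub>v y \<in> carrier_vec m" using M1 y by auto
  ultimately have "L *\<^sub>v ((s \<cdot>\<^sub>v y - M1 *\<^sub>v y) - g) = 0\<^sub>v m"
    using L g by (subst mult_minus_distrib_mat_vec[OF L(1)]) auto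
  from inj_matD[OF L(3,1) _ this] M1y g have "(s \<cdot>\<^sub>v y - M1 *\<^sub>v y) - g = 0\<^sub>v m" by auto
  then show ?thesis by (rule minus_vec_eq_0[OF M1y g])
qed


lemma resolvent_bound:
  assumes R: "R \<in> carrier_mat n k" and f: "stable_frame (Msym \<eta>) R X" and \<eta>: "0 \<le> \<eta>"
    and a: "a \<in> carrier_vec k" and s: "0 < Re s"
  shows "\<exists>U \<in> carrier_vec n. s \<cdot>\<^sub>v U - Msym \<eta> *\<^sub>v U = R *\<^sub>v a \<and>
    4 * Re s * (\<gamma> * sqn U + \<eta> * (\<sigma> * sqn (mat_adjoint pv *\<^sub>v U))) \<le> qf A (R *\<^sub>v a)"
proof -
  have neg: "qf (A * Msym \<eta>) x < 0" if "x \<in> carrier_vec n" "x \<noteq> 0\<^sub>v n" for x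
    using Msym_neg[OF that \<eta>] .
  obtain U where U: "U \<in> carrier_vec n" "s \<cdot>\<^sub>v U - Msym \<eta> *\<^sub>v U = R *\<^sub>v a"
    "- 4 * Re s * qf (A * Msym \<eta>) U \<le> qf A (R *\<^sub>v a)"
    using stable_frame_resolvent[OF A Msym_carrier neg R f a s] by blast
  have "4 * Re s * (\<gamma> * sqn U + \<eta> * (\<sigma> * sqn (mat_adjoint pv *\<^sub>v U))) \<le> 4 * Re s * (- qf (A * Msym \<eta>) U)"
    using qf_Msym_le[OF U(1) \<eta>] s by (intro mult_left_mono) auto
  with U show ?thesis by (intro bexI[of _ U]) auto
qed

section \<open>Limits along relaxation parameters tending to infinity\<close>

context
  fixes \<eta> :: "nat \<Rightarrow> real" and R X :: "nat \<Rightarrow> complex mat" and a e :: "complex vec" and k :: nat and CA :: real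
  assumes \<eta>: "\<And>j. 0 < \<eta> j" "filterlim \<eta> at_top sequentially"
    and R: "\<And>j. R j \<in> carrier_mat n k" "\<And>j. stable_frame (Msym (\<eta> j)) (R j) (X j)"
    and a: "a \<in> carrier_vec k" and e: "vlim n (\<lambda>j. R j *\<^sub>v a) e"
    and CA: "0 \<le> CA" "\<And>j. qf A (R j *\<^sub>v a) \<le> CA"
begin

text \<open>Both energy terms are nonnegative, so each alone is at most \<open>CA\<close>. The
  resolvent parameter may vary with \<open>j\<close>, which serves the slow and the fast scaling
  alike.\<close>

lemma resolvent_seq:
  assumes s: "\<And>j. 0 < Re (s j)"
  obtains U where "\<And>j. U j \<in> carrier_vec n" "\<And>j. s j \<cdot>\<^sub>v U j - Msym (\<eta> j) *\<^sub>v U j = R j *\<^sub>v a"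
    "\<And>j. sqn (U j) \<le> CA / (4 * \<gamma>) / Re (s j)"
    "\<And>j. sqn (mat_adjoint pv *\<^sub>v U j) \<le> CA / (4 * \<sigma>) / (\<eta> j * Re (s j))"
proof -
  have "\<exists>U. U \<in> carrier_vec n \<and> s j \<cdot>\<^sub>v U - Msym (\<eta> j) *\<^sub>v U = R j *\<^sub>v a \<and>
      sqn U \<le> CA / (4 * \<gamma>) / Re (s j) \<and> sqn (mat_adjoint pv *\<^sub>v U) \<le> CA / (4 * \<sigma>) / (\<eta> j * Re (s j))" for j
  proof -
    obtain U where U: "U \<in> carrier_vec n" "s j \<cdot>\<^sub>v U - Msym (\<eta> j) *\<^sub>v U = R j *\<^sub>v a"
      "4 * Re (s j) * (\<gamma> * sqn U + \<eta> j * (\<sigma> * sqn (mat_adjoint pv *\<^sub>v U))) \<le> qf A (R j *\<^sub>v a)"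
      using resolvent_bound[OF R(1,2) less_imp_le[OF \<eta>(1)] a s] by blast
    let ?v = "mat_adjoint pv *\<^sub>v U"
    have t: "4 * Re (s j) * (\<gamma> * sqn U) + 4 * Re (s j) * (\<eta> j * (\<sigma> * sqn ?v)) \<le> CA"
      using U(3) CA(2)[of j] by (simp add: distrib_left)
    have p: "0 \<le> 4 * Re (s j) * (\<gamma> * sqn U)" "0 \<le> 4 * Re (s j) * (\<eta> j * (\<sigma> * sqn ?v))"
      using s[of j] \<gamma>(1) \<sigma>(1) \<eta>(1)[of j] by (auto intro!: mult_nonneg_nonneg less_imp_le)
    have "sqn U * (4 * \<gamma> * Re (s j)) = 4 * Re (s j) * (\<gamma> * sqn U)" by simp
    also have "\<dots> \<le> CA" using t p by linarith
    finally have b1: "sqn U \<le> CA / (4 * \<gamma>) / Re (s j)"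
      unfolding divide_divide_eq_left using s[of j] \<gamma>(1) by (subst pos_le_divide_eq) auto
    have "sqn ?v * (4 * \<sigma> * (\<eta> j * Re (s j))) = 4 * Re (s j) * (\<eta> j * (\<sigma> * sqn ?v))" by simp
    also have "\<dots> \<le> CA" using t p by linarith
    finally have b2: "sqn ?v \<le> CA / (4 * \<sigma>) / (\<eta> j * Re (s j))"
      unfolding divide_divide_eq_left using s[of j] \<sigma>(1) \<eta>(1)[of j] by (subst pos_le_divide_eq) auto
    from U b1 b2 show ?thesis by blast
  qed
  then show thesis using that by metis
qed

lemma const_over_eta_tendsto_0: "(\<lambda>j. c / \<eta> j) \<longlonglongrightarrow> 0"
  by (rule real_tendsto_divide_at_top[OF tendsto_const \<eta>(2)])

lemma sqn_tendsto_0_of_le: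
  assumes "\<And>j. sqn (V j) \<le> c / \<eta> j"
  shows "(\<lambda>j. sqn (V j)) \<longlonglongrightarrow> 0"
  by (rule tendsto_sandwich[OF _ _ tendsto_const const_over_eta_tendsto_0[of c]]) (use assms in auto)

text \<open>At the resolvent parameter \<open>\<eta> s\<close> the squared norm of \<open>U\<close>
  is of order \<open>1 / \<eta>\<close> and that of its \<open>pv\<close> part of order
  \<open>1 / \<eta>^2\<close>. So \<open>U\<close> disappears, while the \<open>pv\<close> part
  multiplied by \<open>\<eta>\<close> keeps a bound in \<open>1 / Re s\<close> and satisfies the
  layer equation in the limit.\<close>

lemma limit_fast: "hardy Z (mat_adjoint pv *\<^sub>v e)"
  unfolding hardy_def
proof (intro exI[of _ "CA / (4 * \<sigma>)"] allI impI)
  fix s :: complex assume s: "0 < Re s"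
  have "0 < Re (complex_of_real (\<eta> j) * s)" for j using s \<eta>(1)[of j] by simp
  from resolvent_seq[of "\<lambda>j. complex_of_real (\<eta> j) * s", OF this] obtain U
    where U: "\<And>j. U j \<in> carrier_vec n"
      "\<And>j. (complex_of_real (\<eta> j) * s) \<cdot>\<^sub>v U j - Msym (\<eta> j) *\<^sub>v U j = R j *\<^sub>v a"
      "\<And>j. sqn (U j) \<le> CA / (4 * \<gamma>) / Re (complex_of_real (\<eta> j) * s)"
      "\<And>j. sqn (mat_adjoint pv *\<^sub>v U j) \<le> CA / (4 * \<sigma>) / (\<eta> j * Re (complex_of_real (\<eta> j) * s))"
    by blast
  define V where "V j = complex_of_real (\<eta> j) \<cdot>\<^sub>v (mat_adjoint pv *\<^sub>v U j)" for j
  \<comment> \<open>The \<open>D\<close> term acts on \<open>U\<close> itself, not on the rescaled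
    \<open>V\<close>, and is therefore lost in the limit.\<close>
  define F where "F = mat_adjoint pv * (J * D)"
  have F: "F \<in> carrier_mat r n" unfolding F_def using pa J D by auto
  have V: "V j \<in> carrier_vec r" for j unfolding V_def using pa U(1)[of j] by auto
  have Vb: "sqn (V j) \<le> CA / (4 * \<sigma>) / Re s" for j
  proof -
    have "sqn (V j) = (\<eta> j)\<^sup>2 * sqn (mat_adjoint pv *\<^sub>v U j)" unfolding V_def by (simp add: sqn_smult)
    also have "\<dots> \<le> (\<eta> j)\<^sup>2 * (CA / (4 * \<sigma>) / (\<eta> j * (\<eta> j * Re s)))"
      using U(4)[of j] by (intro mult_left_mono) auto
    also have "\<dots> = CA / (4 * \<sigma>) / Re s" using \<eta>(1)[of j] by (simp add: power2_eq_square)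
    finally show ?thesis .
  qed
  have Ulim: "vlim n U (0\<^sub>v n)"
  proof (rule vlim_zeroI[OF U(1) sqn_tendsto_0_of_le])
    fix j
    have "sqn (U j) \<le> CA / (4 * \<gamma>) / (\<eta> j * Re s)" using U(3)[of j] by simp
    then show "sqn (U j) \<le> (CA / (4 * \<gamma>) / Re s) / \<eta> j" by (simp only: divide_divide_eq_left mult_ac)
  qed
  have eq: "s \<cdot>\<^sub>v V j + (- 1) \<cdot>\<^sub>v (Z *\<^sub>v V j) + F *\<^sub>v U j = mat_adjoint pv *\<^sub>v (R j *\<^sub>v a)" for j
  proof -
    note Uj = U(1)[of j]
    let ?v = "mat_adjoint pv *\<^sub>v U j" and ?\<eta> = "complex_of_real (\<eta> j)"
    have v: "?v \<in> carrier_vec r" using pa Uj by auto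
    have Mv: "mat_adjoint pv *\<^sub>v (Msym (\<eta> j) *\<^sub>v U j) = Z *\<^sub>v V j - F *\<^sub>v U j"
    proof -
      have JQ: "J *\<^sub>v (Q *\<^sub>v U j) \<in> carrier_vec n" "J *\<^sub>v (D *\<^sub>v U j) \<in> carrier_vec n"
        using J Q_carrier D Uj by auto
      have "Msym (\<eta> j) *\<^sub>v U j = ?\<eta> \<cdot>\<^sub>v (J *\<^sub>v (Q *\<^sub>v U j)) - J *\<^sub>v (D *\<^sub>v U j)"
        unfolding Msym_vec[OF Uj] using Q_carrier D Uj mult_mat_vec[OF J(1), of "Q *\<^sub>v U j" ?\<eta>]
        by (subst mult_minus_distrib_mat_vec[OF J(1)]) auto
      then have "mat_adjoint pv *\<^sub>v (Msym (\<eta> j) *\<^sub>v U j) =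
          ?\<eta> \<cdot>\<^sub>v (mat_adjoint pv *\<^sub>v (J *\<^sub>v (Q *\<^sub>v U j))) - mat_adjoint pv *\<^sub>v (J *\<^sub>v (D *\<^sub>v U j))"
        using JQ mult_mat_vec[OF pa(3) JQ(1), of ?\<eta>] by (simp add: mult_minus_distrib_mat_vec[OF pa(3)])
      also have "mat_adjoint pv *\<^sub>v (J *\<^sub>v (D *\<^sub>v U j)) = F *\<^sub>v U j"
        by (rule mat_mult3_vec_eq[OF F_def[symmetric] pa(3) J(1) D Uj])
      also have "mat_adjoint pv *\<^sub>v (J *\<^sub>v (Q *\<^sub>v U j)) = Z *\<^sub>v ?v"
      proof -
        have "pv *\<^sub>v (S *\<^sub>v ?v) = pv * S *\<^sub>v ?v" using assoc_mult_mat_vec[OF p(3) S v] by simp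
        then show ?thesis unfolding Q_vec[OF Uj]
          using mat_mult3_vec_eq[OF Z(2)[symmetric] pa(3) J(1) _ v] p S by auto
      qed
      also have "?\<eta> \<cdot>\<^sub>v (Z *\<^sub>v ?v) = Z *\<^sub>v V j" unfolding V_def using mult_mat_vec[OF Z(1) v] by simp
      finally show ?thesis .
    qed
    have "mat_adjoint pv *\<^sub>v (R j *\<^sub>v a) =
        mat_adjoint pv *\<^sub>v ((?\<eta> * s) \<cdot>\<^sub>v U j) - mat_adjoint pv *\<^sub>v (Msym (\<eta> j) *\<^sub>v U j)"
      unfolding U(2)[symmetric] using Uj mult_mat_vec_carrier[OF Msym_carrier Uj]
      by (intro mult_minus_distrib_mat_vec[OF pa(3)]) auto
    also have "mat_adjoint pv *\<^sub>v ((?\<eta> * s) \<cdot>\<^sub>v U j) = s \<cdot>\<^sub>v V j"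
      unfolding V_def mult_mat_vec[OF pa(3) Uj] by (simp add: smult_smult_assoc mult.commute)
    finally show ?thesis unfolding Mv using V[of j] Z(1) F Uj
      by (intro eq_vecI) (auto simp del: index_mult_mat_vec)
  qed
  obtain g v where g: "strict_mono g" "vlim r (\<lambda>j. V (g j)) v"
    using bounded_vec_convergent_subseq[of V r, OF V Vb] by blast
  have v: "v \<in> carrier_vec r" using vlimD(2)[OF g(2)] .
  have l1: "vlim r (\<lambda>j. s \<cdot>\<^sub>v V (g j) + (- 1) \<cdot>\<^sub>v (Z *\<^sub>v V (g j)) + F *\<^sub>v U (g j))
      (s \<cdot>\<^sub>v v + (- 1) \<cdot>\<^sub>v (Z *\<^sub>v v) + F *\<^sub>v 0\<^sub>v n)"
    by (intro vlim_add vlim_smult vlim_mult_mat_vec[OF Z(1)] vlim_mult_mat_vec[OF F] g(2) vlim_subseq[OF Ulim g(1)])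
  have "vlim r (\<lambda>j. mat_adjoint pv *\<^sub>v (R (g j) *\<^sub>v a)) (mat_adjoint pv *\<^sub>v e)"
    by (rule vlim_mult_mat_vec[OF pa(3) vlim_subseq[OF e g(1)]])
  from vlim_unique[OF l1[unfolded eq] this]
  have "s \<cdot>\<^sub>v v + (- 1) \<cdot>\<^sub>v (Z *\<^sub>v v) + F *\<^sub>v 0\<^sub>v n = mat_adjoint pv *\<^sub>v e" .
  moreover have "F *\<^sub>v 0\<^sub>v n = 0\<^sub>v r" using F by auto
  ultimately have "s \<cdot>\<^sub>v v - Z *\<^sub>v v = mat_adjoint pv *\<^sub>v e"
    using v Z(1) by (simp flip: \<open>_ = mat_adjoint pv *\<^sub>v e\<close>) (auto intro!: eq_vecI simp del: index_mult_mat_vec)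
  moreover have "sqn v \<le> CA / (4 * \<sigma>) / Re s"
    by (rule LIMSEQ_le_const2[OF vlim_sqn[OF g(2)]]) (use Vb in blast)
  ultimately show "\<exists>y\<in>carrier_vec (dim_row Z). s \<cdot>\<^sub>v y - Z *\<^sub>v y = mat_adjoint pv *\<^sub>v e \<and> sqn y \<le> CA / (4 * \<sigma>) / Re s"
    using v Z(1) by auto
qed

text \<open>For fixed \<open>s\<close> the vectors \<open>U\<close> stay bounded and their
  \<open>pv\<close> part tends to 0. A subsequence limit has no \<open>pv\<close> part, so
  \<open>slow_equation\<close> applies to it.\<close>

lemma limit_slow:
  assumes g: "g \<in> carrier_vec m" "mat_adjoint p1 *\<^sub>v (A *\<^sub>v e) = L *\<^sub>v g" and e0: "mat_adjoint p0 *\<^sub>v (A *\<^sub>v e) = 0\<^sub>v l"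
  shows "hardy M1 g"
  unfolding hardy_def
proof (intro exI[of _ "CA / (4 * \<gamma>)"] allI impI)
  fix s :: complex assume s: "0 < Re s"
  then obtain U where U: "\<And>j. U j \<in> carrier_vec n"
      "\<And>j. s \<cdot>\<^sub>v U j - Msym (\<eta> j) *\<^sub>v U j = R j *\<^sub>v a"
      "\<And>j. sqn (U j) \<le> CA / (4 * \<gamma>) / Re s"
      "\<And>j. sqn (mat_adjoint pv *\<^sub>v U j) \<le> CA / (4 * \<sigma>) / (\<eta> j * Re s)"
    using resolvent_seq[of "\<lambda>_. s"] by blast
  obtain h u where h: "strict_mono h" "vlim n (\<lambda>j. U (h j)) u"
    using bounded_vec_convergent_subseq[of U n, OF U(1,3)] by blast
  have u: "u \<in> carrier_vec n" using vlimD(2)[OF h(2)] .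
  have ub: "sqn u \<le> CA / (4 * \<gamma>) / Re s"
    by (rule LIMSEQ_le_const2[OF vlim_sqn[OF h(2)]]) (use U(3) in blast)
  have vU: "mat_adjoint pv *\<^sub>v U j \<in> carrier_vec r" for j using pa U(1)[of j] by auto
  have "vlim r (\<lambda>j. mat_adjoint pv *\<^sub>v U j) (0\<^sub>v r)"
  proof (rule vlim_zeroI[OF vU sqn_tendsto_0_of_le])
    fix j
    show "sqn (mat_adjoint pv *\<^sub>v U j) \<le> (CA / (4 * \<sigma>) / Re s) / \<eta> j" 
      using U(4)[of j] by (simp only: divide_divide_eq_left mult_ac)
  qed
  from vlim_unique[OF vlim_mult_mat_vec[OF pa(3) h(2)] vlim_subseq[OF this h(1)]]
  have uv: "mat_adjoint pv *\<^sub>v u = 0\<^sub>v r" .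
  \<comment> \<open>Rows that annihilate \<open>pv\<close> remove the relaxation term, the only one
    with the factor \<open>\<eta>\<close>. The adjoints of \<open>p1\<close> and \<open>p0\<close>
    are such rows.\<close>
  have lim: "s \<cdot>\<^sub>v (W *\<^sub>v (A *\<^sub>v u)) + W *\<^sub>v (D *\<^sub>v u) = W *\<^sub>v (A *\<^sub>v e)"
    if W: "W \<in> carrier_mat k' n" and Wv: "W * pv = 0\<^sub>m k' r" for W k'
  proof -
    have eq: "s \<cdot>\<^sub>v (W *\<^sub>v (A *\<^sub>v U j)) + W *\<^sub>v (D *\<^sub>v U j) = W *\<^sub>v (A *\<^sub>v (R j *\<^sub>v a))" for j
    proof -
      note Uj = U(1)[of j]
      have c: "A *\<^sub>v U j \<in> carrier_vec n" "Q *\<^sub>v U j \<in> carrier_vec n" "D *\<^sub>v U j \<in> carrier_vec n"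
        "Msym (\<eta> j) *\<^sub>v U j \<in> carrier_vec n" using A Q_carrier D mult_mat_vec_carrier[OF Msym_carrier Uj] Uj by auto
      have WQ: "W *\<^sub>v (Q *\<^sub>v U j) = 0\<^sub>v k'"
        unfolding Q_vec[OF Uj] using mat_mult_vec_eq[OF Wv W p(3), of "S *\<^sub>v (mat_adjoint pv *\<^sub>v U j)"] S vU[of j] by simp
      have "A *\<^sub>v (R j *\<^sub>v a) = s \<cdot>\<^sub>v (A *\<^sub>v U j) - (complex_of_real (\<eta> j) \<cdot>\<^sub>v (Q *\<^sub>v U j) - D *\<^sub>v U j)"
        unfolding U(2)[symmetric] A_Msym_vec[OF Uj, symmetric]
        using mult_mat_vec[OF A(1) Uj] Uj c by (subst mult_minus_distrib_mat_vec[OF A(1)]) auto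
      also have "W *\<^sub>v \<dots> = s \<cdot>\<^sub>v (W *\<^sub>v (A *\<^sub>v U j)) - (complex_of_real (\<eta> j) \<cdot>\<^sub>v 0\<^sub>v k' - W *\<^sub>v (D *\<^sub>v U j))"
        using mult_mat_vec[OF W c(1)] mult_mat_vec[OF W c(2)] c WQ
        by (simp add: mult_minus_distrib_mat_vec[OF W])
      finally show ?thesis using W c by (intro eq_vecI) (auto simp del: index_mult_mat_vec)
    qed
    have l1: "vlim k' (\<lambda>j. s \<cdot>\<^sub>v (W *\<^sub>v (A *\<^sub>v U (h j))) + W *\<^sub>v (D *\<^sub>v U (h j)))
        (s \<cdot>\<^sub>v (W *\<^sub>v (A *\<^sub>v u)) + W *\<^sub>v (D *\<^sub>v u))"
      by (intro vlim_add vlim_smult vlim_mult_mat_vec[OF W] vlim_mult_mat_vec[OF A(1)] vlim_mult_mat_vec[OF D] h(2))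
    have "vlim k' (\<lambda>j. W *\<^sub>v (A *\<^sub>v (R (h j) *\<^sub>v a))) (W *\<^sub>v (A *\<^sub>v e))"
      by (intro vlim_mult_mat_vec[OF W] vlim_mult_mat_vec[OF A(1)] vlim_subseq[OF e h(1)])
    from vlim_unique[OF l1[unfolded eq] this] show ?thesis .
  qed
  let ?y = "mat_adjoint p1 *\<^sub>v u"
  have "s \<cdot>\<^sub>v ?y - M1 *\<^sub>v ?y = g"
    using slow_equation[OF u uv g(1)] lim[OF pa(1) gram(3)] lim[OF pa(2) gram(6)] g(2) e0 by simp
  moreover have "sqn ?y \<le> sqn u"
  proof -
    have y: "?y \<in> carrier_vec m" using pa u by auto
    define w where "w = u - p1 *\<^sub>v ?y"
    have w: "w \<in> carrier_vec n" unfolding w_def using u p y by auto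
    have pw: "mat_adjoint p1 *\<^sub>v w = 0\<^sub>v m"
      unfolding w_def using mat_mult_vec_eq[OF gram(1) pa(1) p(1) y] u p y
      by (subst mult_minus_distrib_mat_vec[OF pa(1)]) auto
    have uw: "u = p1 *\<^sub>v ?y + w" unfolding w_def using u p y by (intro eq_vecI) (auto simp del: index_mult_mat_vec)
    have py: "p1 *\<^sub>v ?y \<in> carrier_vec n" using p y by auto
    have o: "(p1 *\<^sub>v ?y) \<bullet>c w = 0" using inner_adjoint[OF p(1) y w] pw y by simp
    then have o': "w \<bullet>c (p1 *\<^sub>v ?y) = 0" using inner_commute[OF py w] by simp
    have "u \<bullet>c u = (p1 *\<^sub>v ?y) \<bullet>c (p1 *\<^sub>v ?y) + w \<bullet>c w"
      by (subst (1 2) uw) (use py w o o' in \<open>simp add: inner_simps[of _ n]\<close>)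
    then have "sqn u = sqn (p1 *\<^sub>v ?y) + sqn w" unfolding inner_self by (metis of_real_add of_real_eq_iff)
    moreover have "sqn (p1 *\<^sub>v ?y) = sqn ?y" using isometry_sqn[OF p(1) gram(1) y] .
    ultimately show ?thesis using sqn_nonneg[of w] by linarith
  qed
  ultimately show "\<exists>y\<in>carrier_vec (dim_row M1). s \<cdot>\<^sub>v y - M1 *\<^sub>v y = g \<and> sqn y \<le> CA / (4 * \<gamma>) / Re s"
    using ub pa u M1(1) by (intro bexI[of _ ?y]) auto
qed

end


text \<open>\<open>A G\<close> is orthogonal to \<open>p1\<close> and \<open>p0\<close>, and
  \<open>p0\<close> is null for \<open>A\<close> and \<open>A\<close>-orthogonal to
  \<open>p1\<close>; hence the form decouples and \<open>z\<close> contributes nothing. The vectors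
  \<open>y\<close> and \<open>w\<close> can be read off from \<open>e\<close> through the injective
  \<open>L\<close> and \<open>Th\<close>, which makes the three-term sum direct.\<close>

lemma ansatz:
  assumes y: "y \<in> carrier_vec m" and z: "z \<in> carrier_vec l" and w: "w \<in> carrier_vec q"
  defines "e \<equiv> p1 *\<^sub>v y + (p0 *\<^sub>v z + G *\<^sub>v w)"
  shows "e \<in> carrier_vec n" "mat_adjoint p1 *\<^sub>v (A *\<^sub>v e) = L *\<^sub>v y" "mat_adjoint p0 *\<^sub>v (A *\<^sub>v e) = 0\<^sub>v l"
    "mat_adjoint pv *\<^sub>v e = Th *\<^sub>v w" "qf A e = qf L y + qf A (G *\<^sub>v w)"
proof -
  let ?y = "p1 *\<^sub>v y" and ?z = "p0 *\<^sub>v z" and ?w = "G *\<^sub>v w"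
  have c: "?y \<in> carrier_vec n" "?z \<in> carrier_vec n" "?w \<in> carrier_vec n" using p G y z w by auto
  then have Ac: "A *\<^sub>v ?y \<in> carrier_vec n" "A *\<^sub>v ?z \<in> carrier_vec n" "A *\<^sub>v ?w \<in> carrier_vec n" using A by auto
  show e: "e \<in> carrier_vec n" unfolding e_def using c by auto
  have Ae: "A *\<^sub>v e = A *\<^sub>v ?y + (A *\<^sub>v ?z + A *\<^sub>v ?w)"
    unfolding e_def using c by (simp add: mult_add_distrib_mat_vec[OF A(1)])
  have Aec: "A *\<^sub>v e \<in> carrier_vec n" using A e by auto
  have split1: "W *\<^sub>v (A *\<^sub>v e) = W *\<^sub>v (A *\<^sub>v ?y) + (W *\<^sub>v (A *\<^sub>v ?z) + W *\<^sub>v (A *\<^sub>v ?w))"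
    if "W \<in> carrier_mat k n" for W k
    unfolding Ae using Ac by (simp add: mult_add_distrib_mat_vec[OF that])
  have split2: "W *\<^sub>v e = W *\<^sub>v ?y + (W *\<^sub>v ?z + W *\<^sub>v ?w)" if "W \<in> carrier_mat k n" for W k
    unfolding e_def using c by (simp add: mult_add_distrib_mat_vec[OF that])
  show 1: "mat_adjoint p1 *\<^sub>v (A *\<^sub>v e) = L *\<^sub>v y"
    unfolding split1[OF pa(1)] mat_mult3_vec_eq[OF LA(1) pa(1) A(1) p(1) y]
      mat_mult3_vec_eq[OF LA(2) pa(1) A(1) p(2) z] mat_mult3_vec_eq[OF G(5) pa(1) A(1) G(1) w]
    using L y z w by simp
  show 0: "mat_adjoint p0 *\<^sub>v (A *\<^sub>v e) = 0\<^sub>v l"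
    unfolding split1[OF pa(2)] mat_mult3_vec_eq[OF LA(3) pa(2) A(1) p(1) y]
      mat_mult3_vec_eq[OF LA(4) pa(2) A(1) p(2) z] mat_mult3_vec_eq[OF G(6) pa(2) A(1) G(1) w]
    using y z w by simp
  show "mat_adjoint pv *\<^sub>v e = Th *\<^sub>v w"
    unfolding split2[OF pa(3)] mat_mult_vec_eq[OF gram(7) pa(3) p(1) y]
      mat_mult_vec_eq[OF gram(8) pa(3) p(2) z] mat_mult_vec_eq[OF G(4) pa(3) G(1) w]
    using G y z w by simp
  have e1: "(A *\<^sub>v e) \<bullet>c ?y = (L *\<^sub>v y) \<bullet>c y" using inner_adjoint[OF pa(1) Aec y] 1 by simp
  have e2: "(A *\<^sub>v e) \<bullet>c ?z = 0" using inner_adjoint[OF pa(2) Aec z] 0 z by simp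
  have w1: "(A *\<^sub>v ?w) \<bullet>c ?y = 0"
    using inner_adjoint[OF pa(1) Ac(3) y] mat_mult3_vec_eq[OF G(5) pa(1) A(1) G(1) w] y w by simp
  have w0: "(A *\<^sub>v ?w) \<bullet>c ?z = 0"
    using inner_adjoint[OF pa(2) Ac(3) z] mat_mult3_vec_eq[OF G(6) pa(2) A(1) G(1) w] z w by simp
  have "(A *\<^sub>v ?w) \<bullet>c e = (A *\<^sub>v ?w) \<bullet>c ?w"
    unfolding e_def using w1 w0 c Ac by (simp add: inner_add_right[of _ n])
  moreover have "(A *\<^sub>v e) \<bullet>c ?w = cnj ((A *\<^sub>v ?w) \<bullet>c e)"
    using hermitian_inner[OF A e c(3)] inner_commute[OF Ac(3) e] by simp
  ultimately have e3: "Re ((A *\<^sub>v e) \<bullet>c ?w) = qf A ?w" unfolding qf_def by simp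
  have "(A *\<^sub>v e) \<bullet>c e = (A *\<^sub>v e) \<bullet>c ?y + ((A *\<^sub>v e) \<bullet>c ?z + (A *\<^sub>v e) \<bullet>c ?w)"
    by (subst (2) e_def) (use c Aec in \<open>simp add: inner_add_right[of _ n]\<close>)
  then show "qf A e = qf L y + qf A ?w" unfolding e1 e2 using e3 by (simp add: qf_def)
qed

lemma ansatz_eq_0:
  assumes y: "y \<in> carrier_vec m" and z: "z \<in> carrier_vec l" and w: "w \<in> carrier_vec q"
    and e0: "p1 *\<^sub>v y + (p0 *\<^sub>v z + G *\<^sub>v w) = 0\<^sub>v n"
  shows "y = 0\<^sub>v m" "z = 0\<^sub>v l" "w = 0\<^sub>v q"
proof -
  note an = ansatz[OF y z w, unfolded e0]
  have "A *\<^sub>v 0\<^sub>v n = 0\<^sub>v n" using A by auto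
  moreover have "mat_adjoint p1 *\<^sub>v 0\<^sub>v n = 0\<^sub>v m" using p by (intro eq_vecI) auto
  moreover have "mat_adjoint pv *\<^sub>v 0\<^sub>v n = 0\<^sub>v r" using p by (intro eq_vecI) auto
  ultimately have "L *\<^sub>v y = 0\<^sub>v m" "Th *\<^sub>v w = 0\<^sub>v r" using an(2,4) by auto
  then show y0: "y = 0\<^sub>v m" and w0: "w = 0\<^sub>v q"
    using inj_matD[OF L(3,1) y] inj_matD[OF G(3,2) w] by auto
  have "p1 *\<^sub>v y = 0\<^sub>v n" unfolding y0 using p(1) by (intro eq_vecI) auto
  moreover have "G *\<^sub>v w = 0\<^sub>v n" unfolding w0 using G(1) by (intro eq_vecI) auto
  ultimately have "p0 *\<^sub>v z = 0\<^sub>v n" using e0 p(2) z by simp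
  then have "mat_adjoint p0 *\<^sub>v (p0 *\<^sub>v z) = 0\<^sub>v l" using p(2) by (simp, intro eq_vecI) auto
  then show "z = 0\<^sub>v l" using mat_mult_vec_eq[OF gram(5) pa(2) p(2) z] z by simp
qed

lemma M1_neg:
  assumes x: "x \<in> carrier_vec m" "x \<noteq> 0\<^sub>v m"
  shows "qf (L * M1) x < 0"
proof -
  have "0 < \<gamma> * sqn x" using \<gamma>(1) sqn_pos[OF x] by simp
  then show ?thesis using qf_L_M1[OF x(1)] by simp
qed

text \<open>The conclusion carries the same \<open>c\<close> as the assumption, so neither a rate of
  convergence nor the frequency enters the bound.\<close>

lemma limit_subspace:
  assumes B: "B \<in> carrier_mat b n" and np: "np = num_stable_eigenvalues (- A)"
    and gkc: "\<And>\<eta>. 0 \<le> \<eta> \<Longrightarrow> \<exists>R X. R \<in> carrier_mat n np \<and> stable_frame (Msym \<eta>) R X \<and>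
      mat_adjoint R * R = 1\<^sub>m np \<and> (\<forall>a \<in> carrier_vec np. c * sqn (R *\<^sub>v a) \<le> sqn (B *\<^sub>v (R *\<^sub>v a)))"
  shows "num_stable_eigenvalues M1 + (l + q) = np"
    and "y \<in> carrier_vec m \<Longrightarrow> hardy M1 y \<Longrightarrow> z \<in> carrier_vec l \<Longrightarrow> w \<in> carrier_vec q \<Longrightarrow>
      c * sqn (p1 *\<^sub>v y + (p0 *\<^sub>v z + G *\<^sub>v w)) \<le> sqn (B *\<^sub>v (p1 *\<^sub>v y + (p0 *\<^sub>v z + G *\<^sub>v w)))"
proof -
  define k where "k = num_stable_eigenvalues M1"
  obtain RY XY where RY: "RY \<in> carrier_mat m k" "stable_frame M1 RY XY"
    "\<And>g. g \<in> carrier_vec m \<Longrightarrow> hardy M1 g \<Longrightarrow> \<exists>a \<in> carrier_vec k. g = RY *\<^sub>v a" "k \<le> m"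
    by (rule stable_frame_exists[OF M1(1), folded k_def], rule that; blast)
  note fY = stable_frameD[OF RY(2) M1(1) RY(1)]
  have iA: "inj_mat A" by (rule left_inverse_inj_mat[OF A(1) J(1,2)])
  \<comment> \<open>Candidate for the limit space: stable vectors of \<open>M1\<close>, null
    directions of \<open>p0\<close>, and fast modes.\<close>
  define E where "E = append_cols (p1 * RY) (append_cols p0 G)"
  have pR: "p1 * RY \<in> carrier_mat n k" using p RY by auto
  have E: "E \<in> carrier_mat n (k + (l + q))"
    unfolding E_def using pR p G by auto
  have Evec: "E *\<^sub>v (a @\<^sub>v (z @\<^sub>v w)) = p1 *\<^sub>v (RY *\<^sub>v a) + (p0 *\<^sub>v z + G *\<^sub>v w)"
    if "a \<in> carrier_vec k" "z \<in> carrier_vec l" "w \<in> carrier_vec q" for a z w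
    unfolding E_def
    using append_cols_mult_vec[OF pR append_cols_carrier[OF p(2) G(1)] that(1), of "z @\<^sub>v w"]
      append_cols_mult_vec[OF p(2) G(1) that(2,3)] that assoc_mult_mat_vec[OF p(1) RY(1) that(1)] by simp
  have Esplit: "\<exists>a z w. a \<in> carrier_vec k \<and> z \<in> carrier_vec l \<and> w \<in> carrier_vec q \<and> x = a @\<^sub>v (z @\<^sub>v w)"
    if x: "x \<in> carrier_vec (k + (l + q))" for x :: "complex vec"
  proof -
    let ?x = "vec_last x (l + q)"
    have "x = vec_first x k @\<^sub>v ?x" using x by simp
    moreover have "?x = vec_first ?x l @\<^sub>v vec_last ?x q" by simp
    ultimately show ?thesis
      by (intro exI[of _ "vec_first x k"] exI[of _ "vec_first ?x l"] exI[of _ "vec_last ?x q"]) auto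
  qed
  have iE: "inj_mat E"
  proof (rule inj_matI[OF E])
    fix x assume "x \<in> carrier_vec (k + (l + q))" and z0: "E *\<^sub>v x = 0\<^sub>v n"
    with Esplit obtain a z w where x: "a \<in> carrier_vec k" "z \<in> carrier_vec l" "w \<in> carrier_vec q"
      "x = a @\<^sub>v (z @\<^sub>v w)" by blast
    have Ra: "RY *\<^sub>v a \<in> carrier_vec m" using RY x by auto
    from ansatz_eq_0[OF Ra x(2,3)] z0 have "RY *\<^sub>v a = 0\<^sub>v m" "z = 0\<^sub>v l" "w = 0\<^sub>v q"
      unfolding x(4) Evec[OF x(1-3)] by auto
    with inj_matD[OF fY(4) RY(1) x(1)] show "x = 0\<^sub>v (k + (l + q))" unfolding x(4) by auto
  qed
  have "0 \<le> qf A (E *\<^sub>v x)" if "x \<in> carrier_vec (k + (l + q))" for x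
  proof -
    from Esplit[OF that] obtain a z w where x: "a \<in> carrier_vec k" "z \<in> carrier_vec l" "w \<in> carrier_vec q"
      "x = a @\<^sub>v (z @\<^sub>v w)" by blast
    have Ra: "RY *\<^sub>v a \<in> carrier_vec m" using RY x by auto
    have "0 \<le> qf L (RY *\<^sub>v a)"
    proof (cases "a = 0\<^sub>v k")
      case True
      then have "RY *\<^sub>v a = 0\<^sub>v m" using RY by auto
      then show ?thesis unfolding qf_def using L by simp
    next
      case False
      from stable_frame_positive[OF L(1,2) M1(1) M1_neg RY(1,2) x(1) False] show ?thesis by simp
    qed
    then show ?thesis unfolding x(4) Evec[OF x(1-3)] ansatz(5)[OF Ra x(2,3)] using G(7)[OF x(3)] by simp
  qed
  from psd_dim_bound[OF A iA E iE this] have le1: "k + (l + q) + num_stable_eigenvalues A \<le> n" .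
  have npA: "num_stable_eigenvalues A + np = n"
    unfolding np
  proof (rule num_stable_eigenvalues_uminus[OF A(1)])
    fix z assume ev: "eigenvalue A z"
    show "Re z \<noteq> 0"
    proof
      assume "Re z = 0"
      with hermitian_eigenvalue_real[OF A ev] have "z = 0" by (simp add: complex_eq_iff)
      with ev obtain x where x: "x \<in> carrier_vec n" "x \<noteq> 0\<^sub>v n" "A *\<^sub>v x = 0 \<cdot>\<^sub>v x"
        unfolding eigenvalue_def eigenvector_def using A by auto
      have "0 \<cdot>\<^sub>v x = 0\<^sub>v n" using x by (intro eq_vecI) auto
      with inj_matD[OF iA A(1) x(1)] x show False by simp
    qed
  qed
  define \<eta> where "\<eta> j = real j + 1" for j :: nat
  have \<eta>: "0 < \<eta> j" for j unfolding \<eta>_def by simp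
  have "\<forall>j. \<exists>R X. R \<in> carrier_mat n np \<and> stable_frame (Msym (\<eta> j)) R X \<and>
      mat_adjoint R * R = 1\<^sub>m np \<and> (\<forall>a \<in> carrier_vec np. c * sqn (R *\<^sub>v a) \<le> sqn (B *\<^sub>v (R *\<^sub>v a)))"
    using gkc \<eta> less_imp_le by blast
  then obtain R X where R: "\<And>j. R j \<in> carrier_mat n np" "\<And>j. stable_frame (Msym (\<eta> j)) (R j) (X j)"
    "\<And>j. mat_adjoint (R j) * R j = 1\<^sub>m np"
    "\<And>j a. a \<in> carrier_vec np \<Longrightarrow> c * sqn (R j *\<^sub>v a) \<le> sqn (B *\<^sub>v (R j *\<^sub>v a))" by metis
  obtain h F where h: "strict_mono h" and F: "F \<in> carrier_mat n np"
    "\<And>a. a \<in> carrier_vec np \<Longrightarrow> vlim n (\<lambda>j. R (h j) *\<^sub>v a) (F *\<^sub>v a)"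
    "\<And>a. a \<in> carrier_vec np \<Longrightarrow> sqn (F *\<^sub>v a) = sqn a"
  proof (rule isometry_convergent_subseq[OF R(1,3)])
    fix h F assume "strict_mono h" "F \<in> carrier_mat n np"
      "\<And>a. a \<in> carrier_vec np \<Longrightarrow> vlim n (\<lambda>j. R (h j) *\<^sub>v a) (F *\<^sub>v a)"
      "\<And>a. a \<in> carrier_vec np \<Longrightarrow> sqn (F *\<^sub>v a) = sqn a"
    then show thesis by (rule that)
  qed
  have \<eta>h: "filterlim (\<lambda>j. \<eta> (h j)) at_top sequentially"
  proof -
    have "filterlim (\<lambda>j. real (h j) + 1) at_top sequentially"
      using filterlim_compose[OF filterlim_real_sequentially filterlim_subseq[OF h]]
      by (rule filterlim_at_top_mono) auto
    then show ?thesis unfolding \<eta>_def .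
  qed
  have iF: "inj_mat F"
  proof (rule inj_matI[OF F(1)])
    fix a assume a: "a \<in> carrier_vec np" and "F *\<^sub>v a = 0\<^sub>v n"
    then have "sqn a = 0" using F(3)[OF a] by simp
    then show "a = 0\<^sub>v np" using sqn_eq_0[OF a] by simp
  qed
  obtain CA where CA: "0 < CA" "\<And>x. x \<in> carrier_vec n \<Longrightarrow> \<bar>qf A x\<bar> \<le> CA * sqn x" using qf_bounded[OF A(1)] by blast
  have sub: "\<exists>x \<in> carrier_vec (k + (l + q)). F *\<^sub>v a = E *\<^sub>v x" if a: "a \<in> carrier_vec np" for a
  proof -
    let ?e = "F *\<^sub>v a"
    have e: "?e \<in> carrier_vec n" using F a by auto
    have bd: "qf A (R (h j) *\<^sub>v a) \<le> CA * sqn a" for j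
      using CA(2)[of "R (h j) *\<^sub>v a"] isometry_sqn[OF R(1,3) a, of "h j"] mult_mat_vec_carrier[OF R(1) a, of "h j"] by simp
    have CA0: "0 \<le> CA * sqn a" using CA(1) by simp
    have ve: "mat_adjoint pv *\<^sub>v ?e \<in> carrier_vec r" using pa e by auto
    obtain w where w: "w \<in> carrier_vec q" "mat_adjoint pv *\<^sub>v ?e = Th *\<^sub>v w"
      using Z(3)[OF ve limit_fast[of "\<lambda>j. \<eta> (h j)", OF \<eta> \<eta>h R(1) R(2) a F(2)[OF a] CA0 bd]] by blast
    have Gw: "G *\<^sub>v w \<in> carrier_vec n" using G w by auto
    \<comment> \<open>Removing the fast mode with the same \<open>pv\<close> part leaves a vector in
      the span of \<open>p1\<close> and \<open>p0\<close>.\<close>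
    define e' where "e' = ?e - G *\<^sub>v w"
    have e': "e' \<in> carrier_vec n" unfolding e'_def using e Gw by auto
    have e'v: "mat_adjoint pv *\<^sub>v e' = 0\<^sub>v r"
      unfolding e'_def mult_minus_distrib_mat_vec[OF pa(3) e Gw] w(2)
        mat_mult_vec_eq[OF G(4) pa(3) G(1) w(1)] using G w by auto
    let ?y = "mat_adjoint p1 *\<^sub>v e'" and ?z = "mat_adjoint p0 *\<^sub>v e'"
    have y: "?y \<in> carrier_vec m" and z: "?z \<in> carrier_vec l" using pa e' by auto
    have pz: "pv *\<^sub>v 0\<^sub>v r = 0\<^sub>v n" using p by auto
    have "e' = p1 *\<^sub>v ?y + p0 *\<^sub>v ?z" using complete[OF e'] unfolding e'v pz using p z by simp
    then have ee: "?e = p1 *\<^sub>v ?y + (p0 *\<^sub>v ?z + G *\<^sub>v w)"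
    proof -
      assume e'eq: "e' = p1 *\<^sub>v ?y + p0 *\<^sub>v ?z"
      have "?e = e' + G *\<^sub>v w" unfolding e'_def using e Gw F(1) G(1)
        by (intro eq_vecI) (auto simp del: index_mult_mat_vec)
      also have "\<dots> = (p1 *\<^sub>v ?y + p0 *\<^sub>v ?z) + G *\<^sub>v w" using e'eq by simp
      also have "\<dots> = p1 *\<^sub>v ?y + (p0 *\<^sub>v ?z + G *\<^sub>v w)"
        using p y z Gw by (intro assoc_add_vec[of _ n]) auto
      finally show ?thesis .
    qed
    note an = ansatz[OF y z w(1), folded ee]
    have "hardy M1 ?y"
      using limit_slow[of "\<lambda>j. \<eta> (h j)", OF \<eta> \<eta>h R(1) R(2) a F(2)[OF a] CA0 bd y an(2,3)] .
    from RY(3)[OF y this] obtain a' where a': "a' \<in> carrier_vec k" "?y = RY *\<^sub>v a'" by blast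
    show ?thesis
      using Evec[OF a'(1) z w(1)] ee a' z w by (intro bexI[of _ "a' @\<^sub>v (?z @\<^sub>v w)"]) auto
  qed
  obtain Kf where Kf: "Kf \<in> carrier_mat (k + (l + q)) np" "F = E * Kf"
    using columns_in_range_factor[OF F(1) E sub] by blast
  \<comment> \<open>\<open>F\<close> keeps \<open>np\<close> independent directions and factors
    through \<open>E\<close>, which gives the inequality opposite to \<open>le1\<close>.
    \<open>Kf\<close> is then square and invertible, so every vector in the range of
    \<open>E\<close> is a limit vector.\<close>
  have iK: "inj_mat Kf" using inj_mat_left_factor[OF E Kf(1)] iF Kf(2) by simp
  from inj_mat_le[OF Kf(1) iK] le1 npA have dim: "k + (l + q) = np" by linarith
  then show "num_stable_eigenvalues M1 + (l + q) = np" unfolding k_def .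
  obtain Ki where Ki: "Ki \<in> carrier_mat np np" "Kf * Ki = 1\<^sub>m np"
    using inj_mat_obtain_inverse[of Kf np] Kf(1) iK unfolding dim by blast
  have FB: "c * sqn (F *\<^sub>v a) \<le> sqn (B *\<^sub>v (F *\<^sub>v a))" if a: "a \<in> carrier_vec np" for a
  proof (rule LIMSEQ_le)
    show "(\<lambda>j. c * sqn (R (h j) *\<^sub>v a)) \<longlonglongrightarrow> c * sqn (F *\<^sub>v a)"
      by (intro tendsto_mult tendsto_const vlim_sqn[OF F(2)[OF a]])
    show "(\<lambda>j. sqn (B *\<^sub>v (R (h j) *\<^sub>v a))) \<longlonglongrightarrow> sqn (B *\<^sub>v (F *\<^sub>v a))"
      by (intro vlim_sqn[OF vlim_mult_mat_vec[OF B F(2)[OF a]]])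
    show "\<exists>N. \<forall>j\<ge>N. c * sqn (R (h j) *\<^sub>v a) \<le> sqn (B *\<^sub>v (R (h j) *\<^sub>v a))" using R(4)[OF a] by blast
  qed
  assume y: "y \<in> carrier_vec m" "hardy M1 y" and z: "z \<in> carrier_vec l" and w: "w \<in> carrier_vec q"
  from RY(3)[OF y] obtain a where a: "a \<in> carrier_vec k" "y = RY *\<^sub>v a" by blast
  let ?x = "a @\<^sub>v (z @\<^sub>v w)"
  have x: "?x \<in> carrier_vec np" using a z w dim by (metis append_carrier_vec)
  have "F *\<^sub>v (Ki *\<^sub>v ?x) = E *\<^sub>v (Kf *\<^sub>v (Ki *\<^sub>v ?x))"
    unfolding Kf(2) using E Kf(1) Ki(1) x by (intro assoc_mult_mat_vec) auto
  also have "Kf *\<^sub>v (Ki *\<^sub>v ?x) = ?x"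
    using mat_mult_vec_eq[OF Ki(2) _ Ki(1) x, of np] Kf(1) x dim by simp
  also have "E *\<^sub>v ?x = p1 *\<^sub>v y + (p0 *\<^sub>v z + G *\<^sub>v w)" unfolding Evec[OF a(1) z w] a(2) ..
  finally show "c * sqn (p1 *\<^sub>v y + (p0 *\<^sub>v z + G *\<^sub>v w)) \<le> sqn (B *\<^sub>v (p1 *\<^sub>v y + (p0 *\<^sub>v z + G *\<^sub>v w)))"
    using FB[of "Ki *\<^sub>v ?x"] Ki x by simp
qed

end

text \<open>Completing \<open>D\<close> to an invertible matrix and cutting the inverse into rows
  gives \<open>El\<close>, whose rows span the left annihilator of \<open>D\<close>. For
  \<open>D = B (P_0, G)\<close> this \<open>El\<close> is the boundary matrix B_o, and its right
  inverse \<open>E\<close> certifies full rank.\<close>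

lemma inj_mat_complement_inverse:
  fixes D :: "'a :: field mat"
  assumes D: "D \<in> carrier_mat n m" and i: "inj_mat D"
  obtains E Dl El where "E \<in> carrier_mat n (n - m)" "Dl \<in> carrier_mat m n" "El \<in> carrier_mat (n - m) n"
    "El * D = 0\<^sub>m (n - m) m" "El * E = 1\<^sub>m (n - m)" "D * Dl + E * El = 1\<^sub>m n"
proof -
  obtain E where E: "E \<in> carrier_mat n (n - m)" "inj_mat (append_cols D E)"
    using inj_mat_complement[OF D i] by blast
  have mn: "m + (n - m) = n" using inj_mat_le[OF D i] by simp
  have DE: "append_cols D E \<in> carrier_mat n n" using append_cols_carrier[OF D E(1)] unfolding mn .
  obtain V where V: "V \<in> carrier_mat n n" "append_cols D E * V = 1\<^sub>m n" "V * append_cols D E = 1\<^sub>m n"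
    using inj_mat_obtain_inverse[OF DE E(2)] by blast
  define Dl where "Dl = mat m n (\<lambda>(i,j). V $$ (i,j))"
  define El where "El = mat (n - m) n (\<lambda>(i,j). V $$ (i + m,j))"
  have c: "Dl \<in> carrier_mat m n" "El \<in> carrier_mat (n - m) n" unfolding Dl_def El_def by auto
  have Vs: "V = Dl @\<^sub>r El"
    unfolding append_rows_def Dl_def El_def using V(1) mn by (intro eq_matI) auto
  have "D * Dl + E * El = 1\<^sub>m n" using append_cols_mult_right[OF D E(1) c] V(2) unfolding Vs by simp
  moreover have "El * D = 0\<^sub>m (n - m) m"
  proof (rule eq_matI)
    fix i j assume "i < dim_row (0\<^sub>m (n - m) m)" "j < dim_col (0\<^sub>m (n - m) m)"
    then have ij: "i < n - m" "j < m" by auto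
    have "(El * D) $$ (i,j) = (V * append_cols D E) $$ (i + m, j)"
      using ij c D E V(1) mn unfolding El_def append_cols_def by (auto simp: scalar_prod_def)
    also have "\<dots> = 1\<^sub>m n $$ (i + m, j)" unfolding V(3) ..
    finally show "(El * D) $$ (i,j) = 0\<^sub>m (n - m) m $$ (i,j)" using ij by simp
  qed (use c D in auto)
  moreover have "El * E = 1\<^sub>m (n - m)"
  proof (rule eq_matI)
    fix i j assume "i < dim_row (1\<^sub>m (n - m))" "j < dim_col (1\<^sub>m (n - m))"
    then have ij: "i < n - m" "j < n - m" by auto
    have "(El * E) $$ (i,j) = (V * append_cols D E) $$ (i + m, j + m)"
      using ij c D E V(1) mn unfolding El_def append_cols_def by (auto simp: scalar_prod_def)
    also have "\<dots> = 1\<^sub>m n $$ (i + m, j + m)" unfolding V(3) ..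
    finally show "(El * E) $$ (i,j) = 1\<^sub>m (n - m) $$ (i,j)" using ij by simp
  qed (use c E in auto)
  ultimately show thesis using that E(1) c by blast
qed

section \<open>The block structure of the data\<close>

text \<open>\<open>minv\<close> unwraps an optional result, so the matrix is first shown to be a
  unit of the matrix ring; the computation then succeeds, and uniqueness of inverses identifies its
  value.\<close>

lemma minv_eqI:
  fixes M :: "'a :: field mat"
  assumes M: "M \<in> carrier_mat n n" and N: "N \<in> carrier_mat n n" and NM: "N * M = 1\<^sub>m n"
  shows "minv M = N"
proof -
  have MN: "M * N = 1\<^sub>m n" using mat_mult_left_right_inverse[OF N M NM] .
  have "M \<in> Units (ring_mat TYPE('a) n ())"
    unfolding Units_def using M N NM MN by (auto simp: ring_mat_simps)
  with mat_inverse(1)[OF M, where b = "()"] obtain V where V: "mat_inverse M = Some V"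
    by (cases "mat_inverse M") auto
  from mat_inverse(2)[OF M V] have V': "M * V = 1\<^sub>m n" "V \<in> carrier_mat n n" by auto
  have "V = (N * M) * V" unfolding NM using V' by simp
  also have "\<dots> = N * (M * V)" using N M V' by (intro assoc_mult_mat) auto
  also have "\<dots> = N" unfolding V'(1) using N by simp
  finally show ?thesis unfolding minv_def V by simp
qed

lemma invertible_mat_obtain_inverse:
  fixes M :: "'a :: field mat"
  assumes M: "M \<in> carrier_mat n n" and i: "invertible_mat M"
  obtains N where "N \<in> carrier_mat n n" "M * N = 1\<^sub>m n" "N * M = 1\<^sub>m n"
proof -
  from i obtain N where N: "M * N = 1\<^sub>m (dim_row M)" "N * M = 1\<^sub>m (dim_row N)"
    unfolding invertible_mat_def inverts_mat_def by auto
  have "dim_col N = n" using arg_cong[OF N(1), of dim_col] M by simp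
  moreover have "dim_row N = n" using arg_cong[OF N(2), of dim_col] M by simp
  ultimately show thesis using that[of N] N M by auto
qed

lemma transpose_append_cols_mult:
  fixes X :: "real mat"
  assumes "X \<in> carrier_mat n a" "Y \<in> carrier_mat n b" "U \<in> carrier_mat n c" "V \<in> carrier_mat n d"
  shows "transpose_mat (append_cols X Y) * append_cols U V =
    four_block_mat (transpose_mat X * U) (transpose_mat X * V) (transpose_mat Y * U) (transpose_mat Y * V)"
  using assms unfolding append_cols_def by (intro eq_matI) (auto simp: scalar_prod_def)

lemma four_block_mat_eqD:
  assumes e: "four_block_mat A B C D = four_block_mat A' B' C' D'"
    and c: "A \<in> carrier_mat a b" "B \<in> carrier_mat a e" "C \<in> carrier_mat d b" "D \<in> carrier_mat d e"
    "A' \<in> carrier_mat a b" "B' \<in> carrier_mat a e" "C' \<in> carrier_mat d b" "D' \<in> carrier_mat d e"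
  shows "A = A'" "B = B'" "C = C'" "D = D'"
proof -
  have i: "four_block_mat A B C D $$ (i, j) = four_block_mat A' B' C' D' $$ (i, j)" for i j using e by simp
  show "A = A'" using c i by (intro eq_matI) (metis carrier_matD index_mat_four_block(1) trans_less_add1, auto)
  show "B = B'"
  proof (rule eq_matI)
    fix p q assume "p < dim_row B'" "q < dim_col B'"
    then show "B $$ (p,q) = B' $$ (p,q)" using i[of p "q + b"] c by auto
  qed (use c in auto)
  show "C = C'"
  proof (rule eq_matI)
    fix p q assume "p < dim_row C'" "q < dim_col C'"
    then show "C $$ (p,q) = C' $$ (p,q)" using i[of "p + a" q] c by auto
  qed (use c in auto)
  show "D = D'"
  proof (rule eq_matI)
    fix p q assume "p < dim_row D'" "q < dim_col D'"
    then show "D $$ (p,q) = D' $$ (p,q)" using i[of "p + a" "q + b"] c by auto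
  qed (use c in auto)
qed

lemma append_cols_mult_transpose:
  fixes X :: "real mat"
  assumes "X \<in> carrier_mat n a" "Y \<in> carrier_mat n b"
  shows "append_cols X Y * transpose_mat (append_cols X Y) = X * transpose_mat X + Y * transpose_mat Y"
proof -
  have "transpose_mat (append_cols X Y) = transpose_mat X @\<^sub>r transpose_mat Y"
    using assms unfolding append_cols_def append_rows_def by (intro eq_matI) auto
  then show ?thesis
    using append_cols_mult_right[OF assms, of "transpose_mat X" n "transpose_mat Y"] assms by auto
qed

text \<open>Coordinate inclusions, so that extracting a block becomes multiplication. The arguments
  of \<open>top_embed\<close> are the full dimension and the block size, those of
  \<open>bottom_embed\<close> the offset and the block size.\<close>

definition top_embed :: "nat \<Rightarrow> nat \<Rightarrow> 'a :: comm_ring_1 mat" where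
  "top_embed n k = mat n k (\<lambda>(i,j). if i = j then 1 else 0)"

definition bottom_embed :: "nat \<Rightarrow> nat \<Rightarrow> 'a :: comm_ring_1 mat" where
  "bottom_embed k r = mat (k + r) r (\<lambda>(i,j). if i = k + j then 1 else 0)"

lemma top_embed_carrier: "top_embed n k \<in> carrier_mat n k"
  unfolding top_embed_def by simp

lemma bottom_embed_carrier: "bottom_embed k r \<in> carrier_mat (k + r) r"
  unfolding bottom_embed_def by simp

lemma mult_top_embed:
  assumes "X \<in> carrier_mat a n" "k \<le> n"
  shows "X * top_embed n k = mat a k (\<lambda>(i,j). X $$ (i,j))"
  using assms unfolding top_embed_def
  by (intro eq_matI) (auto simp: scalar_prod_def if_distrib[of "\<lambda>x. _ * x"] sum.delta cong: if_cong)

lemma mult_bottom_embed: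
  assumes "X \<in> carrier_mat a (k + r)"
  shows "X * bottom_embed k r = mat a r (\<lambda>(i,j). X $$ (i,k + j))"
  using assms unfolding bottom_embed_def
  by (intro eq_matI) (auto simp: scalar_prod_def if_distrib[of "\<lambda>x. _ * x"] sum.delta cong: if_cong)

lemma transpose_top_embed_mult:
  assumes "X \<in> carrier_mat n a" "k \<le> n"
  shows "transpose_mat (top_embed n k) * X = mat k a (\<lambda>(i,j). X $$ (i,j))"
proof -
  have "transpose_mat (top_embed n k) * X = transpose_mat (transpose_mat X * top_embed n k)"
    using assms transpose_mult[of "transpose_mat X" a n "top_embed n k" k] by (simp add: top_embed_carrier)
  also have "\<dots> = mat k a (\<lambda>(i,j). X $$ (i,j))"
    using assms by (subst mult_top_embed[of _ a]) (auto intro!: eq_matI)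
  finally show ?thesis .
qed

lemma transpose_bottom_embed_mult:
  assumes "X \<in> carrier_mat (k + r) a"
  shows "transpose_mat (bottom_embed k r) * X = mat r a (\<lambda>(i,j). X $$ (k + i,j))"
proof -
  have "transpose_mat (bottom_embed k r) * X = transpose_mat (transpose_mat X * bottom_embed k r)"
    using assms transpose_mult[of "transpose_mat X" a "k + r" "bottom_embed k r" r] by (simp add: bottom_embed_carrier)
  also have "\<dots> = mat r a (\<lambda>(i,j). X $$ (k + i,j))"
    using assms by (subst mult_bottom_embed[of _ a]) (auto intro!: eq_matI)
  finally show ?thesis .
qed

lemma bottom_embed_mult:
  assumes "X \<in> carrier_mat r a"
  shows "bottom_embed k r * X = mat (k + r) a (\<lambda>(i,j). if i < k then 0 else X $$ (i - k,j))"
proof (rule eq_matI)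
  fix i j assume "i < dim_row (mat (k + r) a (\<lambda>(i,j). if i < k then 0 else X $$ (i - k,j)))"
    "j < dim_col (mat (k + r) a (\<lambda>(i,j). if i < k then 0 else X $$ (i - k,j)))"
  then have ij: "i < k + r" "j < a" by auto
  have e: "(bottom_embed k r * X) $$ (i,j) = (\<Sum>l<r. (if i = k + l then 1 else 0) * X $$ (l,j))"
    using ij assms by (simp add: bottom_embed_def scalar_prod_def atLeast0LessThan)
  show "(bottom_embed k r * X) $$ (i,j) = mat (k + r) a (\<lambda>(i,j). if i < k then 0 else X $$ (i - k,j)) $$ (i,j)"
  proof (cases "i < k")
    case True
    then show ?thesis unfolding e using ij by (auto intro!: sum.neutral)
  next
    case False
    have "(\<Sum>l<r. (if i = k + l then 1 else 0) * X $$ (l,j)) = (\<Sum>l<r. if i - k = l then X $$ (l,j) else 0)"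
      using False by (intro sum.cong) auto
    moreover have "i - k < r" using False ij by arith
    ultimately show ?thesis unfolding e using False ij by simp
  qed
qed (use assms in \<open>auto simp: bottom_embed_def\<close>)

lemma bottom_embed_sandwich:
  assumes S: "S \<in> carrier_mat r r"
  shows "bottom_embed k r * (S * transpose_mat (bottom_embed k r)) =
    four_block_mat (0\<^sub>m k k) (0\<^sub>m k r) (0\<^sub>m r k) S"
proof -
  have "S * transpose_mat (bottom_embed k r) = transpose_mat (bottom_embed k r * transpose_mat S)"
    using transpose_mult[OF bottom_embed_carrier[of k r], of "transpose_mat S" r] S by simp
  also have "\<dots> = transpose_mat (mat (k + r) r (\<lambda>(i,j). if i < k then 0 else transpose_mat S $$ (i - k,j)))"
    using S by (subst bottom_embed_mult[of _ r r]) auto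
  finally show ?thesis using S by (subst bottom_embed_mult[of _ r "k + r"]) (auto intro!: eq_matI)
qed

lemma embed_gram:
  "transpose_mat (top_embed (k + r) k) * top_embed (k + r) k = 1\<^sub>m k"
  "transpose_mat (top_embed (k + r) k) * bottom_embed k r = 0\<^sub>m k r"
  "transpose_mat (bottom_embed k r) * top_embed (k + r) k = 0\<^sub>m r k"
  "transpose_mat (bottom_embed k r) * bottom_embed k r = 1\<^sub>m r"
  by (subst transpose_top_embed_mult[of _ _ k] transpose_top_embed_mult[of _ _ r]
      transpose_bottom_embed_mult[of _ _ _ k] transpose_bottom_embed_mult[of _ _ _ r];
      auto simp: top_embed_def bottom_embed_def intro!: eq_matI)+

lemma embed_complete:
  "(top_embed (k + r) k :: real mat) * transpose_mat (top_embed (k + r) k) +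
   bottom_embed k r * transpose_mat (bottom_embed k r) = 1\<^sub>m (k + r)"
proof (rule eq_matI)
  fix i j assume "i < dim_row (1\<^sub>m (k + r) :: real mat)" "j < dim_col (1\<^sub>m (k + r) :: real mat)"
  then have ij: "i < k + r" "j < k + r" by auto
  have 1: "((top_embed (k + r) k :: real mat) * transpose_mat (top_embed (k + r) k)) $$ (i,j) =
      (\<Sum>l<k. (if i = l then 1 else 0) * (if j = l then 1 else 0))"
    using ij by (simp add: top_embed_def scalar_prod_def atLeast0LessThan)
  have "(\<Sum>l<k. (if i = l then 1 else 0) * (if j = l then 1 else (0::real))) = (if i = j \<and> i < k then 1 else 0)"
    by (subst sum.cong[OF refl, of _ _ "\<lambda>l. if i = l then (if i = j then 1 else 0) else 0"]) auto
  note 1 = 1[unfolded this]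
  have 2: "((bottom_embed k r :: real mat) * transpose_mat (bottom_embed k r)) $$ (i,j) =
      (\<Sum>l<r. (if i = k + l then 1 else 0) * (if j = k + l then 1 else 0))"
    using ij by (simp add: bottom_embed_def scalar_prod_def atLeast0LessThan)
  have "(\<Sum>l<r. (if i = k + l then 1 else 0) * (if j = k + l then 1 else (0::real))) = (if i = j \<and> \<not> i < k then 1 else 0)"
  proof (cases "i < k")
    case True
    then show ?thesis by (auto intro!: sum.neutral)
  next
    case False
    then have "(\<Sum>l<r. (if i = k + l then 1 else 0) * (if j = k + l then 1 else (0::real))) =
      (\<Sum>l<r. if i - k = l then (if i = j then 1 else 0) else 0)" by (intro sum.cong) auto
    moreover have "i - k < r" using False ij by arith
    then have "(\<Sum>l<r. if i - k = l then (if i = j then 1 else 0) else 0) = (if i = j then 1 else (0::real))" by simp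
    ultimately show ?thesis using False by simp
  qed
  note 2 = 2[unfolded this]
  show "((top_embed (k + r) k :: real mat) * transpose_mat (top_embed (k + r) k) +
      bottom_embed k r * transpose_mat (bottom_embed k r)) $$ (i,j) = 1\<^sub>m (k + r) $$ (i,j)"
    using ij 1 2
    by (simp add: carrier_matD[OF top_embed_carrier[of "k + r" k]] carrier_matD[OF bottom_embed_carrier[of k r]])
qed (auto simp: top_embed_def bottom_embed_def)

lemma mult_sandwich:
  fixes M :: "'a :: comm_ring_1 mat"
  assumes X: "X \<in> carrier_mat a k" and U: "U \<in> carrier_mat k n" and M: "M \<in> carrier_mat n n"
    and V: "V \<in> carrier_mat n h" and Y: "Y \<in> carrier_mat h b"
  shows "(X * U) * (M * (V * Y)) = X * ((U * (M * V)) * Y)"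
proof -
  have 1: "(X * U) * (M * (V * Y)) = X * (U * (M * (V * Y)))" using assms by (intro assoc_mult_mat) auto
  have 2: "M * (V * Y) = M * V * Y" using assms by (intro assoc_mult_mat[symmetric]) auto
  have 3: "U * (M * V * Y) = (U * (M * V)) * Y" using assms by (intro assoc_mult_mat[symmetric]) auto
  show ?thesis unfolding 1 unfolding 2 3 ..
qed

lemma uminus_mat_mult_vec:
  fixes M :: "complex mat"
  assumes "M \<in> carrier_mat m n" "x \<in> carrier_vec n"
  shows "- M *\<^sub>v x = (- 1) \<cdot>\<^sub>v (M *\<^sub>v x)"
  using assms by (intro eq_vecI) auto

lemma tangential_symbol_carrier: "tangential_symbol m d A w \<in> carrier_mat m m"
  unfolding tangential_symbol_def by simp

text \<open>The symbol is the imaginary unit times a real symmetric matrix, hence skew-Hermitian.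
  Only \<open>Re \<xi>\<close> survives in the energy, and no bound sees
  \<open>\<omega>\<close>.\<close>

lemma tangential_symbol_skew:
  assumes "\<And>j. j \<in> {2..d} \<Longrightarrow> A j \<in> carrier_mat m m" "\<And>j. j \<in> {2..d} \<Longrightarrow> transpose_mat (A j) = A j"
    and x: "x \<in> carrier_vec m"
  shows "Re ((tangential_symbol m d A w *\<^sub>v x) \<bullet>c x) = 0"
proof -
  let ?T = "tangential_symbol m d A w"
  have T: "?T \<in> carrier_mat m m" by (rule tangential_symbol_carrier)
  have s: "A j $$ (k,l) = A j $$ (l,k)" if "j \<in> {2..d}" "k < m" "l < m" for j k l
    using arg_cong[OF assms(2)[OF that(1)], of "\<lambda>M. M $$ (k,l)"] assms(1)[OF that(1)] that by simp
  have "mat_adjoint ?T = - ?T"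
  proof (rule eq_matI)
    fix k l assume "k < dim_row (- ?T)" "l < dim_col (- ?T)"
    then have kl: "k < m" "l < m" by (auto simp: tangential_symbol_def)
    then have "(\<Sum>j = 2..d. w j * (A j $$ (l, k))) = (\<Sum>j = 2..d. w j * (A j $$ (k, l)))"
      using s by (intro sum.cong) auto
    with kl show "mat_adjoint ?T $$ (k,l) = (- ?T) $$ (k,l)" by (simp add: tangential_symbol_def del: of_real_sum of_real_mult)
  qed (auto simp: tangential_symbol_def)
  then have "(?T *\<^sub>v x) \<bullet>c x = x \<bullet>c (- ?T *\<^sub>v x)" using inner_adjoint[OF T x x] by simp
  also have "- ?T *\<^sub>v x = (- 1) \<cdot>\<^sub>v (?T *\<^sub>v x)" by (rule uminus_mat_mult_vec[OF T x])
  also have "x \<bullet>c ((- 1) \<cdot>\<^sub>v (?T *\<^sub>v x)) = - cnj ((?T *\<^sub>v x) \<bullet>c x)"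
    using T x inner_commute[of "?T *\<^sub>v x" m x] by (simp add: inner_smult_right[of _ m])
  finally have "(?T *\<^sub>v x) \<bullet>c x = - cnj ((?T *\<^sub>v x) \<bullet>c x)" .
  from arg_cong[OF this, of Re] show ?thesis by simp
qed

lemma cmat_top_embed [simp]: "cmat (top_embed n k) = top_embed n k"
  unfolding top_embed_def by (intro eq_matI) auto

lemma hermitian_inner_real:
  assumes A: "A \<in> carrier_mat n n" and h: "mat_adjoint A = A" and x: "x \<in> carrier_vec n"
  shows "Im ((A *\<^sub>v x) \<bullet>c x) = 0"
proof -
  have Ax: "A *\<^sub>v x \<in> carrier_vec n" using A x by auto
  have "(A *\<^sub>v x) \<bullet>c x = cnj ((A *\<^sub>v x) \<bullet>c x)"
    using hermitian_inner[OF A h x x] inner_commute[OF Ax x] by simp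
  from arg_cong[OF this, of Im] show ?thesis by simp
qed

lemma smult_one_add_mult_vec:
  fixes M :: "complex mat"
  assumes "M \<in> carrier_mat k k" "x \<in> carrier_vec k"
  shows "(c \<cdot>\<^sub>m 1\<^sub>m k + M) *\<^sub>v x = c \<cdot>\<^sub>v x + M *\<^sub>v x"
  using shifted_mult_vec(2)[OF assms] .

text \<open>The data of the theorem with \<open>k = n - r\<close>, \<open>m = n - r - n\<^sub>1\<^sup>o\<close>, \<open>l = n\<^sub>1\<^sup>o\<close>.\<close>

locale relaxation_system =
  fixes k r m l d np :: nat and A A11 :: "nat \<Rightarrow> real mat" and S P1 P0 L1 Jr Q B Bu :: "real mat"
  assumes d: "1 \<le> d"
    and A: "\<And>j. j \<in> {1..d} \<Longrightarrow> A j \<in> carrier_mat (k + r) (k + r)"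
      "\<And>j. j \<in> {1..d} \<Longrightarrow> transpose_mat (A j) = A j"
    and A11: "\<And>j. j \<in> {1..d} \<Longrightarrow> A11 j \<in> carrier_mat k k"
      "\<And>j a b. j \<in> {1..d} \<Longrightarrow> a < k \<Longrightarrow> b < k \<Longrightarrow> A j $$ (a,b) = A11 j $$ (a,b)"
    and Jr: "Jr \<in> carrier_mat (k + r) (k + r)" "A 1 * Jr = 1\<^sub>m (k + r)" "Jr * A 1 = 1\<^sub>m (k + r)"
    and S: "S \<in> carrier_mat r r" "transpose_mat S = S" "negative_definite S"
    and Q: "Q = four_block_mat (0\<^sub>m k k) (0\<^sub>m k r) (0\<^sub>m r k) S"
    and P: "P1 \<in> carrier_mat k m" "P0 \<in> carrier_mat k l"
    and gramP: "transpose_mat P1 * P1 = 1\<^sub>m m" "transpose_mat P1 * P0 = 0\<^sub>m m l"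
      "transpose_mat P0 * P1 = 0\<^sub>m l m" "transpose_mat P0 * P0 = 1\<^sub>m l"
      "P1 * transpose_mat P1 + P0 * transpose_mat P0 = 1\<^sub>m k"
    and LP: "transpose_mat P1 * (A11 1 * P1) = L1" "transpose_mat P1 * (A11 1 * P0) = 0\<^sub>m m l"
      "transpose_mat P0 * (A11 1 * P1) = 0\<^sub>m l m" "transpose_mat P0 * (A11 1 * P0) = 0\<^sub>m l l"
    and L1: "L1 \<in> carrier_mat m m" "transpose_mat L1 = L1" "invertible_mat L1"
    and np: "np = num_pos_eigenvalues (A 1)"
    and B: "B \<in> carrier_mat np (k + r)" "B * top_embed (k + r) k = Bu"
    and gkc: "generalized_kreiss (k + r) d A Q B"
begin

abbreviation "n \<equiv> k + r"
abbreviation Eu :: "real mat" where "Eu \<equiv> top_embed n k"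
abbreviation Ev :: "real mat" where "Ev \<equiv> bottom_embed k r"
abbreviation "p1 \<equiv> Eu * P1"
abbreviation "p0 \<equiv> Eu * P0"

lemma Eu_carrier: "Eu \<in> carrier_mat n k" and Ev_carrier: "Ev \<in> carrier_mat n r"
  by (rule top_embed_carrier bottom_embed_carrier)+

lemma one_in: "1 \<in> {1..d}" using d by auto

lemma pr_carrier: "p1 \<in> carrier_mat n m" "p0 \<in> carrier_mat n l"
  using P Eu_carrier by auto

lemma embedded_form:
  fixes X Y :: "real mat"
  assumes X: "X \<in> carrier_mat k a" and Y: "Y \<in> carrier_mat k b" and M: "M \<in> carrier_mat n n"
  shows "transpose_mat (Eu * X) * (M * (Eu * Y)) = transpose_mat X * ((transpose_mat Eu * (M * Eu)) * Y)"
  using mult_sandwich[of "transpose_mat X" a k "transpose_mat Eu" n M Eu k Y b]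
    transpose_mult[OF Eu_carrier X] X Y M Eu_carrier by simp

lemma embedded_gram:
  fixes X Y :: "real mat"
  assumes X: "X \<in> carrier_mat k a" and Y: "Y \<in> carrier_mat k b"
  shows "transpose_mat (Eu * X) * (Eu * Y) = transpose_mat X * Y"
    "transpose_mat (Eu * X) * Ev = 0\<^sub>m a r" "transpose_mat Ev * (Eu * Y) = 0\<^sub>m r b"
proof -
  have EY: "Eu * Y \<in> carrier_mat n b" using Eu_carrier Y by auto
  show "transpose_mat (Eu * X) * (Eu * Y) = transpose_mat X * Y"
    using embedded_form[OF X Y one_carrier_mat] left_mult_one_mat[OF EY] left_mult_one_mat[OF Eu_carrier]
      embed_gram(1)[of k r, where ?'a = real] Y by simp
  have "transpose_mat (Eu * X) * Ev = transpose_mat X * (transpose_mat Eu * Ev)"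
    using transpose_mult[OF Eu_carrier X] X Eu_carrier Ev_carrier
    by (simp add: assoc_mult_mat[of "transpose_mat X" a k "transpose_mat Eu" n Ev r])
  then show "transpose_mat (Eu * X) * Ev = 0\<^sub>m a r" unfolding embed_gram(2) using X by simp
  have "transpose_mat Ev * (Eu * Y) = transpose_mat Ev * Eu * Y"
    using Y Eu_carrier Ev_carrier by (intro assoc_mult_mat[symmetric]) auto
  then show "transpose_mat Ev * (Eu * Y) = 0\<^sub>m r b" unfolding embed_gram(3) using Y by simp
qed

lemma adjoint_cmat_mult:
  assumes "X \<in> carrier_mat n' a" "Y \<in> carrier_mat n' b"
  shows "mat_adjoint (cmat X) * cmat Y = cmat (transpose_mat X * Y)"
  unfolding mat_adjoint_cmat using assms by (intro cmat_mult[symmetric]) auto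

lemma adjoint_cmat_mult3:
  assumes "X \<in> carrier_mat n' a" "M \<in> carrier_mat n' n'" "Y \<in> carrier_mat n' b"
  shows "mat_adjoint (cmat X) * (cmat M * cmat Y) = cmat (transpose_mat X * (M * Y))"
  using adjoint_cmat_mult[OF assms(1) mult_carrier_mat[OF assms(2,3)]] cmat_mult[OF assms(2,3)] by simp

lemma cmat_zero [simp]: "cmat (0\<^sub>m a b) = 0\<^sub>m a b"
  by (intro eq_matI) auto

lemma complex_gram:
  "mat_adjoint (cmat p1) * cmat p1 = 1\<^sub>m m" "mat_adjoint (cmat p1) * cmat p0 = 0\<^sub>m m l"
  "mat_adjoint (cmat p1) * cmat Ev = 0\<^sub>m m r"
  "mat_adjoint (cmat p0) * cmat p1 = 0\<^sub>m l m" "mat_adjoint (cmat p0) * cmat p0 = 1\<^sub>m l"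
  "mat_adjoint (cmat p0) * cmat Ev = 0\<^sub>m l r"
  "mat_adjoint (cmat Ev) * cmat p1 = 0\<^sub>m r m" "mat_adjoint (cmat Ev) * cmat p0 = 0\<^sub>m r l"
  "mat_adjoint (cmat Ev) * cmat Ev = 1\<^sub>m r"
  unfolding adjoint_cmat_mult[OF pr_carrier(1) pr_carrier(1)] adjoint_cmat_mult[OF pr_carrier(1) pr_carrier(2)]
    adjoint_cmat_mult[OF pr_carrier(1) Ev_carrier] adjoint_cmat_mult[OF pr_carrier(2) pr_carrier(1)]
    adjoint_cmat_mult[OF pr_carrier(2) pr_carrier(2)] adjoint_cmat_mult[OF pr_carrier(2) Ev_carrier]
    adjoint_cmat_mult[OF Ev_carrier pr_carrier(1)] adjoint_cmat_mult[OF Ev_carrier pr_carrier(2)]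
    adjoint_cmat_mult[OF Ev_carrier Ev_carrier]
    embedded_gram[OF P(1) P(1)] embedded_gram[OF P(1) P(2)] embedded_gram[OF P(2) P(1)] embedded_gram[OF P(2) P(2)]
    gramP embed_gram by simp_all

lemma real_complete: "p1 * transpose_mat p1 + (p0 * transpose_mat p0 + Ev * transpose_mat Ev) = 1\<^sub>m n"
proof -
  have e: "(Eu * X) * transpose_mat (Eu * X) = Eu * ((X * transpose_mat X) * transpose_mat Eu)"
    if X: "X \<in> carrier_mat k a" for X :: "real mat" and a
  proof -
    have "(Eu * X) * transpose_mat (Eu * X) = (Eu * X) * (transpose_mat X * transpose_mat Eu)"
      using transpose_mult[OF Eu_carrier X] by simp
    also have "\<dots> = Eu * (X * (transpose_mat X * transpose_mat Eu))"
      using X Eu_carrier by (intro assoc_mult_mat[of _ n k _ a _ n]) auto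
    also have "X * (transpose_mat X * transpose_mat Eu) = (X * transpose_mat X) * transpose_mat Eu"
      using X Eu_carrier by (intro assoc_mult_mat[symmetric, of _ k a _ k _ n]) auto
    finally show ?thesis .
  qed
  let ?X1 = "P1 * transpose_mat P1" and ?X0 = "P0 * transpose_mat P0" and ?E = "transpose_mat Eu"
  have X: "?X1 \<in> carrier_mat k k" "?X0 \<in> carrier_mat k k" "?E \<in> carrier_mat k n" using P Eu_carrier by auto
  have XE: "?X1 * ?E \<in> carrier_mat k n" "?X0 * ?E \<in> carrier_mat k n" using X by auto
  have "p1 * transpose_mat p1 + p0 * transpose_mat p0 = Eu * (?X1 * ?E) + Eu * (?X0 * ?E)"
    using e[OF P(1)] e[OF P(2)] by simp
  also have "\<dots> = Eu * (?X1 * ?E + ?X0 * ?E)" using mult_add_distrib_mat[OF Eu_carrier XE] by simp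
  also have "?X1 * ?E + ?X0 * ?E = (?X1 + ?X0) * ?E" using add_mult_distrib_mat[OF X] by simp
  also have "(?X1 + ?X0) * ?E = ?E" unfolding gramP(5) using X by simp
  finally have "p1 * transpose_mat p1 + p0 * transpose_mat p0 + Ev * transpose_mat Ev = 1\<^sub>m n"
    using embed_complete[of k r] by simp
  then show ?thesis
    using assoc_add_mat[of "p1 * transpose_mat p1" n n "p0 * transpose_mat p0" "Ev * transpose_mat Ev"]
      pr_carrier Ev_carrier by simp
qed

lemma complex_complete:
  assumes x: "x \<in> carrier_vec n"
  shows "x = cmat p1 *\<^sub>v (mat_adjoint (cmat p1) *\<^sub>v x) +
    (cmat p0 *\<^sub>v (mat_adjoint (cmat p0) *\<^sub>v x) + cmat Ev *\<^sub>v (mat_adjoint (cmat Ev) *\<^sub>v x))"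
proof -
  have c: "cmat (Y * transpose_mat Y) *\<^sub>v x = cmat Y *\<^sub>v (mat_adjoint (cmat Y) *\<^sub>v x)"
    "Y * transpose_mat Y \<in> carrier_mat n n"
    if Y: "Y \<in> carrier_mat n a" for Y :: "real mat" and a
  proof -
    have "cmat (Y * transpose_mat Y) = cmat Y * mat_adjoint (cmat Y)"
      unfolding mat_adjoint_cmat using Y by (intro cmat_mult) auto
    then show "cmat (Y * transpose_mat Y) *\<^sub>v x = cmat Y *\<^sub>v (mat_adjoint (cmat Y) *\<^sub>v x)"
      using Y x assoc_mult_mat_vec[of "cmat Y" n a "mat_adjoint (cmat Y)" n x] by auto
    show "Y * transpose_mat Y \<in> carrier_mat n n" using Y by auto
  qed
  have add: "cmat (U + V) *\<^sub>v x = cmat U *\<^sub>v x + cmat V *\<^sub>v x"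
    if "U \<in> carrier_mat n n" "V \<in> carrier_mat n n" for U V :: "real mat"
  proof -
    have "cmat (U + V) = cmat U + cmat V" using that by (intro eq_matI) auto
    then show ?thesis using that x add_mult_distrib_mat_vec[of "cmat U" n n "cmat V" x] by auto
  qed
  have "x = cmat (1\<^sub>m n) *\<^sub>v x" using x by simp
  also have "\<dots> = cmat (p1 * transpose_mat p1) *\<^sub>v x +
      (cmat (p0 * transpose_mat p0) *\<^sub>v x + cmat (Ev * transpose_mat Ev) *\<^sub>v x)"
    unfolding real_complete[symmetric]
    using c(2)[OF pr_carrier(1)] c(2)[OF pr_carrier(2)] c(2)[OF Ev_carrier] add by simp
  finally show ?thesis unfolding c(1)[OF pr_carrier(1)] c(1)[OF pr_carrier(2)] c(1)[OF Ev_carrier] .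
qed

lemma top_block_A1: "transpose_mat Eu * (A 1 * Eu) = A11 1"
proof -
  have "A 1 * Eu = mat n k (\<lambda>(i,j). A 1 $$ (i,j))" using A(1)[OF one_in] by (intro mult_top_embed) auto
  then have "transpose_mat Eu * (A 1 * Eu) = mat k k (\<lambda>(i,j). mat n k (\<lambda>(i,j). A 1 $$ (i,j)) $$ (i,j))"
    by (simp add: transpose_top_embed_mult[of _ _ k])
  also have "\<dots> = A11 1" using A11(1)[OF one_in] A11(2)[OF one_in] by (intro eq_matI) auto
  finally show ?thesis .
qed

lemma complex_LA:
  "mat_adjoint (cmat p1) * (cmat (A 1) * cmat p1) = cmat L1"
  "mat_adjoint (cmat p1) * (cmat (A 1) * cmat p0) = 0\<^sub>m m l"
  "mat_adjoint (cmat p0) * (cmat (A 1) * cmat p1) = 0\<^sub>m l m"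
  "mat_adjoint (cmat p0) * (cmat (A 1) * cmat p0) = 0\<^sub>m l l"
  unfolding adjoint_cmat_mult3[OF pr_carrier(1) A(1)[OF one_in] pr_carrier(1)]
    adjoint_cmat_mult3[OF pr_carrier(1) A(1)[OF one_in] pr_carrier(2)]
    adjoint_cmat_mult3[OF pr_carrier(2) A(1)[OF one_in] pr_carrier(1)]
    adjoint_cmat_mult3[OF pr_carrier(2) A(1)[OF one_in] pr_carrier(2)]
    embedded_form[OF P(1) P(1) A(1)[OF one_in]] embedded_form[OF P(1) P(2) A(1)[OF one_in]]
    embedded_form[OF P(2) P(1) A(1)[OF one_in]] embedded_form[OF P(2) P(2) A(1)[OF one_in]]
    top_block_A1 LP by simp_all

lemma cA: "cmat (A 1) \<in> carrier_mat n n" "mat_adjoint (cmat (A 1)) = cmat (A 1)"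
  "cmat Jr \<in> carrier_mat n n" "cmat Jr * cmat (A 1) = 1\<^sub>m n" "cmat (A 1) * cmat Jr = 1\<^sub>m n"
  using A(1)[OF one_in] Jr cmat_mult[OF Jr(1) A(1)[OF one_in]] cmat_mult[OF A(1)[OF one_in] Jr(1)]
    mat_adjoint_cmat[of "A 1"] A(2)[OF one_in] by auto

lemma cS: "cmat S \<in> carrier_mat r r" "mat_adjoint (cmat S) = cmat S"
  using S mat_adjoint_cmat[of S] by auto

lemma cL: "cmat L1 \<in> carrier_mat m m" "mat_adjoint (cmat L1) = cmat L1" "inj_mat (cmat L1)"
proof -
  show "cmat L1 \<in> carrier_mat m m" "mat_adjoint (cmat L1) = cmat L1"
    using L1 mat_adjoint_cmat[of L1] by auto
  obtain N where N: "N \<in> carrier_mat m m" "L1 * N = 1\<^sub>m m" "N * L1 = 1\<^sub>m m"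
    using invertible_mat_obtain_inverse[OF L1(1,3)] by blast
  show "inj_mat (cmat L1)"
    using left_inverse_inj_mat[of "cmat L1" m m "cmat N"] N cmat_mult[OF N(1) L1(1)] L1(1) by simp
qed

text \<open>On the fast scale a boundary layer solves \<open>A 1 * U' = Q U\<close>, and its lower
  components obey \<open>U_v' = Zr U_v\<close>: the lower right block of the inverse of
  \<open>A 1\<close>, times \<open>S\<close>.\<close>

definition "Zr = transpose_mat Ev * (Jr * (Ev * S))"

lemma Zr_carrier: "Zr \<in> carrier_mat r r"
  unfolding Zr_def using Ev_carrier Jr S by auto

lemma cZr: "cmat Zr = mat_adjoint (cmat Ev) * (cmat Jr * (cmat Ev * cmat S))"
  unfolding Zr_def mat_adjoint_cmat
  using cmat_mult[of "transpose_mat Ev" r n "Jr * (Ev * S)" r] cmat_mult[OF Jr(1), of "Ev * S" r]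
    cmat_mult[OF Ev_carrier S(1)] Ev_carrier Jr(1) S(1) by simp

lemma cJ_hermitian: "mat_adjoint (cmat Jr) = cmat Jr"
proof -
  let ?J = "cmat Jr" and ?A = "cmat (A 1)"
  have "mat_adjoint ?J * ?A = 1\<^sub>m n"
    using mat_adjoint_mult[OF cA(1,3)] cA(2,5) by simp
  have "mat_adjoint ?J = mat_adjoint ?J * (?A * ?J)" unfolding cA(5) using cA(3) by simp
  also have "\<dots> = (mat_adjoint ?J * ?A) * ?J" using cA by (intro assoc_mult_mat[symmetric]) auto
  also have "\<dots> = ?J" unfolding \<open>mat_adjoint ?J * ?A = 1\<^sub>m n\<close> using cA(3) by simp
  finally show ?thesis .
qed

text \<open>Pairing \<open>Zr v = z v\<close> with \<open>S v\<close> gives \<open>z\<close> times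
  the negative number \<open>(S v, v)\<close> on one side, and on the other a value of the Hermitian
  form of the inverse of \<open>A 1\<close>, which is real.\<close>

lemma Zr_eigenvalue_real:
  assumes ev: "eigenvalue (cmat Zr) z"
  shows "Im z = 0"
proof -
  obtain \<sigma> where \<sigma>: "0 < \<sigma>" "\<And>v. v \<in> carrier_vec r \<Longrightarrow> qf (cmat S) v \<le> - \<sigma> * sqn v"
    using negative_definite_qf[OF S] by blast
  from ev obtain v where v: "v \<in> carrier_vec r" "v \<noteq> 0\<^sub>v r" "cmat Zr *\<^sub>v v = z \<cdot>\<^sub>v v"
    unfolding eigenvalue_def eigenvector_def using Zr_carrier by auto
  let ?S = "cmat S" and ?E = "cmat Ev" and ?J = "cmat Jr"
  have E: "?E \<in> carrier_mat n r" using Ev_carrier by auto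
  have Sv: "?S *\<^sub>v v \<in> carrier_vec r" using cS v by auto
  let ?f = "?E *\<^sub>v (?S *\<^sub>v v)"
  have f: "?f \<in> carrier_vec n" using E Sv by auto
  have Jf: "?J *\<^sub>v ?f \<in> carrier_vec n" using cA f by auto
  have ES: "?E * ?S \<in> carrier_mat n r" using E cS by auto
  have "cmat Zr *\<^sub>v v = mat_adjoint ?E *\<^sub>v (?J *\<^sub>v ?f)"
    using mat_mult3_vec_eq[OF cZr[symmetric] mat_adjoint_carrier[OF E] cA(3) ES v(1)] assoc_mult_mat_vec[OF E cS(1) v(1)] by auto
  then have "(z \<cdot>\<^sub>v v) \<bullet>c (?S *\<^sub>v v) = (?J *\<^sub>v ?f) \<bullet>c ?f"
    unfolding v(3) using inner_adjoint[of "mat_adjoint ?E" r n "?J *\<^sub>v ?f" "?S *\<^sub>v v"] E Jf Sv by simp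
  then have e: "z * (v \<bullet>c (?S *\<^sub>v v)) = (?J *\<^sub>v ?f) \<bullet>c ?f"
    using v(1) Sv by (simp add: inner_smult_left[of _ r])
  have c: "v \<bullet>c (?S *\<^sub>v v) = (?S *\<^sub>v v) \<bullet>c v" using hermitian_inner[OF cS v(1,1)] by simp
  have im: "Im ((?S *\<^sub>v v) \<bullet>c v) = 0" by (rule hermitian_inner_real[OF cS v(1)])
  have "Re ((?S *\<^sub>v v) \<bullet>c v) < 0"
    using \<sigma>(2)[OF v(1)] mult_pos_pos[OF \<sigma>(1) sqn_pos[OF v(1,2)]] unfolding qf_def by simp
  moreover have "Im (z * ((?S *\<^sub>v v) \<bullet>c v)) = 0"
    using e unfolding c using hermitian_inner_real[OF cA(3) cJ_hermitian f] by simp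
  ultimately show ?thesis using im by simp
qed

text \<open>For \<open>U_v = Th e^(x X) w\<close>, integrating \<open>U' = Jr Ev S U_v\<close> from
  infinity gives the boundary value \<open>Jr Ev S Th X^(-1) w\<close>, which defines
  \<open>G\<close>; a stable \<open>X\<close> is invertible. Since \<open>A 1 * G\<close> lies in
  the range of \<open>Ev\<close>, it is orthogonal to \<open>p1\<close> and
  \<open>p0\<close>.\<close>

lemma fast_frame_exists:
  obtains q G Th where "G \<in> carrier_mat n q" "Th \<in> carrier_mat r q" "inj_mat (cmat Th)"
    "mat_adjoint (cmat Ev) * cmat G = cmat Th" "mat_adjoint (cmat p1) * (cmat (A 1) * cmat G) = 0\<^sub>m m q"
    "mat_adjoint (cmat p0) * (cmat (A 1) * cmat G) = 0\<^sub>m l q"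
    "\<forall>w \<in> carrier_vec q. 0 \<le> qf (cmat (A 1)) (cmat G *\<^sub>v w)"
    "\<forall>g \<in> carrier_vec r. hardy (cmat Zr) g \<longrightarrow> (\<exists>w \<in> carrier_vec q. g = cmat Th *\<^sub>v w)"
proof -
  obtain q Th X where Th: "Th \<in> carrier_mat r q" and X: "X \<in> carrier_mat q q" and ZT: "Zr * Th = Th * X"
    and iT: "inj_mat (cmat Th)" and st: "stable_mat (cmat X)"
    and hZ: "\<And>g. g \<in> carrier_vec r \<Longrightarrow> hardy (cmat Zr) g \<Longrightarrow> \<exists>a \<in> carrier_vec q. g = cmat Th *\<^sub>v a"
    by (rule real_stable_frame_exists[OF Zr_carrier Zr_eigenvalue_real]) blast+
  have cX: "cmat X \<in> carrier_mat q q" using X by auto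
  have "\<not> eigenvalue (cmat X) 0" using stable_matD[OF st] by force
  then have "inj_mat (cmat X)"
  proof (intro inj_matI[OF cX])
    fix a assume a: "a \<in> carrier_vec q" "cmat X *\<^sub>v a = 0\<^sub>v q" and n0: "\<not> eigenvalue (cmat X) 0"
    have "0 \<cdot>\<^sub>v a = 0\<^sub>v q" using a by (intro eq_vecI) auto
    with a n0 cX show "a = 0\<^sub>v q" unfolding eigenvalue_def eigenvector_def by auto
  qed
  then obtain Xi where Xi: "Xi \<in> carrier_mat q q" "X * Xi = 1\<^sub>m q" "Xi * X = 1\<^sub>m q"
    using inj_mat_obtain_inverse[OF X inj_mat_cmat[OF X]] by blast
  define Y where "Y = S * (Th * Xi)"
  have TX: "Th * Xi \<in> carrier_mat r q" using Th Xi by auto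
  have Y: "Y \<in> carrier_mat r q" unfolding Y_def using S TX by auto
  define G where "G = Jr * (Ev * Y)"
  have EY: "Ev * Y \<in> carrier_mat n q" using Ev_carrier Y by auto
  have G: "G \<in> carrier_mat n q" unfolding G_def using Jr EY by auto
  have AG: "A 1 * G = Ev * Y"
  proof -
    have "A 1 * G = (A 1 * Jr) * (Ev * Y)"
      unfolding G_def using A(1)[OF one_in] Jr(1) EY by (intro assoc_mult_mat[symmetric]) auto
    then show ?thesis unfolding Jr(2) left_mult_one_mat[OF EY] .
  qed
  \<comment> \<open>Consistency of the integrated layer with the given lower part:
    \<open>Zr Th Xi = Th X Xi = Th\<close>.\<close>
  have EG: "transpose_mat Ev * G = Th"
  proof -
    have "Jr * (Ev * Y) = (Jr * (Ev * S)) * (Th * Xi)"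
    proof -
      have "Ev * Y = (Ev * S) * (Th * Xi)"
        unfolding Y_def using Ev_carrier S(1) TX by (intro assoc_mult_mat[symmetric]) auto
      then show ?thesis using Jr(1) Ev_carrier S(1) TX by (simp add: assoc_mult_mat[of Jr n n "Ev * S" r "Th * Xi" q])
    qed
    then have "transpose_mat Ev * G = Zr * (Th * Xi)"
      unfolding G_def Zr_def using Jr(1) Ev_carrier S(1) TX
      by (simp add: assoc_mult_mat[of "transpose_mat Ev" r n "Jr * (Ev * S)" r "Th * Xi" q])
    also have "\<dots> = Zr * Th * Xi" using Zr_carrier Th Xi by (intro assoc_mult_mat[symmetric]) auto
    also have "\<dots> = Th * (X * Xi)" unfolding ZT using Th X Xi by (intro assoc_mult_mat) auto
    finally show ?thesis unfolding Xi(2) using Th by simp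
  qed
  have cAG: "cmat (A 1) * cmat G = cmat (Ev * Y)" using cmat_mult[OF A(1)[OF one_in] G] AG by simp
  have zero: "mat_adjoint (cmat (Eu * W)) * (cmat (A 1) * cmat G) = 0\<^sub>m a q" if W: "W \<in> carrier_mat k a" for W a
  proof -
    have EW: "Eu * W \<in> carrier_mat n a" using Eu_carrier W by auto
    have "transpose_mat (Eu * W) * (Ev * Y) = transpose_mat (Eu * W) * Ev * Y"
      using EW Ev_carrier Y by (intro assoc_mult_mat[symmetric]) auto
    then show ?thesis unfolding cAG adjoint_cmat_mult[OF EW EY]
      using embedded_gram(2)[OF W W] Y by simp
  qed
  have EcG: "mat_adjoint (cmat Ev) * cmat G = cmat Th"
    unfolding adjoint_cmat_mult[OF Ev_carrier G] EG ..
  obtain \<sigma> where \<sigma>: "0 < \<sigma>" "\<And>v. v \<in> carrier_vec r \<Longrightarrow> qf (cmat S) v \<le> - \<sigma> * sqn v"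
    using negative_definite_qf[OF S] by blast
  have pos: "0 \<le> qf (cmat (A 1)) (cmat G *\<^sub>v w)" if w: "w \<in> carrier_vec q" for w
  proof (cases "w = 0\<^sub>v q")
    case True
    have "cmat G *\<^sub>v 0\<^sub>v q = 0\<^sub>v n" using G by (intro eq_vecI) auto
    then show ?thesis unfolding True qf_def using cA by simp
  next
    case False
    have cG: "cmat G \<in> carrier_mat n q" and cT: "cmat Th \<in> carrier_mat r q" using G Th by auto
    \<comment> \<open>Positivity is again a Lyapunov argument, now with \<open>X\<close> itself:
      \<open>?H * cmat X\<close> is the compression of the definite \<open>S\<close> by the
      injective \<open>Th\<close>.\<close>
    let ?H = "mat_adjoint (cmat G) * (cmat (A 1) * cmat G)"
    have H: "?H \<in> carrier_mat q q" using cG cA by auto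
    have hH: "mat_adjoint ?H = ?H"
    proof -
      have "mat_adjoint ?H = mat_adjoint (cmat (A 1) * cmat G) * cmat G"
        using mat_adjoint_mult[of "mat_adjoint (cmat G)" q n "cmat (A 1) * cmat G" q] cG cA by simp
      also have "\<dots> = mat_adjoint (cmat G) * cmat (A 1) * cmat G"
        using mat_adjoint_mult[OF cA(1) cG] cA(2) by simp
      also have "\<dots> = ?H" using cG cA by (intro assoc_mult_mat) auto
      finally show ?thesis .
    qed
    have "0 < qf ?H w"
    proof (rule lyapunov_positive[OF H hH cX st _ w False])
      fix x :: "complex vec" assume x: "x \<in> carrier_vec q" "x \<noteq> 0\<^sub>v q"
      have Tx: "cmat Th *\<^sub>v x \<in> carrier_vec r" using cT x by auto
      have "?H * cmat X *\<^sub>v x = mat_adjoint (cmat G) *\<^sub>v (cmat Ev *\<^sub>v (cmat S *\<^sub>v (cmat Th *\<^sub>v x)))"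
      proof -
        have Xx: "cmat X *\<^sub>v x \<in> carrier_vec q" using cX x by auto
        have YX: "Y * X = S * Th"
        proof -
          have "Y * X = S * ((Th * Xi) * X)" unfolding Y_def using S(1) TX X by (intro assoc_mult_mat) auto
          also have "(Th * Xi) * X = Th * (Xi * X)" using Th Xi X by (intro assoc_mult_mat) auto
          also have "\<dots> = Th" unfolding Xi(3) using Th by simp
          finally show ?thesis .
        qed
        have cY: "cmat Y \<in> carrier_mat r q" and cE: "cmat Ev \<in> carrier_mat n r" using Y Ev_carrier by auto
        have "cmat Y * cmat X = cmat S * cmat Th" using cmat_mult[OF Y X] cmat_mult[OF S(1) Th] YX by simp
        then have "cmat Y *\<^sub>v (cmat X *\<^sub>v x) = cmat S *\<^sub>v (cmat Th *\<^sub>v x)"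
          using assoc_mult_mat_vec[OF cY cX x(1)] assoc_mult_mat_vec[OF cS(1) cT x(1)] by simp
        then have "cmat (Ev * Y) *\<^sub>v (cmat X *\<^sub>v x) = cmat Ev *\<^sub>v (cmat S *\<^sub>v (cmat Th *\<^sub>v x))"
          using cmat_mult[OF Ev_carrier Y] assoc_mult_mat_vec[OF cE cY Xx] by simp
        moreover have cEY: "cmat (Ev * Y) \<in> carrier_mat n q" using EY by simp
        have "?H * cmat X *\<^sub>v x = mat_adjoint (cmat G) *\<^sub>v (cmat (Ev * Y) *\<^sub>v (cmat X *\<^sub>v x))"
          using assoc_mult_mat_vec[OF H cX x(1)] assoc_mult_mat_vec[OF mat_adjoint_carrier[OF cG] cEY Xx]
          unfolding cAG by simp
        ultimately show ?thesis by simp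
      qed
      moreover have "(mat_adjoint (cmat G) *\<^sub>v (cmat Ev *\<^sub>v (cmat S *\<^sub>v (cmat Th *\<^sub>v x)))) \<bullet>c x =
          (cmat S *\<^sub>v (cmat Th *\<^sub>v x)) \<bullet>c (cmat Th *\<^sub>v x)"
      proof -
        have cE: "cmat Ev \<in> carrier_mat n r" using Ev_carrier by auto
        have STx: "cmat S *\<^sub>v (cmat Th *\<^sub>v x) \<in> carrier_vec r" using cS Tx by auto
        have "mat_adjoint (cmat Ev) *\<^sub>v (cmat G *\<^sub>v x) = cmat Th *\<^sub>v x"
          by (rule mat_mult_vec_eq[OF EcG mat_adjoint_carrier[OF cE] cG x(1)])
        then show ?thesis
          using inner_adjoint[of "mat_adjoint (cmat G)" q n "cmat Ev *\<^sub>v (cmat S *\<^sub>v (cmat Th *\<^sub>v x))" x]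
            inner_adjoint[OF cE STx, of "cmat G *\<^sub>v x"] cG cE STx x by simp
      qed
      moreover have "cmat Th *\<^sub>v x \<noteq> 0\<^sub>v r" using inj_matD[OF iT cT x(1)] x(2) by blast
      then have "qf (cmat S) (cmat Th *\<^sub>v x) < 0"
        using \<sigma>(2)[OF Tx] mult_pos_pos[OF \<sigma>(1) sqn_pos[OF Tx]] by simp
      ultimately show "qf (?H * cmat X) x < 0" unfolding qf_def by simp
    qed
    then show ?thesis using qf_congruence[OF cG cA(1) w] by simp
  qed
  show thesis
    using that[OF G Th iT EcG zero[OF P(1)] zero[OF P(2)]] pos hZ by blast
qed

end

section \<open>Orthonormal stable frames and the symbols at a fixed frequency\<close>

lemma stable_mat_conjugate:
  assumes X: "X \<in> carrier_mat k k" and st: "stable_mat X"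
    and V: "V \<in> carrier_mat k k" "V' \<in> carrier_mat k k" "V * V' = 1\<^sub>m k" "V' * V = 1\<^sub>m k"
  shows "stable_mat (V' * X * V)"
proof -
  have Y: "V' * X * V \<in> carrier_mat k k" using X V by auto
  have "similar_mat_wit (V' * X * V) X V' V" using X V by (intro similar_mat_witI[of _ _ k]) auto
  then have "char_poly (V' * X * V) = char_poly X" by (intro char_poly_similar) (auto simp: similar_mat_def)
  then have "spectrum (V' * X * V) = spectrum X"
    using spectrum_root_char_poly[OF Y] spectrum_root_char_poly[OF X] by simp
  then show ?thesis using st Y X V unfolding stable_mat_def by auto
qed

lemma mult_mat_zero_vec:
  fixes M :: "complex mat"
  assumes "M \<in> carrier_mat m n"
  shows "M *\<^sub>v 0\<^sub>v n = 0\<^sub>v m"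
  using assms by (intro eq_vecI) auto

lemma complex_vec_arith:
  fixes x y z :: "complex vec"
  assumes "x \<in> carrier_vec n" "y \<in> carrier_vec n" "z \<in> carrier_vec n"
  shows "x + (y + z) = (x + z) + y" "(- 1) \<cdot>\<^sub>v x + x = 0\<^sub>v n" "x + y - z = x + (y + (- 1) \<cdot>\<^sub>v z)"
  using assms by (auto intro!: eq_vecI)

text \<open>For an orthonormal right-stable matrix the Gram determinant is 1, so the right side of
  the Generalized Kreiss Condition reduces to its constant.\<close>

lemma orthonormal_stable_frame_exists:
  assumes M: "M \<in> carrier_mat n n"
  obtains R X where "R \<in> carrier_mat n (num_stable_eigenvalues M)" "stable_frame M R X"
    "mat_adjoint R * R = 1\<^sub>m (num_stable_eigenvalues M)" "right_stable_mat M R"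
proof -
  define k where "k = num_stable_eigenvalues M"
  obtain R0 X0 where R0: "R0 \<in> carrier_mat n k" "stable_frame M R0 X0" and kn: "k \<le> n"
    by (rule stable_frame_exists[OF M, folded k_def]) blast
  note f = stable_frameD[OF R0(2) M R0(1)]
  obtain V V' where V: "V \<in> carrier_mat k k" "V' \<in> carrier_mat k k" "V * V' = 1\<^sub>m k" "V' * V = 1\<^sub>m k"
    "mat_adjoint (R0 * V) * (R0 * V) = 1\<^sub>m k" using gram_schmidt_normalize[OF R0(1) f(4)] by blast
  let ?R = "R0 * V" and ?X = "V' * X0 * V"
  have R: "?R \<in> carrier_mat n k" and X: "?X \<in> carrier_mat k k" using R0 V f by auto
  have st: "stable_mat ?X" by (rule stable_mat_conjugate[OF f(1,2) V(1-4)])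
  have "M * ?R = M * R0 * V" using M R0(1) V(1) by (intro assoc_mult_mat[symmetric]) auto
  also have "\<dots> = R0 * (X0 * V)" unfolding f(3) using R0(1) f(1) V(1) by (intro assoc_mult_mat) auto
  also have "X0 * V = V * ?X"
  proof -
    have X0V: "X0 * V \<in> carrier_mat k k" using f(1) V(1) by auto
    have "V' * X0 * V = V' * (X0 * V)" using f(1) V by (intro assoc_mult_mat) auto
    then have "V * ?X = (V * V') * (X0 * V)" using assoc_mult_mat[OF V(1,2) X0V] by simp
    then show ?thesis unfolding V(3) left_mult_one_mat[OF X0V] by simp
  qed
  also have "R0 * (V * ?X) = ?R * ?X" using R0(1) V(1) X by (intro assoc_mult_mat[symmetric]) auto
  finally have MR: "M * ?R = ?R * ?X" .
  have i: "inj_mat ?R" using left_inverse_inj_mat[OF R _ V(5)] R by auto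
  have "right_stable_mat M ?R"
    unfolding right_stable_mat_def k_def[symmetric]
    using M R X st MR full_rank_inj_mat[OF R kn] i by auto
  then show thesis
    using that[unfolded k_def[symmetric], OF R stable_frameI[OF M R X st MR i] V(5)] by blast
qed

context relaxation_system
begin

lemma complex_symbol_block:
  "mat_adjoint (cmat Eu) * (tangential_symbol n d A w * cmat Eu) = tangential_symbol k d A11 w"
proof -
  let ?T = "tangential_symbol n d A w" and ?E = "top_embed n k :: complex mat"
  have a: "mat_adjoint ?E = transpose_mat ?E" unfolding top_embed_def by (intro eq_matI) auto
  have "?T * ?E = mat n k (\<lambda>(i,j). ?T $$ (i,j))"
    by (rule mult_top_embed[OF tangential_symbol_carrier]) simp
  then have "mat_adjoint ?E * (?T * ?E) = mat k k (\<lambda>(i,j). mat n k (\<lambda>(i,j). ?T $$ (i,j)) $$ (i,j))"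
    unfolding a by (simp add: transpose_top_embed_mult[of _ _ k])
  also have "\<dots> = tangential_symbol k d A11 w"
  proof (rule eq_matI)
    fix a b assume "a < dim_row (tangential_symbol k d A11 w)" "b < dim_col (tangential_symbol k d A11 w)"
    then have ab: "a < k" "b < k" unfolding tangential_symbol_def by auto
    have "(\<Sum>j = 2..d. w j * (A j $$ (a, b))) = (\<Sum>j = 2..d. w j * (A11 j $$ (a, b)))"
      using A11(2) ab by (intro sum.cong) auto
    with ab show "mat k k (\<lambda>(i,j). mat n k (\<lambda>(i,j). ?T $$ (i,j)) $$ (i,j)) $$ (a,b) = tangential_symbol k d A11 w $$ (a,b)"
      unfolding tangential_symbol_def by (simp del: of_real_sum)
  qed (auto simp: tangential_symbol_def)
  finally show ?thesis by simp
qed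

text \<open>The blocks C_kl of the equilibrium symbol are compressions of the full tangential
  symbol, because \<open>p1\<close> and \<open>p0\<close> live in the upper components only.\<close>

lemma complex_symbol_form:
  assumes X: "X \<in> carrier_mat k a" and Y: "Y \<in> carrier_mat k b"
  shows "mat_adjoint (cmat (Eu * X)) * (tangential_symbol n d A w * cmat (Eu * Y)) =
    mat_adjoint (cmat X) * tangential_symbol k d A11 w * cmat Y"
proof -
  let ?T = "tangential_symbol n d A w" and ?C = "tangential_symbol k d A11 w"
  have cE: "cmat Eu \<in> carrier_mat n k" unfolding cmat_top_embed by (rule top_embed_carrier)
  have cX: "cmat X \<in> carrier_mat k a" and cY: "cmat Y \<in> carrier_mat k b" using X Y by auto
  have "mat_adjoint (cmat (Eu * X)) = mat_adjoint (cmat X) * mat_adjoint (cmat Eu)"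
    unfolding cmat_mult[OF Eu_carrier X] by (rule mat_adjoint_mult[OF cE cX])
  then have "mat_adjoint (cmat (Eu * X)) * (?T * cmat (Eu * Y)) =
      mat_adjoint (cmat X) * ((mat_adjoint (cmat Eu) * (?T * cmat Eu)) * cmat Y)"
    unfolding cmat_mult[OF Eu_carrier Y]
    using mult_sandwich[OF mat_adjoint_carrier[OF cX] mat_adjoint_carrier[OF cE] tangential_symbol_carrier cE cY] by simp
  also have "\<dots> = mat_adjoint (cmat X) * ?C * cmat Y"
    unfolding complex_symbol_block
    by (rule assoc_mult_mat[symmetric, OF mat_adjoint_carrier[OF cX] tangential_symbol_carrier cY])
  finally show ?thesis .
qed

definition Dsym :: "complex \<Rightarrow> (nat \<Rightarrow> real) \<Rightarrow> complex mat" where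
  "Dsym \<xi> w = \<xi> \<cdot>\<^sub>m 1\<^sub>m n + tangential_symbol n d A w"

lemma Dsym_carrier: "Dsym \<xi> w \<in> carrier_mat n n"
  unfolding Dsym_def using tangential_symbol_carrier[of n d A w] by auto

lemma qf_Dsym:
  assumes x: "x \<in> carrier_vec n"
  shows "qf (Dsym \<xi> w) x = Re \<xi> * sqn x"
proof -
  let ?T = "tangential_symbol n d A w"
  have T: "?T \<in> carrier_mat n n" by (rule tangential_symbol_carrier)
  have Tx: "?T *\<^sub>v x \<in> carrier_vec n" by (rule mult_mat_vec_carrier[OF T x])
  have "Re ((?T *\<^sub>v x) \<bullet>c x) = 0" using A x by (intro tangential_symbol_skew) auto
  moreover have "(Dsym \<xi> w *\<^sub>v x) \<bullet>c x = \<xi> * (x \<bullet>c x) + (?T *\<^sub>v x) \<bullet>c x"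
    unfolding Dsym_def smult_one_add_mult_vec[OF T x] using x Tx by (simp add: inner_simps[of _ n])
  ultimately show ?thesis unfolding qf_def by (simp add: inner_self)
qed

lemma adjoint_Dsym:
  fixes w :: "nat \<Rightarrow> real"
  assumes X: "X \<in> carrier_mat k a" and y: "y \<in> carrier_vec m" and z: "z \<in> carrier_vec l"
  defines "C \<equiv> tangential_symbol k d A11 w"
  shows "mat_adjoint (cmat (Eu * X)) *\<^sub>v (Dsym \<xi> w *\<^sub>v (cmat p1 *\<^sub>v y + cmat p0 *\<^sub>v z)) =
    \<xi> \<cdot>\<^sub>v (mat_adjoint (cmat (Eu * X)) *\<^sub>v (cmat p1 *\<^sub>v y + cmat p0 *\<^sub>v z)) +
    (mat_adjoint (cmat X) * C * cmat P1 *\<^sub>v y + mat_adjoint (cmat X) * C * cmat P0 *\<^sub>v z)"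
proof -
  let ?T = "tangential_symbol n d A w" and ?W = "mat_adjoint (cmat (Eu * X))"
  have T: "?T \<in> carrier_mat n n" by (rule tangential_symbol_carrier)
  have EX: "cmat (Eu * X) \<in> carrier_mat n a" using mult_carrier_mat[OF Eu_carrier X] by simp
  have W: "?W \<in> carrier_mat a n" by (rule mat_adjoint_carrier[OF EX])
  have p: "cmat p1 \<in> carrier_mat n m" "cmat p0 \<in> carrier_mat n l" using pr_carrier by auto
  have py: "cmat p1 *\<^sub>v y \<in> carrier_vec n" and pz: "cmat p0 *\<^sub>v z \<in> carrier_vec n" using p y z by auto
  let ?u = "cmat p1 *\<^sub>v y + cmat p0 *\<^sub>v z"
  have u: "?u \<in> carrier_vec n" using py pz by auto
  have Tu: "?T *\<^sub>v ?u \<in> carrier_vec n" "?T *\<^sub>v (cmat p1 *\<^sub>v y) \<in> carrier_vec n" "?T *\<^sub>v (cmat p0 *\<^sub>v z) \<in> carrier_vec n"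
    using mult_mat_vec_carrier[OF T] u py pz by auto
  have "?W *\<^sub>v (Dsym \<xi> w *\<^sub>v ?u) = ?W *\<^sub>v (\<xi> \<cdot>\<^sub>v ?u) + ?W *\<^sub>v (?T *\<^sub>v ?u)"
    unfolding Dsym_def smult_one_add_mult_vec[OF T u] using u Tu by (intro mult_add_distrib_mat_vec[OF W]) auto
  also have "?W *\<^sub>v (\<xi> \<cdot>\<^sub>v ?u) = \<xi> \<cdot>\<^sub>v (?W *\<^sub>v ?u)" by (rule mult_mat_vec[OF W u])
  also have "?W *\<^sub>v (?T *\<^sub>v ?u) = ?W *\<^sub>v (?T *\<^sub>v (cmat p1 *\<^sub>v y)) + ?W *\<^sub>v (?T *\<^sub>v (cmat p0 *\<^sub>v z))"
    unfolding mult_add_distrib_mat_vec[OF T py pz] by (rule mult_add_distrib_mat_vec[OF W Tu(2,3)])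
  finally show ?thesis
    unfolding mat_mult3_vec_eq[OF complex_symbol_form[OF X P(1)] W T p(1) y]
      mat_mult3_vec_eq[OF complex_symbol_form[OF X P(2)] W T p(2) z] C_def .
qed

text \<open>\<open>K = - (\<xi> I + C00)^(-1) C01\<close> solves the \<open>p0\<close> equation,
  which makes the explicit formula for M_1 the Schur complement required by the limit. The inverse
  exists because a kernel vector \<open>z\<close> would have energy
  \<open>Re \<xi> |p0 z|^2 = 0\<close>.\<close>

lemma equilibrium_symbol_properties:
  assumes \<xi>: "0 < Re \<xi>"
  obtains K where "K \<in> carrier_mat l m" "equilibrium_symbol d A11 P1 P0 L1 \<xi> w \<in> carrier_mat m m"
    "\<And>y. y \<in> carrier_vec m \<Longrightarrow>
      mat_adjoint (cmat p0) *\<^sub>v (Dsym \<xi> w *\<^sub>v (cmat p1 *\<^sub>v y + cmat p0 *\<^sub>v (K *\<^sub>v y))) = 0\<^sub>v l"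
    "\<And>y. y \<in> carrier_vec m \<Longrightarrow> cmat L1 *\<^sub>v (equilibrium_symbol d A11 P1 P0 L1 \<xi> w *\<^sub>v y) =
      - (mat_adjoint (cmat p1) *\<^sub>v (Dsym \<xi> w *\<^sub>v (cmat p1 *\<^sub>v y + cmat p0 *\<^sub>v (K *\<^sub>v y))))"
proof -
  define C where "C = tangential_symbol k d A11 w"
  define C11 where "C11 = mat_adjoint (cmat P1) * C * cmat P1"
  define C10 where "C10 = mat_adjoint (cmat P1) * C * cmat P0"
  define C01 where "C01 = mat_adjoint (cmat P0) * C * cmat P1"
  define C00 where "C00 = mat_adjoint (cmat P0) * C * cmat P0"
  have C: "C \<in> carrier_mat k k" unfolding C_def by (rule tangential_symbol_carrier)
  have cP: "cmat P1 \<in> carrier_mat k m" "cmat P0 \<in> carrier_mat k l" using P by auto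
  have cc: "C11 \<in> carrier_mat m m" "C10 \<in> carrier_mat m l" "C01 \<in> carrier_mat l m" "C00 \<in> carrier_mat l l"
    unfolding C11_def C10_def C01_def C00_def using C cP by auto
  have p: "cmat p1 \<in> carrier_mat n m" "cmat p0 \<in> carrier_mat n l" using pr_carrier by auto
  have u1: "mat_adjoint (cmat p1) *\<^sub>v (cmat p1 *\<^sub>v y + cmat p0 *\<^sub>v z) = y"
    and u0: "mat_adjoint (cmat p0) *\<^sub>v (cmat p1 *\<^sub>v y + cmat p0 *\<^sub>v z) = z"
    if y: "y \<in> carrier_vec m" and z: "z \<in> carrier_vec l" for y z
  proof -
    have py: "cmat p1 *\<^sub>v y \<in> carrier_vec n" and pz: "cmat p0 *\<^sub>v z \<in> carrier_vec n" using p y z by auto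
    note a = mat_adjoint_carrier[OF p(1)] mat_adjoint_carrier[OF p(2)]
    show "mat_adjoint (cmat p1) *\<^sub>v (cmat p1 *\<^sub>v y + cmat p0 *\<^sub>v z) = y"
      unfolding mult_add_distrib_mat_vec[OF a(1) py pz]
        mat_mult_vec_eq[OF complex_gram(1) a(1) p(1) y] mat_mult_vec_eq[OF complex_gram(2) a(1) p(2) z] using y z by simp
    show "mat_adjoint (cmat p0) *\<^sub>v (cmat p1 *\<^sub>v y + cmat p0 *\<^sub>v z) = z"
      unfolding mult_add_distrib_mat_vec[OF a(2) py pz]
        mat_mult_vec_eq[OF complex_gram(4) a(2) p(1) y] mat_mult_vec_eq[OF complex_gram(5) a(2) p(2) z] using y z by simp
  qed
  have D1: "mat_adjoint (cmat p1) *\<^sub>v (Dsym \<xi> w *\<^sub>v (cmat p1 *\<^sub>v y + cmat p0 *\<^sub>v z)) = \<xi> \<cdot>\<^sub>v y + (C11 *\<^sub>v y + C10 *\<^sub>v z)"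
    and D0: "mat_adjoint (cmat p0) *\<^sub>v (Dsym \<xi> w *\<^sub>v (cmat p1 *\<^sub>v y + cmat p0 *\<^sub>v z)) = \<xi> \<cdot>\<^sub>v z + (C01 *\<^sub>v y + C00 *\<^sub>v z)"
    if y: "y \<in> carrier_vec m" and z: "z \<in> carrier_vec l" for y z
    using adjoint_Dsym[OF P(1) y z] adjoint_Dsym[OF P(2) y z] u1[OF y z] u0[OF y z]
    unfolding C11_def C10_def C01_def C00_def C_def by simp_all
  let ?W = "\<xi> \<cdot>\<^sub>m 1\<^sub>m l + C00"
  have W: "?W \<in> carrier_mat l l" using cc by auto
  have "inj_mat ?W"
  proof (rule inj_matI[OF W])
    fix z assume z: "z \<in> carrier_vec l" and Wz: "?W *\<^sub>v z = 0\<^sub>v l"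
    let ?u = "cmat p1 *\<^sub>v 0\<^sub>v m + cmat p0 *\<^sub>v z"
    have o: "(0\<^sub>v m :: complex vec) \<in> carrier_vec m" by simp
    have "cmat p1 *\<^sub>v 0\<^sub>v m = 0\<^sub>v n" by (rule mult_mat_zero_vec[OF p(1)])
    then have ue: "?u = cmat p0 *\<^sub>v z" using p(2) z by simp
    have u: "?u \<in> carrier_vec n" unfolding ue using p(2) z by auto
    have Du: "Dsym \<xi> w *\<^sub>v ?u \<in> carrier_vec n" by (rule mult_mat_vec_carrier[OF Dsym_carrier u])
    have "C01 *\<^sub>v 0\<^sub>v m = 0\<^sub>v l" by (rule mult_mat_zero_vec[OF cc(3)])
    then have "mat_adjoint (cmat p0) *\<^sub>v (Dsym \<xi> w *\<^sub>v ?u) = 0\<^sub>v l"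
      unfolding D0[OF o z] using Wz smult_one_add_mult_vec[OF cc(4) z, of \<xi>] cc z by simp
    then have "(Dsym \<xi> w *\<^sub>v ?u) \<bullet>c ?u = 0"
      using inner_adjoint[OF mat_adjoint_carrier[OF p(2)] Du z] z unfolding ue by simp
    then have "Re \<xi> * sqn ?u = 0" using qf_Dsym[OF u, of \<xi> w] unfolding qf_def by simp
    then have "?u = 0\<^sub>v n" using \<xi> sqn_eq_0[OF u] by simp
    then have "z = mat_adjoint (cmat p0) *\<^sub>v 0\<^sub>v n" using u0[OF o z] by simp
    also have "\<dots> = 0\<^sub>v l" by (rule mult_mat_zero_vec[OF mat_adjoint_carrier[OF p(2)]])
    finally show "z = 0\<^sub>v l" .
  qed
  then obtain N where N: "N \<in> carrier_mat l l" "?W * N = 1\<^sub>m l" "N * ?W = 1\<^sub>m l"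
    using inj_mat_obtain_inverse[OF W] by blast
  have mN: "minv ?W = N" by (rule minv_eqI[OF W N(1,3)])
  obtain Li where Li: "Li \<in> carrier_mat m m" "cmat L1 * Li = 1\<^sub>m m" "Li * cmat L1 = 1\<^sub>m m"
    using inj_mat_obtain_inverse[OF cL(1,3)] by blast
  have mL: "minv (cmat L1) = Li" by (rule minv_eqI[OF cL(1) Li(1,3)])
  let ?V = "(\<xi> \<cdot>\<^sub>m 1\<^sub>m m + C11) - C10 * N * C01"
  have V: "?V \<in> carrier_mat m m" using cc N by auto
  have M1: "equilibrium_symbol d A11 P1 P0 L1 \<xi> w = - (Li * ?V)"
    unfolding equilibrium_symbol_def Let_def using P mN mL
    unfolding C11_def C10_def C01_def C00_def C_def by simp
  have LiV: "Li * ?V \<in> carrier_mat m m" using Li V by auto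
  let ?K = "- (N * C01)"
  have K: "?K \<in> carrier_mat l m" using N cc by auto
  have Kv: "?K *\<^sub>v y = (- 1) \<cdot>\<^sub>v (N *\<^sub>v (C01 *\<^sub>v y))" if y: "y \<in> carrier_vec m" for y
    using uminus_mat_mult_vec[of "N * C01" l m y] N cc y assoc_mult_mat_vec[OF N(1) cc(3) y] by auto
  show thesis
  proof (rule that[OF K])
    show "equilibrium_symbol d A11 P1 P0 L1 \<xi> w \<in> carrier_mat m m" unfolding M1 using LiV by auto
    fix y :: "complex vec" assume y: "y \<in> carrier_vec m"
    have Cy: "C01 *\<^sub>v y \<in> carrier_vec l" using cc y by auto
    have NCy: "N *\<^sub>v (C01 *\<^sub>v y) \<in> carrier_vec l" using N Cy by auto
    have Ky: "?K *\<^sub>v y \<in> carrier_vec l" using K y by auto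
    have "?W *\<^sub>v (?K *\<^sub>v y) = (- 1) \<cdot>\<^sub>v (C01 *\<^sub>v y)"
      unfolding Kv[OF y] mult_mat_vec[OF W NCy] mat_mult_vec_eq[OF N(2) W N(1) Cy] using Cy by simp
    then have WK: "\<xi> \<cdot>\<^sub>v (?K *\<^sub>v y) + C00 *\<^sub>v (?K *\<^sub>v y) = (- 1) \<cdot>\<^sub>v (C01 *\<^sub>v y)"
      unfolding smult_one_add_mult_vec[OF cc(4) Ky] .
    have CK: "C00 *\<^sub>v (?K *\<^sub>v y) \<in> carrier_vec l" using cc Ky by auto
    have \<xi>K: "\<xi> \<cdot>\<^sub>v (?K *\<^sub>v y) \<in> carrier_vec l" using Ky by (rule smult_carrier_vec[THEN iffD2])
    have "\<xi> \<cdot>\<^sub>v (?K *\<^sub>v y) + (C01 *\<^sub>v y + C00 *\<^sub>v (?K *\<^sub>v y)) = 0\<^sub>v l"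
      unfolding complex_vec_arith(1)[OF \<xi>K Cy CK] WK by (rule complex_vec_arith(2)[OF Cy Cy Cy])
    then show "mat_adjoint (cmat p0) *\<^sub>v (Dsym \<xi> w *\<^sub>v (cmat p1 *\<^sub>v y + cmat p0 *\<^sub>v (?K *\<^sub>v y))) = 0\<^sub>v l"
      unfolding D0[OF y Ky] .
    have Vy: "?V *\<^sub>v y \<in> carrier_vec m" using V y by auto
    have "cmat L1 *\<^sub>v (equilibrium_symbol d A11 P1 P0 L1 \<xi> w *\<^sub>v y) = (- 1) \<cdot>\<^sub>v (?V *\<^sub>v y)"
    proof -
      have LV: "Li *\<^sub>v (?V *\<^sub>v y) \<in> carrier_vec m" using Li Vy by auto
      have "equilibrium_symbol d A11 P1 P0 L1 \<xi> w *\<^sub>v y = (- 1) \<cdot>\<^sub>v (Li *\<^sub>v (?V *\<^sub>v y))"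
        unfolding M1 uminus_mat_mult_vec[OF LiV y] assoc_mult_mat_vec[OF Li(1) V y] ..
      then show ?thesis
        using mult_mat_vec[OF cL(1) LV, of "- 1"] mat_mult_vec_eq[OF Li(2) cL(1) Li(1) Vy] Vy by simp
    qed
    also have "?V *\<^sub>v y = \<xi> \<cdot>\<^sub>v y + (C11 *\<^sub>v y + C10 *\<^sub>v (?K *\<^sub>v y))"
    proof -
      have CNC: "C10 * N * C01 \<in> carrier_mat m m" "C10 * N \<in> carrier_mat m l" using cc N by auto
      have "?V *\<^sub>v y = (\<xi> \<cdot>\<^sub>m 1\<^sub>m m + C11) *\<^sub>v y - C10 * N * C01 *\<^sub>v y"
        using cc CNC y by (intro minus_mult_distrib_mat_vec[of _ m m]) auto
      also have "C10 * N * C01 *\<^sub>v y = C10 *\<^sub>v (N *\<^sub>v (C01 *\<^sub>v y))"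
        unfolding assoc_mult_mat_vec[OF CNC(2) cc(3) y] by (rule assoc_mult_mat_vec[OF cc(2) N(1) Cy])
      finally have e: "?V *\<^sub>v y = (\<xi> \<cdot>\<^sub>v y + C11 *\<^sub>v y) - C10 *\<^sub>v (N *\<^sub>v (C01 *\<^sub>v y))"
        unfolding smult_one_add_mult_vec[OF cc(1) y] .
      have c: "\<xi> \<cdot>\<^sub>v y \<in> carrier_vec m" "C11 *\<^sub>v y \<in> carrier_vec m" "C10 *\<^sub>v (N *\<^sub>v (C01 *\<^sub>v y)) \<in> carrier_vec m"
        using y cc NCy by auto
      show ?thesis unfolding e Kv[OF y] mult_mat_vec[OF cc(2) NCy] by (rule complex_vec_arith(3)[OF c])
    qed
    also have "(- 1) \<cdot>\<^sub>v (\<xi> \<cdot>\<^sub>v y + (C11 *\<^sub>v y + C10 *\<^sub>v (?K *\<^sub>v y))) = - (\<xi> \<cdot>\<^sub>v y + (C11 *\<^sub>v y + C10 *\<^sub>v (?K *\<^sub>v y)))"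
      by (intro eq_vecI) auto
    finally show "cmat L1 *\<^sub>v (equilibrium_symbol d A11 P1 P0 L1 \<xi> w *\<^sub>v y) =
      - (mat_adjoint (cmat p1) *\<^sub>v (Dsym \<xi> w *\<^sub>v (cmat p1 *\<^sub>v y + cmat p0 *\<^sub>v (?K *\<^sub>v y))))"
      unfolding D1[OF y Ky] .
  qed
qed

lemma relaxation_symbol_carrier: "relaxation_symbol n d A Q \<xi> w \<eta> \<in> carrier_mat n n"
  unfolding relaxation_symbol_def minv_eqI[OF cA(1,3,4)] Q
  using cA(3) S tangential_symbol_carrier[of n d A w] by auto

lemma relaxation_symbol_eq:
  "relaxation_symbol n d A Q \<xi> w \<eta> =
    cmat Jr * (complex_of_real \<eta> \<cdot>\<^sub>m (cmat Ev * (cmat S * mat_adjoint (cmat Ev))) - Dsym \<xi> w)"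
proof -
  have "cmat Q = cmat Ev * (cmat S * mat_adjoint (cmat Ev))"
    unfolding Q bottom_embed_sandwich[OF S(1), symmetric] mat_adjoint_cmat
    using cmat_mult[OF S(1), of "transpose_mat Ev" n] cmat_mult[OF Ev_carrier, of "S * transpose_mat Ev" n]
      S(1) Ev_carrier by simp
  moreover have "complex_of_real \<eta> \<cdot>\<^sub>m cmat Q - \<xi> \<cdot>\<^sub>m 1\<^sub>m n - tangential_symbol n d A w =
      complex_of_real \<eta> \<cdot>\<^sub>m cmat Q - Dsym \<xi> w"
    unfolding Dsym_def Q using S tangential_symbol_carrier[of n d A w] by (intro eq_matI) auto
  ultimately show ?thesis unfolding relaxation_symbol_def minv_eqI[OF cA(1,3,4)] by simp
qed

text \<open>For orthonormal frames \<open>|det (B R)|\<close> is at least \<open>cK\<close>, while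
  the entries of \<open>B R\<close> are bounded independently of the frequency;
  \<open>det_lower_bound_sqn\<close> then bounds \<open>B\<close> from below on the stable subspace,
  uniformly.\<close>

lemma gkc_vector:
  obtains c where "0 < c" "\<And>\<eta> w \<xi>. 0 \<le> \<eta> \<Longrightarrow> 0 < Re \<xi> \<Longrightarrow>
    \<exists>R X. R \<in> carrier_mat n np \<and> stable_frame (relaxation_symbol n d A Q \<xi> w \<eta>) R X \<and>
      mat_adjoint R * R = 1\<^sub>m np \<and> (\<forall>a \<in> carrier_vec np. c * sqn (R *\<^sub>v a) \<le> sqn (cmat B *\<^sub>v (R *\<^sub>v a)))"
proof -
  from gkc obtain cK where cK: "0 < cK" and gk: "\<And>\<eta> w \<xi> R. 0 \<le> \<eta> \<Longrightarrow> 0 < Re \<xi> \<Longrightarrow>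
      right_stable_mat (relaxation_symbol n d A Q \<xi> w \<eta>) R \<Longrightarrow>
      cK * sqrt (Re (det (mat_adjoint R * R))) \<le> cmod (det (cmat B * R))"
    unfolding generalized_kreiss_def by blast
  have cB: "cmat B \<in> carrier_mat np n" using B by simp
  obtain KB where KB: "norm_bound (cmat B) KB" using norm_bound_exists by blast
  \<comment> \<open>An entry of \<open>B R\<close> is a sum of \<open>n\<close> products, and the
    entries of an orthonormal \<open>R\<close> are at most 1.\<close>
  define Kn where "Kn = KB * 1 * of_nat n"
  \<comment> \<open>The constant of \<open>det_lower_bound_sqn\<close>; the added 1 keeps it
    positive also for \<open>np = 0\<close>.\<close>
  define H where "H = real np * (real np * (fact (np - 1) * Kn ^ (np - 1)))\<^sup>2 + 1"
  have H: "0 < H" unfolding H_def by (intro add_nonneg_pos) auto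
  show thesis
  proof (rule that[of "cK\<^sup>2 / H"])
    show "0 < cK\<^sup>2 / H" using cK H by simp
    fix \<eta> w \<xi> assume \<eta>: "(0::real) \<le> \<eta>" and \<xi>: "0 < Re \<xi>"
    let ?M = "relaxation_symbol n d A Q \<xi> w \<eta>"
    obtain R X where R: "R \<in> carrier_mat n (num_stable_eigenvalues ?M)" "stable_frame ?M R X"
      "mat_adjoint R * R = 1\<^sub>m (num_stable_eigenvalues ?M)" "right_stable_mat ?M R"
      using orthonormal_stable_frame_exists[OF relaxation_symbol_carrier] by blast
    from gk[OF \<eta> \<xi> R(4)] have det: "cK \<le> cmod (det (cmat B * R))" unfolding R(3) by simp
    \<comment> \<open>The determinant of a nonsquare matrix is 0 by definition, so the positive
      \<open>cK\<close> forces \<open>B R\<close> to be square.\<close>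
    have nps: "num_stable_eigenvalues ?M = np"
    proof (rule ccontr)
      assume "num_stable_eigenvalues ?M \<noteq> np"
      then have "det (cmat B * R) = 0" using R(1) cB by (simp add: det_def)
      with det cK show False by simp
    qed
    note R = R[unfolded nps]
    have BR: "cmat B * R \<in> carrier_mat np np" using cB R(1) by auto
    have "norm_bound R 1"
    proof (rule norm_boundI)
      fix i j assume "i < dim_row R" "j < dim_col R"
      then have ij: "i < n" "j < np" using R(1) by auto
      have "cmod (R $$ (i,j)) = cmod ((R *\<^sub>v unit_vec np j) $ i)"
        using ij R(1) mult_mat_unit_vec[OF R(1) ij(2)] by simp
      also have "\<dots> \<le> sqrt (sqn (R *\<^sub>v unit_vec np j))"
        using R(1) ij by (intro cmod_index_le_sqrt_sqn) auto
      also have "sqn (R *\<^sub>v unit_vec np j) = sqn (unit_vec np j)" using isometry_sqn[OF R(1,3)] by simp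
      also have "\<dots> = (\<Sum>l<np. if l = j then 1 else 0)"
        unfolding sqn_def using ij by (intro sum.cong) (auto simp: unit_vec_def)
      also have "\<dots> = 1" using ij by simp
      finally show "cmod (R $$ (i,j)) \<le> 1" by simp
    qed
    from norm_bound_mult[OF cB R(1) KB this] have nb: "norm_bound (cmat B * R) Kn" unfolding Kn_def .
    have "cK\<^sup>2 / H * sqn (R *\<^sub>v a) \<le> sqn (cmat B *\<^sub>v (R *\<^sub>v a))" if a: "a \<in> carrier_vec np" for a
    proof -
      have e: "cmat B * R *\<^sub>v a = cmat B *\<^sub>v (R *\<^sub>v a)" by (rule assoc_mult_mat_vec[OF cB R(1) a])
      have "cK\<^sup>2 * sqn a \<le> (cmod (det (cmat B * R)))\<^sup>2 * sqn a"
        using det cK by (intro mult_right_mono power_mono) auto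
      also have "\<dots> \<le> (H - 1) * sqn (cmat B *\<^sub>v (R *\<^sub>v a))"
        using det_lower_bound_sqn[OF BR nb a] unfolding e H_def by simp
      also have "\<dots> \<le> H * sqn (cmat B *\<^sub>v (R *\<^sub>v a))" by (intro mult_right_mono) auto
      finally show ?thesis unfolding isometry_sqn[OF R(1,3) a] using H by (simp add: field_simps)
    qed
    with R show "\<exists>R X. R \<in> carrier_mat n np \<and> stable_frame ?M R X \<and>
      mat_adjoint R * R = 1\<^sub>m np \<and> (\<forall>a \<in> carrier_vec np. cK\<^sup>2 / H * sqn (R *\<^sub>v a) \<le> sqn (cmat B *\<^sub>v (R *\<^sub>v a)))"
      by blast
  qed
qed

end

section \<open>The reduced boundary condition\<close>

lemma cmat_add: "U \<in> carrier_mat a b \<Longrightarrow> V \<in> carrier_mat a b \<Longrightarrow> cmat (U + V) = cmat U + cmat V"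
  by (intro eq_matI) auto

context relaxation_system
begin

lemma num_stable_uminus_L1: "num_stable_eigenvalues (- cmat L1) = num_pos_eigenvalues L1"
proof -
  obtain as where "char_poly L1 = (\<Prod>a\<leftarrow>as. [:- a, 1:])"
    using char_poly_real_factorized[OF L1(1) hermitian_eigenvalue_real[OF cL(1,2)]] by blast
  from num_stable_uminus_cmat[OF L1(1) this] show ?thesis .
qed

lemma num_stable_uminus_A: "num_stable_eigenvalues (- cmat (A 1)) = np"
proof -
  obtain as where "char_poly (A 1) = (\<Prod>a\<leftarrow>as. [:- a, 1:])"
    using char_poly_real_factorized[OF A(1)[OF one_in] hermitian_eigenvalue_real[OF cA(1,2)]] by blast
  from num_stable_uminus_cmat[OF A(1)[OF one_in] this] show ?thesis unfolding np .
qed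

text \<open>\<open>q\<close>, \<open>G\<close> and \<open>Th\<close> are fixed before the frequency,
  so one left annihilator of \<open>B (p0, G)\<close> serves all of them. For given \<open>y\<close>
  the free parts \<open>z\<close> and \<open>v\<close> can be chosen so that \<open>B e\<close> is
  controlled by \<open>El B p1 y\<close> alone, while \<open>e\<close> still determines
  \<open>y\<close>; this transfers the bound on \<open>B e\<close> to the reduced condition.\<close>

lemma reduced_boundary_condition:
  "\<exists>Bo. Bo \<in> carrier_mat (num_pos_eigenvalues L1) np \<and> full_rank Bo \<and>
     Bo * Bu * P0 = 0\<^sub>m (num_pos_eigenvalues L1) l \<and>
     uniform_kreiss_characteristic d A11 P1 P0 L1 (Bo * Bu)"
proof -
  define nn where "nn = num_pos_eigenvalues L1"
  obtain q G Th where G: "G \<in> carrier_mat n q" "Th \<in> carrier_mat r q" "inj_mat (cmat Th)"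
    "mat_adjoint (cmat Ev) * cmat G = cmat Th" "mat_adjoint (cmat p1) * (cmat (A 1) * cmat G) = 0\<^sub>m m q"
    "mat_adjoint (cmat p0) * (cmat (A 1) * cmat G) = 0\<^sub>m l q"
    and Gpos: "\<forall>w \<in> carrier_vec q. 0 \<le> qf (cmat (A 1)) (cmat G *\<^sub>v w)"
    and Gh: "\<forall>g \<in> carrier_vec r. hardy (cmat Zr) g \<longrightarrow> (\<exists>w \<in> carrier_vec q. g = cmat Th *\<^sub>v w)"
    using fast_frame_exists .
  obtain \<sigma> where \<sigma>: "0 < \<sigma>" "\<And>v. v \<in> carrier_vec r \<Longrightarrow> qf (cmat S) v \<le> - \<sigma> * sqn v"
    using negative_definite_qf[OF S] by blast
  obtain c where c: "0 < c" and gv: "\<And>\<eta> w \<xi>. 0 \<le> \<eta> \<Longrightarrow> 0 < Re \<xi> \<Longrightarrow>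
    \<exists>R X. R \<in> carrier_mat n np \<and> stable_frame (relaxation_symbol n d A Q \<xi> w \<eta>) R X \<and>
      mat_adjoint R * R = 1\<^sub>m np \<and> (\<forall>a \<in> carrier_vec np. c * sqn (R *\<^sub>v a) \<le> sqn (cmat B *\<^sub>v (R *\<^sub>v a)))"
    by (rule gkc_vector) blast
  have cB: "cmat B \<in> carrier_mat np n" using B by simp
  have cp: "cmat p1 \<in> carrier_mat n m" "cmat p0 \<in> carrier_mat n l" using pr_carrier by auto
  have cG: "cmat G \<in> carrier_mat n q" using G by auto
  let ?M1 = "\<lambda>\<xi> w. equilibrium_symbol d A11 P1 P0 L1 \<xi> w"
  \<comment> \<open>Everything needed from a single frequency; \<open>c\<close>, \<open>nn\<close>
    and \<open>q\<close> are common to all. The last conjunct is the means of recovering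
    \<open>y\<close> from the full vector.\<close>
  have freq: "num_stable_eigenvalues (?M1 \<xi> w) = nn \<and> nn + (l + q) = np \<and> ?M1 \<xi> w \<in> carrier_mat m m \<and>
    (\<forall>y \<in> carrier_vec m. \<forall>z \<in> carrier_vec l. \<forall>v \<in> carrier_vec q. hardy (?M1 \<xi> w) y \<longrightarrow>
      c * sqn (cmat p1 *\<^sub>v y + (cmat p0 *\<^sub>v z + cmat G *\<^sub>v v)) \<le>
      sqn (cmat B *\<^sub>v (cmat p1 *\<^sub>v y + (cmat p0 *\<^sub>v z + cmat G *\<^sub>v v)))) \<and>
    (\<forall>y \<in> carrier_vec m. qf (cmat L1 * ?M1 \<xi> w) y \<le> - Re \<xi> * sqn y) \<and>
    (\<forall>y \<in> carrier_vec m. \<forall>z \<in> carrier_vec l. \<forall>v \<in> carrier_vec q.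
      mat_adjoint (cmat p1) *\<^sub>v (cmat (A 1) *\<^sub>v (cmat p1 *\<^sub>v y + (cmat p0 *\<^sub>v z + cmat G *\<^sub>v v))) = cmat L1 *\<^sub>v y)" if \<xi>: "0 < Re \<xi>" for \<xi> w
  proof -
    obtain K where K: "K \<in> carrier_mat l m" "?M1 \<xi> w \<in> carrier_mat m m"
      "\<And>y. y \<in> carrier_vec m \<Longrightarrow>
        mat_adjoint (cmat p0) *\<^sub>v (Dsym \<xi> w *\<^sub>v (cmat p1 *\<^sub>v y + cmat p0 *\<^sub>v (K *\<^sub>v y))) = 0\<^sub>v l"
      "\<And>y. y \<in> carrier_vec m \<Longrightarrow> cmat L1 *\<^sub>v (?M1 \<xi> w *\<^sub>v y) =
        - (mat_adjoint (cmat p1) *\<^sub>v (Dsym \<xi> w *\<^sub>v (cmat p1 *\<^sub>v y + cmat p0 *\<^sub>v (K *\<^sub>v y))))"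
      by (rule equilibrium_symbol_properties[OF \<xi>]) blast
    interpret lim: relaxation_limit n m l r q "cmat (A 1)" "cmat Jr" "cmat p1" "cmat p0" "cmat Ev" "cmat L1"
      "cmat S" "cmat G" "cmat Th" "cmat Zr" \<sigma> "Dsym \<xi> w" "?M1 \<xi> w" K "Re \<xi>"
    proof (rule relaxation_limit.intro)
      show "cmat Ev \<in> carrier_mat n r" "cmat Th \<in> carrier_mat r q" "cmat Zr \<in> carrier_mat r r"
        using Ev_carrier G(2) Zr_carrier by auto
      show "\<And>w. w \<in> carrier_vec q \<Longrightarrow> 0 \<le> qf (cmat (A 1)) (cmat G *\<^sub>v w)" using Gpos by blast
      show "\<And>g. g \<in> carrier_vec r \<Longrightarrow> hardy (cmat Zr) g \<Longrightarrow> \<exists>w \<in> carrier_vec q. g = cmat Th *\<^sub>v w" using Gh by blast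
      show "\<And>x. x \<in> carrier_vec n \<Longrightarrow> qf (Dsym \<xi> w) x = Re \<xi> * sqn x" by (rule qf_Dsym)
      show "\<And>x. x \<in> carrier_vec n \<Longrightarrow> x = cmat p1 *\<^sub>v (mat_adjoint (cmat p1) *\<^sub>v x) +
          (cmat p0 *\<^sub>v (mat_adjoint (cmat p0) *\<^sub>v x) + cmat Ev *\<^sub>v (mat_adjoint (cmat Ev) *\<^sub>v x))"
        by (rule complex_complete)
    qed (fact cA cp complex_gram complex_LA cL cS \<sigma> cG G cZr Dsym_carrier \<xi> K)+
    have Ms: "lim.Msym \<eta> = relaxation_symbol n d A Q \<xi> w \<eta>" for \<eta>
      unfolding lim.Msym_def lim.Q_def relaxation_symbol_eq ..
    have "\<exists>R X. R \<in> carrier_mat n np \<and> stable_frame (lim.Msym \<eta>) R X \<and>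
      mat_adjoint R * R = 1\<^sub>m np \<and> (\<forall>a \<in> carrier_vec np. c * sqn (R *\<^sub>v a) \<le> sqn (cmat B *\<^sub>v (R *\<^sub>v a)))"
      if "0 \<le> \<eta>" for \<eta> unfolding Ms using gv[OF that \<xi>] .
    note ls = lim.limit_subspace[OF cB num_stable_uminus_A[symmetric] this]
    have "num_stable_eigenvalues (?M1 \<xi> w) = nn"
      using lyapunov_inertia[OF cL(1,2) K(2) lim.M1_neg] unfolding num_stable_uminus_L1 nn_def .
    with ls K(2) lim.qf_L_M1 lim.ansatz(2) show ?thesis by auto
  qed
  define D where "D = B * append_cols p0 G"
  have pG: "append_cols p0 G \<in> carrier_mat n (l + q)" using pr_carrier(2) G(1) by (rule append_cols_carrier)
  have D: "D \<in> carrier_mat np (l + q)" unfolding D_def using B pG by auto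
  have cpG: "cmat (append_cols p0 G) = append_cols (cmat p0) (cmat G)"
    unfolding append_cols_def using pr_carrier G by (intro eq_matI) auto
  have Dv: "cmat D *\<^sub>v (z @\<^sub>v v) = cmat B *\<^sub>v (cmat p0 *\<^sub>v z + cmat G *\<^sub>v v)"
    if z: "z \<in> carrier_vec l" and v: "v \<in> carrier_vec q" for z v
  proof -
    have "cmat D = cmat B * append_cols (cmat p0) (cmat G)"
      unfolding D_def cmat_mult[OF B(1) pG] cpG ..
    then show ?thesis
      using assoc_mult_mat_vec[OF cB append_cols_carrier[OF cp(2) cG], of "z @\<^sub>v v"]
        append_cols_mult_vec[OF cp(2) cG z v] z v by simp
  qed
  have vs: "x = vec_first x l @\<^sub>v vec_last x q" if "x \<in> carrier_vec (l + q)" for x :: "complex vec"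
    using that by simp
  \<comment> \<open>The facts about \<open>p0\<close> and \<open>G\<close> contain no frequency, so
    they are read off at \<open>\<xi> = 1\<close>, \<open>\<omega> = 0\<close>. The choice
    \<open>y = 0\<close> is admissible because 0 satisfies \<open>hardy\<close> trivially.\<close>
  have f1: "nn + (l + q) = np" "?M1 1 (\<lambda>_. 0) \<in> carrier_mat m m"
    "\<And>z v. z \<in> carrier_vec l \<Longrightarrow> v \<in> carrier_vec q \<Longrightarrow>
      c * sqn (cmat p0 *\<^sub>v z + cmat G *\<^sub>v v) \<le> sqn (cmat B *\<^sub>v (cmat p0 *\<^sub>v z + cmat G *\<^sub>v v))"
  proof -
    have f: "nn + (l + q) = np" "?M1 1 (\<lambda>_. 0) \<in> carrier_mat m m" using freq[of 1 "\<lambda>_. 0"] by auto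
    have h0: "hardy (?M1 1 (\<lambda>_. 0)) (0\<^sub>v m)"
      unfolding hardy_def
    proof (intro exI[of _ 0] allI impI)
      fix s :: complex
      have "s \<cdot>\<^sub>v 0\<^sub>v m - ?M1 1 (\<lambda>_. 0) *\<^sub>v 0\<^sub>v m = 0\<^sub>v m"
        unfolding mult_mat_zero_vec[OF f(2)] by (intro eq_vecI) auto
      then show "\<exists>y \<in> carrier_vec (dim_row (?M1 1 (\<lambda>_. 0))). s \<cdot>\<^sub>v y - ?M1 1 (\<lambda>_. 0) *\<^sub>v y = 0\<^sub>v m \<and> sqn y \<le> 0 / Re s"
        using f(2) by (intro bexI[of _ "0\<^sub>v m"]) auto
    qed
    have e: "cmat p1 *\<^sub>v 0\<^sub>v m + (cmat p0 *\<^sub>v z + cmat G *\<^sub>v v) = cmat p0 *\<^sub>v z + cmat G *\<^sub>v v"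
      if "z \<in> carrier_vec l" "v \<in> carrier_vec q" for z v
      unfolding mult_mat_zero_vec[OF cp(1)] using cp(2) cG that by simp
    have "c * sqn (cmat p0 *\<^sub>v z + cmat G *\<^sub>v v) \<le> sqn (cmat B *\<^sub>v (cmat p0 *\<^sub>v z + cmat G *\<^sub>v v))"
      if zv: "z \<in> carrier_vec l" "v \<in> carrier_vec q" for z v
    proof -
      have "0 < Re 1" by simp
      from freq[OF this, of "\<lambda>_. 0"] h0 zv zero_carrier_vec[of m]
      have "c * sqn (cmat p1 *\<^sub>v 0\<^sub>v m + (cmat p0 *\<^sub>v z + cmat G *\<^sub>v v)) \<le>
        sqn (cmat B *\<^sub>v (cmat p1 *\<^sub>v 0\<^sub>v m + (cmat p0 *\<^sub>v z + cmat G *\<^sub>v v)))" by blast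
      then show ?thesis unfolding e[OF zv] .
    qed
    with f show "nn + (l + q) = np" "?M1 1 (\<lambda>_. 0) \<in> carrier_mat m m"
      "\<And>z v. z \<in> carrier_vec l \<Longrightarrow> v \<in> carrier_vec q \<Longrightarrow>
        c * sqn (cmat p0 *\<^sub>v z + cmat G *\<^sub>v v) \<le> sqn (cmat B *\<^sub>v (cmat p0 *\<^sub>v z + cmat G *\<^sub>v v))" by blast+
  qed
  have cD: "cmat D \<in> carrier_mat np (l + q)" using D by simp
  have "inj_mat (cmat D)"
  proof (rule inj_matI[OF cD])
    fix x :: "complex vec" assume x: "x \<in> carrier_vec (l + q)" and Dx: "cmat D *\<^sub>v x = 0\<^sub>v np"
    define z v where "z = vec_first x l" and "v = vec_last x q"
    have zv: "z \<in> carrier_vec l" "v \<in> carrier_vec q" "x = z @\<^sub>v v" unfolding z_def v_def using vs[OF x] by auto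
    have pz: "cmat p0 *\<^sub>v z \<in> carrier_vec n" and Gv: "cmat G *\<^sub>v v \<in> carrier_vec n" using cp cG zv by auto
    have "sqn (cmat B *\<^sub>v (cmat p0 *\<^sub>v z + cmat G *\<^sub>v v)) = 0"
      using Dx unfolding zv(3) Dv[OF zv(1,2)] by simp
    with f1(3)[OF zv(1,2)] have "c * sqn (cmat p0 *\<^sub>v z + cmat G *\<^sub>v v) \<le> 0" by simp
    with c have "sqn (cmat p0 *\<^sub>v z + cmat G *\<^sub>v v) = 0"
      using sqn_nonneg[of "cmat p0 *\<^sub>v z + cmat G *\<^sub>v v"] by (simp add: mult_le_0_iff)
    then have e0: "cmat p0 *\<^sub>v z + cmat G *\<^sub>v v = 0\<^sub>v n" using sqn_eq_0[of _ n] pz Gv by auto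
    have cE: "mat_adjoint (cmat Ev) \<in> carrier_mat r n" using Ev_carrier by simp
    have "mat_adjoint (cmat Ev) *\<^sub>v (cmat p0 *\<^sub>v z + cmat G *\<^sub>v v) = cmat Th *\<^sub>v v"
      unfolding mult_add_distrib_mat_vec[OF cE pz Gv] mat_mult_vec_eq[OF complex_gram(8) cE cp(2) zv(1)]
        mat_mult_vec_eq[OF G(4) cE cG zv(2)] using G(2) zv by simp
    then have "cmat Th *\<^sub>v v = 0\<^sub>v r" unfolding e0 mult_mat_zero_vec[OF cE] by simp
    then have v0: "v = 0\<^sub>v q" using inj_matD[OF G(3) _ zv(2)] G(2) by simp
    have p0a: "mat_adjoint (cmat p0) \<in> carrier_mat l n" by (rule mat_adjoint_carrier[OF cp(2)])
    have "cmat p0 *\<^sub>v z = 0\<^sub>v n" using e0 unfolding v0 mult_mat_zero_vec[OF cG] using pz by simp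
    then have "z = 0\<^sub>v l"
      using mat_mult_vec_eq[OF complex_gram(5) p0a cp(2) zv(1)] mult_mat_zero_vec[OF p0a] zv(1) by simp
    with v0 show "x = 0\<^sub>v (l + q)" unfolding zv(3) by auto
  qed
  then have iD: "inj_mat D" by (rule inj_mat_cmat[OF D])
  have np_eq: "np - (l + q) = nn" using f1(1) by simp
  obtain E Dl El where E: "E \<in> carrier_mat np nn" "Dl \<in> carrier_mat (l + q) np" "El \<in> carrier_mat nn np"
    "El * D = 0\<^sub>m nn (l + q)" "El * E = 1\<^sub>m nn" "D * Dl + E * El = 1\<^sub>m np"
    using inj_mat_complement_inverse[OF D iD] unfolding np_eq .
  have BEX: "El * Bu * X = El * (B * (Eu * X))" if X: "X \<in> carrier_mat k a" for X a
  proof -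
    have Bu: "Bu \<in> carrier_mat np k" using B Eu_carrier by auto
    have "El * Bu * X = El * (Bu * X)" using E(3) Bu X by (intro assoc_mult_mat) auto
    also have "Bu * X = B * (Eu * X)"
      unfolding B(2)[symmetric] using B(1) Eu_carrier X by (intro assoc_mult_mat) auto
    finally show ?thesis .
  qed
  have zero: "El * Bu * P0 = 0\<^sub>m nn l"
  proof (rule eq_matI)
    fix i j assume "i < dim_row (0\<^sub>m nn l)" "j < dim_col (0\<^sub>m nn l)"
    then have ij: "i < nn" "j < l" by auto
    have Bp: "B * p0 \<in> carrier_mat np l" "B * G \<in> carrier_mat np q" using B pr_carrier G by auto
    have "D = append_cols (B * p0) (B * G)" unfolding D_def by (rule append_cols_mult_left[OF B(1) pr_carrier(2) G(1)])
    then have "El * D = append_cols (El * (B * p0)) (El * (B * G))"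
      using append_cols_mult_left[OF E(3) Bp] by simp
    then have "append_cols (El * (B * p0)) (El * (B * G)) = 0\<^sub>m nn (l + q)" using E(4) by simp
    then have "append_cols (El * (B * p0)) (El * (B * G)) $$ (i,j) = 0" using ij by simp
    then show "(El * Bu * P0) $$ (i,j) = 0\<^sub>m nn l $$ (i,j)"
      unfolding BEX[OF P(2)] append_cols_def using ij E(3) P(2) G(1) by simp
  qed (use E P in auto)
  have cE: "cmat E \<in> carrier_mat np nn" "cmat Dl \<in> carrier_mat (l + q) np" "cmat El \<in> carrier_mat nn np"
    using E by auto
  \<comment> \<open>From \<open>D Dl + E El = 1\<close>: subtracting the \<open>D\<close> part of
    \<open>b\<close> leaves its \<open>E\<close> part, whose size is governed by
    \<open>El b\<close>.\<close>
  have split: "b + cmat D *\<^sub>v ((- 1) \<cdot>\<^sub>v (cmat Dl *\<^sub>v b)) = cmat E *\<^sub>v (cmat El *\<^sub>v b)" if b: "b \<in> carrier_vec np" for b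
  proof -
    have Dlb: "cmat Dl *\<^sub>v b \<in> carrier_vec (l + q)" and Elb: "cmat El *\<^sub>v b \<in> carrier_vec nn" using cE b by auto
    have x: "cmat D *\<^sub>v (cmat Dl *\<^sub>v b) \<in> carrier_vec np" and y: "cmat E *\<^sub>v (cmat El *\<^sub>v b) \<in> carrier_vec np"
      using cD cE Dlb Elb by auto
    have "cmat (D * Dl + E * El) = cmat D * cmat Dl + cmat E * cmat El"
      unfolding cmat_mult[OF D E(2), symmetric] cmat_mult[OF E(1,3), symmetric]
      using D E(1-3) by (intro cmat_add) auto
    then have one: "cmat D * cmat Dl + cmat E * cmat El = 1\<^sub>m np" unfolding E(6) by simp
    have "b = (cmat D * cmat Dl + cmat E * cmat El) *\<^sub>v b" unfolding one using b by simp
    also have "\<dots> = cmat D * cmat Dl *\<^sub>v b + cmat E * cmat El *\<^sub>v b"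
      using cD cE b by (intro add_mult_distrib_mat_vec) auto
    also have "\<dots> = cmat D *\<^sub>v (cmat Dl *\<^sub>v b) + cmat E *\<^sub>v (cmat El *\<^sub>v b)"
      unfolding assoc_mult_mat_vec[OF cD cE(2) b] assoc_mult_mat_vec[OF cE(1,3) b] ..
    finally have beq: "b = cmat D *\<^sub>v (cmat Dl *\<^sub>v b) + cmat E *\<^sub>v (cmat El *\<^sub>v b)" .
    have cancel: "(x + y) + (- 1) \<cdot>\<^sub>v x = y" if "x \<in> carrier_vec np" "y \<in> carrier_vec np" for x y :: "complex vec"
      using that by (auto intro!: eq_vecI)
    show ?thesis unfolding mult_mat_vec[OF cD Dlb] using cancel[OF x y] beq by simp
  qed
  obtain CE where CE: "0 < CE" "\<And>x. x \<in> carrier_vec nn \<Longrightarrow> sqn (cmat E *\<^sub>v x) \<le> CE * sqn x"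
    using sqn_mult_vec_bounded[OF cE(1)] by blast
  obtain Li where Li: "Li \<in> carrier_mat m m" "cmat L1 * Li = 1\<^sub>m m" "Li * cmat L1 = 1\<^sub>m m"
    using inj_mat_obtain_inverse[OF cL(1,3)] by blast
  have p1A: "mat_adjoint (cmat p1) * cmat (A 1) \<in> carrier_mat m n"
    by (rule mult_carrier_mat[OF mat_adjoint_carrier[OF cp(1)] cA(1)])
  then have LpA: "Li * (mat_adjoint (cmat p1) * cmat (A 1)) \<in> carrier_mat m n" using Li by auto
  \<comment> \<open>Bounds the map that returns the slow coefficient \<open>y\<close> from
    \<open>e\<close>, namely the inverse of \<open>L1\<close> applied to the \<open>p1\<close>
    component of \<open>A 1\<close> times \<open>e\<close>.\<close>
  obtain CL where CL: "0 < CL"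
    "\<And>x. x \<in> carrier_vec n \<Longrightarrow> sqn (Li * (mat_adjoint (cmat p1) * cmat (A 1)) *\<^sub>v x) \<le> CL * sqn x"
    using sqn_mult_vec_bounded[OF LpA] by blast
  \<comment> \<open>From the chain
    \<open>c |y|^2 \<le> CL c |e|^2 \<le> CL CE |N a|^2\<close>.\<close>
  define c3 where "c3 = c / (CL * CE)"
  have c3: "0 < c3" unfolding c3_def using c CL CE by simp
  have ukc: "uniform_kreiss_characteristic d A11 P1 P0 L1 (El * Bu)"
    unfolding uniform_kreiss_characteristic_def
  \<comment> \<open>The determinant comparison contributes one factor \<open>c3\<close> per column
    and bounds a squared modulus, hence the power \<open>nn\<close> and the square root.\<close>
  proof (intro exI[of _ "sqrt (c3 ^ nn)"] conjI allI impI)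
    show "0 < sqrt (c3 ^ nn)" using c3 by simp
    fix \<xi> w R assume \<xi>: "0 < Re \<xi>" and rs: "right_stable_mat (?M1 \<xi> w) R"
    note fr = freq[OF \<xi>, of w]
    have M1: "?M1 \<xi> w \<in> carrier_mat m m" and ns: "num_stable_eigenvalues (?M1 \<xi> w) = nn" using fr by auto
    have nm: "nn \<le> m" by (rule stable_frame_exists[OF M1, unfolded ns])
    from rs obtain X where R: "R \<in> carrier_mat m nn" and fR: "full_rank R" and X: "X \<in> carrier_mat nn nn"
      "stable_mat X" "?M1 \<xi> w * R = R * X" unfolding right_stable_mat_def ns using M1 by auto
    have iR: "inj_mat R" using full_rank_inj_mat[OF R nm] fR by simp
    have sf: "stable_frame (?M1 \<xi> w) R X" by (rule stable_frameI[OF M1 R X iR])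
    let ?N = "cmat (El * Bu) * cmat P1 * R"
    have Bu: "Bu \<in> carrier_mat np k" using B Eu_carrier by auto
    have EB: "El * Bu \<in> carrier_mat nn k" using E(3) Bu by auto
    have N: "?N \<in> carrier_mat nn nn" using EB P R by auto
    have le: "c3 * sqn (R *\<^sub>v a) \<le> sqn (?N *\<^sub>v a)" if a: "a \<in> carrier_vec nn" for a
    proof -
      let ?y = "R *\<^sub>v a"
      have y: "?y \<in> carrier_vec m" using R a by auto
      have hy: "hardy (?M1 \<xi> w) ?y"
        using fr by (intro stable_frame_hardy[OF cL(1,2) M1 \<xi> _ R sf a]) auto
      have p1y: "cmat p1 *\<^sub>v ?y \<in> carrier_vec n" using cp y by auto
      let ?b = "cmat B *\<^sub>v (cmat p1 *\<^sub>v ?y)"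
      have b: "?b \<in> carrier_vec np" using cB p1y by auto
      have Na: "?N *\<^sub>v a = cmat El *\<^sub>v ?b"
      proof -
        have Bp: "B * p1 \<in> carrier_mat np m" using B pr_carrier by auto
        have EBP: "cmat (El * Bu) * cmat P1 \<in> carrier_mat nn m" using EB P by auto
        have eq: "cmat (El * Bu) * cmat P1 = cmat El * (cmat B * cmat p1)"
          unfolding cmat_mult[OF EB P(1), symmetric] BEX[OF P(1)] cmat_mult[OF E(3) Bp] cmat_mult[OF B(1) pr_carrier(1)] ..
        have "?N *\<^sub>v a = cmat El * (cmat B * cmat p1) *\<^sub>v ?y"
          unfolding eq[symmetric] by (rule assoc_mult_mat_vec[OF EBP R a])
        also have "\<dots> = cmat El *\<^sub>v (cmat B *\<^sub>v (cmat p1 *\<^sub>v ?y))"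
          by (rule mat_mult3_vec_eq[OF refl cE(3) cB cp(1) y, symmetric])
        finally show ?thesis .
      qed
      \<comment> \<open>This choice of the free coefficients cancels the \<open>D\<close> part of
        \<open>B p1 y\<close>, so that \<open>B e\<close> equals \<open>E El B p1 y\<close>.\<close>
      let ?x = "(- 1) \<cdot>\<^sub>v (cmat Dl *\<^sub>v ?b)"
      have x: "?x \<in> carrier_vec (l + q)" using mult_mat_vec_carrier[OF cE(2) b] by simp
      define z v where "z = vec_first ?x l" and "v = vec_last ?x q"
      have zv: "z \<in> carrier_vec l" "v \<in> carrier_vec q" "?x = z @\<^sub>v v" unfolding z_def v_def using vs[OF x] by auto
      let ?w = "cmat p0 *\<^sub>v z + cmat G *\<^sub>v v"
      have w: "?w \<in> carrier_vec n" using cp cG zv by auto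
      let ?e = "cmat p1 *\<^sub>v ?y + ?w"
      have e: "?e \<in> carrier_vec n" using p1y w by auto
      have Elb: "cmat El *\<^sub>v ?b \<in> carrier_vec nn" using cE b by auto
      have "cmat B *\<^sub>v ?e = ?b + cmat D *\<^sub>v ?x"
        unfolding zv(3) Dv[OF zv(1,2)] by (rule mult_add_distrib_mat_vec[OF cB p1y w])
      also have "\<dots> = cmat E *\<^sub>v (cmat El *\<^sub>v ?b)" by (rule split[OF b])
      finally have Be: "cmat B *\<^sub>v ?e = cmat E *\<^sub>v (cmat El *\<^sub>v ?b)" .
      have "c * sqn ?e \<le> sqn (cmat B *\<^sub>v ?e)" using fr y zv hy by blast
      also have "\<dots> \<le> CE * sqn (?N *\<^sub>v a)" unfolding Be Na by (rule CE(2)[OF Elb])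
      finally have ce: "c * sqn ?e \<le> CE * sqn (?N *\<^sub>v a)" .
      have "Li * (mat_adjoint (cmat p1) * cmat (A 1)) *\<^sub>v ?e = Li *\<^sub>v (mat_adjoint (cmat p1) *\<^sub>v (cmat (A 1) *\<^sub>v ?e))"
        by (rule mat_mult3_vec_eq[OF refl Li(1) mat_adjoint_carrier[OF cp(1)] cA(1) e, symmetric])
      also have "mat_adjoint (cmat p1) *\<^sub>v (cmat (A 1) *\<^sub>v ?e) = cmat L1 *\<^sub>v ?y" using fr y zv by blast
      also have "Li *\<^sub>v (cmat L1 *\<^sub>v ?y) = ?y" using mat_mult_vec_eq[OF Li(3,1) cL(1) y] y by simp
      finally have "sqn ?y \<le> CL * sqn ?e" using CL(2)[OF e] by simp
      then have "c * sqn ?y \<le> CL * (c * sqn ?e)" using c by (simp add: mult.left_commute)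
      also have "\<dots> \<le> CL * (CE * sqn (?N *\<^sub>v a))" using ce CL(1) by (intro mult_left_mono) auto
      finally show ?thesis unfolding c3_def using CL(1) CE(1) by (simp add: field_simps)
    qed
    have "sqrt (c3 ^ nn) * sqrt (Re (det (mat_adjoint R * R))) = sqrt (c3 ^ nn * Re (det (mat_adjoint R * R)))"
      by (rule real_sqrt_mult[symmetric])
    also have "\<dots> \<le> sqrt ((cmod (det ?N))\<^sup>2)"
      using det_gram_comparison[OF N R iR less_imp_le[OF c3] le] by (rule real_sqrt_le_mono)
    finally show "sqrt (c3 ^ nn) * sqrt (Re (det (mat_adjoint R * R))) \<le> cmod (det ?N)" by simp
  qed
  have "full_rank El" by (rule right_inverse_full_rank[OF E(3,1,5)])
  with E(3) zero ukc show ?thesis unfolding nn_def[symmetric] by blast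
qed

end

section \<open>Reduction of the stated data to the block setting\<close>

theorem theorem4p5:
  fixes d n r np n1p n1o :: nat
    and A A11 A12 A22 :: "nat \<Rightarrow> real mat"
    and Q S B Bu Bv P1 P0 L1 :: "real mat"
  assumes "1 \<le> d" and "r \<le> n"
    and "\<And>j. j \<in> {1..d} \<Longrightarrow> A j \<in> carrier_mat n n"
    and "\<And>j. j \<in> {1..d} \<Longrightarrow> transpose_mat (A j) = A j"
    and "\<And>j. j \<in> {1..d} \<Longrightarrow> A11 j \<in> carrier_mat (n - r) (n - r)"
    and "\<And>j. j \<in> {1..d} \<Longrightarrow> A12 j \<in> carrier_mat (n - r) r"
    and "\<And>j. j \<in> {1..d} \<Longrightarrow> A22 j \<in> carrier_mat r r"
    and "\<And>j. j \<in> {1..d} \<Longrightarrow>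
           A j = four_block_mat (A11 j) (A12 j) (transpose_mat (A12 j)) (A22 j)"
    and "S \<in> carrier_mat r r" and "transpose_mat S = S" and "negative_definite S"
    and "Q = four_block_mat (0\<^sub>m (n - r) (n - r)) (0\<^sub>m (n - r) r) (0\<^sub>m r (n - r)) S"
    and "invertible_mat (A 1)" and "\<not> invertible_mat (A11 1)"
    and "np = num_pos_eigenvalues (A 1)"
    and "n1p = num_pos_eigenvalues (A11 1)"
    and "n1o = alg_mult (A11 1) 0" and "1 \<le> n1o"
    and "B \<in> carrier_mat np n" and "full_rank B"
    and "Bu \<in> carrier_mat np (n - r)" and "Bv \<in> carrier_mat np r"
    and "B = append_cols Bu Bv"
    and "P1 \<in> carrier_mat (n - r) (n - r - n1o)" and "P0 \<in> carrier_mat (n - r) n1o"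
    and "transpose_mat (append_cols P1 P0) * append_cols P1 P0 = 1\<^sub>m (n - r)"
    and "L1 \<in> carrier_mat (n - r - n1o) (n - r - n1o)"
    and "diagonal_mat L1" and "invertible_mat L1"
    and "transpose_mat (append_cols P1 P0) * A11 1 * append_cols P1 P0 =
         four_block_mat L1 (0\<^sub>m (n - r - n1o) n1o) (0\<^sub>m n1o (n - r - n1o)) (0\<^sub>m n1o n1o)"
    and "generalized_kreiss n d A Q B"
  shows "\<exists>Bo. Bo \<in> carrier_mat n1p np \<and> full_rank Bo \<and>
           Bo * Bu * P0 = 0\<^sub>m n1p n1o \<and>
           uniform_kreiss_characteristic d A11 P1 P0 L1 (Bo * Bu)"
proof -
  define k where "k = n - r"
  define m where "m = n - r - n1o"
  have nk: "k + r = n" unfolding k_def using assms(2) by simp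
  note P = assms(24,25)[folded m_def k_def]
  let ?P = "append_cols P1 P0"
  have AP: "?P \<in> carrier_mat k (m + n1o)" by (rule append_cols_carrier[OF P])
  have orth: "transpose_mat ?P * ?P = 1\<^sub>m k" using assms(26) unfolding k_def .
  \<comment> \<open>\<open>m\<close> is a truncated difference; the shape of the orthogonal matrix
    shows that nothing was cut off.\<close>
  have kml: "k = m + n1o" using arg_cong[OF orth, of dim_col] AP by simp
  have AP': "?P \<in> carrier_mat k k" using AP unfolding kml[symmetric] .
  have one: "(1\<^sub>m k :: real mat) = four_block_mat (1\<^sub>m m) (0\<^sub>m m n1o) (0\<^sub>m n1o m) (1\<^sub>m n1o)"
    unfolding kml by (intro eq_matI) auto
  have gram: "transpose_mat P1 * P1 = 1\<^sub>m m" "transpose_mat P1 * P0 = 0\<^sub>m m n1o"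
    "transpose_mat P0 * P1 = 0\<^sub>m n1o m" "transpose_mat P0 * P0 = 1\<^sub>m n1o"
    by (rule four_block_mat_eqD[OF orth[unfolded one transpose_append_cols_mult[OF P P]]]; use P in auto)+
  have orth': "?P * transpose_mat ?P = 1\<^sub>m k"
    using mat_mult_left_right_inverse[OF _ AP' orth] AP' by simp
  have one_in: "1 \<in> {1..d}" using assms(1) by simp
  have A11: "A11 1 \<in> carrier_mat k k" using assms(5)[OF one_in] unfolding k_def .
  have L1: "L1 \<in> carrier_mat m m" using assms(27) unfolding m_def .
  have AX: "A11 1 * P1 \<in> carrier_mat k m" "A11 1 * P0 \<in> carrier_mat k n1o" using A11 P by auto
  let ?F = "four_block_mat L1 (0\<^sub>m m n1o) (0\<^sub>m n1o m) (0\<^sub>m n1o n1o)"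
  have F: "transpose_mat ?P * A11 1 * ?P = ?F" using assms(30) unfolding m_def .
  have "transpose_mat ?P * A11 1 * ?P = transpose_mat ?P * (A11 1 * ?P)"
    using AP' A11 by (intro assoc_mult_mat) auto
  also have "A11 1 * ?P = append_cols (A11 1 * P1) (A11 1 * P0)" by (rule append_cols_mult_left[OF A11 P])
  finally have blk: "four_block_mat (transpose_mat P1 * (A11 1 * P1)) (transpose_mat P1 * (A11 1 * P0))
      (transpose_mat P0 * (A11 1 * P1)) (transpose_mat P0 * (A11 1 * P0)) = ?F"
    using F transpose_append_cols_mult[OF P AX] by simp
  have PT: "transpose_mat P1 \<in> carrier_mat m k" "transpose_mat P0 \<in> carrier_mat n1o k" using P by auto
  note c = mult_carrier_mat[OF PT(1) AX(1)] mult_carrier_mat[OF PT(1) AX(2)]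
    mult_carrier_mat[OF PT(2) AX(1)] mult_carrier_mat[OF PT(2) AX(2)]
  have LP: "transpose_mat P1 * (A11 1 * P1) = L1" "transpose_mat P1 * (A11 1 * P0) = 0\<^sub>m m n1o"
    "transpose_mat P0 * (A11 1 * P1) = 0\<^sub>m n1o m" "transpose_mat P0 * (A11 1 * P0) = 0\<^sub>m n1o n1o"
    using four_block_mat_eqD[OF blk c L1 zero_carrier_mat zero_carrier_mat zero_carrier_mat] .
  have diag: "L1 $$ (i,j) = 0" if "i < m" "j < m" "i \<noteq> j" for i j
    using assms(28) L1 that unfolding diagonal_mat_def by auto
  have L1sym: "transpose_mat L1 = L1"
  proof (rule eq_matI)
    fix i j assume "i < dim_row L1" "j < dim_col L1"
    then show "transpose_mat L1 $$ (i,j) = L1 $$ (i,j)" using L1 diag by (cases "i = j") auto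
  qed (use L1 in auto)
  \<comment> \<open>\<open>A11 1\<close> is orthogonally similar to the block diagonal matrix of
    \<open>L1\<close> and 0, and the zero block adds no positive eigenvalue, so the row count found
    from \<open>L1\<close> is the required one.\<close>
  have n1p: "n1p = num_pos_eigenvalues L1"
  proof -
    have Fc: "?F \<in> carrier_mat k k" unfolding kml using L1 by auto
    have "?P * ?F * transpose_mat ?P = A11 1"
    proof -
      let ?T = "transpose_mat ?P"
      have T: "?T \<in> carrier_mat k k" using AP' by simp
      have TA: "?T * A11 1 \<in> carrier_mat k k" using T A11 by auto
      have "?P * ?F * ?T = ?P * ((?T * A11 1) * (?P * ?T))"
        unfolding F[symmetric] assoc_mult_mat[OF TA AP' T, symmetric]
        using AP' T TA by (intro assoc_mult_mat) auto
      also have "\<dots> = ?P * (?T * A11 1)" unfolding orth' right_mult_one_mat[OF TA] ..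
      also have "\<dots> = (?P * ?T) * A11 1" using AP' T A11 by (intro assoc_mult_mat[symmetric]) auto
      finally show ?thesis unfolding orth' left_mult_one_mat[OF A11] .
    qed
    then have "similar_mat_wit (A11 1) ?F ?P (transpose_mat ?P)"
      using orth orth' A11 Fc AP' by (intro similar_mat_witI[of _ _ k]) auto
    then have "char_poly (A11 1) = char_poly ?F" by (intro char_poly_similar) (auto simp: similar_mat_def)
    also have "upper_triangular ?F"
      unfolding upper_triangular_def using L1 diag by auto
    then have "char_poly ?F = (\<Prod>a\<leftarrow>diag_mat ?F. [:- a, 1:])" by (rule char_poly_upper_triangular[OF Fc])
    also have "diag_mat ?F = diag_mat L1 @ diag_mat (0\<^sub>m n1o n1o)"
      using L1 by (intro diag_four_block_mat) auto
    finally have "num_pos_eigenvalues (A11 1) = length (filter (\<lambda>z. 0 < z) (diag_mat L1 @ diag_mat (0\<^sub>m n1o n1o)))"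
      by (rule num_pos_eigenvalues_eq[OF A11])
    also have "\<dots> = length (filter (\<lambda>z. 0 < z) (diag_mat L1))" by (simp add: diag_mat_def filter_map o_def)
    also have "\<dots> = num_pos_eigenvalues L1"
      using L1 diag by (intro num_pos_eigenvalues_eq[OF L1, symmetric] char_poly_upper_triangular[OF L1])
        (auto simp: upper_triangular_def)
    finally show ?thesis using assms(16) by simp
  qed
  have A1: "A 1 \<in> carrier_mat n n" using assms(3)[OF one_in] .
  obtain Jr where Jr: "Jr \<in> carrier_mat n n" "A 1 * Jr = 1\<^sub>m n" "Jr * A 1 = 1\<^sub>m n"
    using invertible_mat_obtain_inverse[OF A1 assms(13)] .
  have A11_block: "A j $$ (a,b) = A11 j $$ (a,b)" if j: "j \<in> {1..d}" and ab: "a < k" "b < k" for j a b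
    using ab assms(5,7)[OF j] unfolding assms(8)[OF j] k_def by auto
  have Bu: "B * top_embed n k = Bu"
  proof -
    have "B * top_embed n k = mat np k (\<lambda>(i,j). B $$ (i,j))"
      using assms(19) nk by (intro mult_top_embed) auto
    also have "\<dots> = Bu" unfolding assms(23) append_cols_def using assms(21,22) unfolding k_def
      by (intro eq_matI) auto
    finally show ?thesis .
  qed
  have complete: "P1 * transpose_mat P1 + P0 * transpose_mat P0 = 1\<^sub>m k"
    using append_cols_mult_transpose[OF P] orth' by simp
  interpret relaxation_system k r m n1o d np A A11 S P1 P0 L1 Jr Q B Bu
    by (rule relaxation_system.intro)
      (use assms nk Jr A11_block gram complete LP L1 L1sym P Bu in \<open>simp_all add: k_def[symmetric]\<close>)
  show ?thesis using reduced_boundary_condition unfolding n1p .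
qed

end
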